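(* Let $F(x,y,z)=a(z)xy+b(z)x^2g(y)+h(y,z)\in\mathbb{Z}[x,y,z]$, where $a(z),b(z)$ are any non-zero polynomials, $g(y)$ is any polynomial of degree at least two and $h(y,z)$ is an arbitrary polynomial. For each prime $p$ let $f_p:\mathbb{F}_p^3\to\{-1,1\}$ be defined by $f_p(x,y,z)=\mathrm{sgn}\,\sin\left(\frac{2\pi F(x,y,z)}{p}\right)$. Then there exists $\delta>0$ such that the $3$-source $(f_p)_p$ has entropy at most $1/2-\delta$ and has exponential distribution, the latter meaning that for every $\alpha\in(1/2-\delta,1)$ there is $\gamma'=\gamma'(\alpha)>0$ such that, for all subsets $A,B,C$ of $\mathbb{F}_p$ with $|A|,|B|,|C|\asymp p^\alpha$, $$\sum_{(x,y,z)\in A\times B\times C}f_p(x,y,z)=O\big(p^{-\gamma'}|A||B||C|\big)\qquad\text{as } p\to+\infty.$$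
   Context: $\mathbb{F}_p$ is the field with $p$ elements and $F$ is evaluated on $\mathbb{F}_p^3$ by reduction modulo $p$ (the value of $\sin(2\pi t/p)$ depends only on $t$ modulo $p$). When the sine vanishes, $\mathrm{sgn}(0)$ is given a fixed value in $\{-1,1\}$, so that $f_p$ takes values in $\{-1,1\}$. The entropy of a $k$-source $f=(f_p)_p$, $f_p:\mathbb{F}_p^k\to\{-1,1\}$, is the infimum of the $\alpha>0$ such that for any subsets $A_1,\dots,A_k$ of $\mathbb{F}_p$ each with cardinality at least $p^\alpha$ one has $\sum_{a_j\in A_j,\,j=1,\dots,k}f_p(a_1,\dots,a_k)=o\big(\prod_{j=1}^k|A_j|\big)$ as $p\to+\infty$ (uniformly in the choice of the sets). If the entropy is less than $1$, $f$ is called a $k$-source extractor. The condition $|A|,|B|,|C|\asymp p^\alpha$ means $L_1p^\alpha\le|A|,|B|,|C|\le L_2p^\alpha$ for fixed positive constants $L_1\le L_2$; the $O$-constant is independent of $p,A,B,C$ (it may depend on $F,\alpha,L_1,L_2$). *)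

theory Defs
  imports Complex_Main "HOL-Computational_Algebra.Polynomial" "HOL-Number_Theory.Residues"
begin

text \<open>The field with \<open>p\<close> elements is given by the representatives \<open>0, \<dots>, p - 1\<close>.\<close>

abbreviation prime_field :: "nat \<Rightarrow> int set" where
  "prime_field p \<equiv> carrier (residue_ring (int p))"

definition primes_at_top :: "nat filter" where
  "primes_at_top = inf at_top (principal {p. prime p})"

text \<open>
  A family \<open>f\<close> of functions on \<open>k\<close>-tuples over the prime fields takes the tuple as a list of
  length \<open>k\<close>. The bound below is uniform in the sets, since \<open>p\<close> is chosen before \<open>As\<close>.
\<close>

definition is_source :: "nat \<Rightarrow> (nat \<Rightarrow> int list \<Rightarrow> real) \<Rightarrow> bool" where
  "is_source k f \<longleftrightarrow>
     (\<forall>p v. prime p \<and> length v = k \<and> set v \<subseteq> prime_field p \<longrightarrow> f p v \<in> {-1, 1})"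

definition cancels_at :: "nat \<Rightarrow> (nat \<Rightarrow> int list \<Rightarrow> real) \<Rightarrow> real \<Rightarrow> bool" where
  "cancels_at k f \<alpha> \<longleftrightarrow>
     (\<forall>\<epsilon>>0. \<forall>\<^sub>F p in primes_at_top. \<forall>As.
        length As = k \<and> (\<forall>A\<in>set As. A \<subseteq> prime_field p \<and> real p powr \<alpha> \<le> real (card A)) \<longrightarrow>
        \<bar>\<Sum>v\<in>listset As. f p v\<bar> \<le> \<epsilon> * (\<Prod>A\<leftarrow>As. real (card A)))"

text \<open>
  The set is bounded below by \<open>0\<close> and contains every \<open>\<alpha> > 1\<close> (for \<open>k > 0\<close>), where the
  condition is void.
\<close>

definition entropy :: "nat \<Rightarrow> (nat \<Rightarrow> int list \<Rightarrow> real) \<Rightarrow> real" where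
  "entropy k f = Inf {\<alpha>. \<alpha> > 0 \<and> cancels_at k f \<alpha>}"

text \<open>An element \<open>h\<close> of \<open>\<int>[z][y]\<close>: the outer variable is \<open>y\<close>, the coefficients are polynomials in \<open>z\<close>.\<close>

definition poly_yz :: "int poly poly \<Rightarrow> int \<Rightarrow> int \<Rightarrow> int" where
  "poly_yz h y z = poly (poly h [:y:]) z"

definition F_eval ::
    "int poly \<Rightarrow> int poly \<Rightarrow> int poly \<Rightarrow> int poly poly \<Rightarrow> int \<Rightarrow> int \<Rightarrow> int \<Rightarrow> int" where
  "F_eval a b g h x y z = poly a z * x * y + poly b z * x\<^sup>2 * poly g y + poly_yz h y z"

text \<open>The sign function with the value at \<open>0\<close> replaced by \<open>s\<close>.\<close>

definition sgn_at0 :: "real \<Rightarrow> real \<Rightarrow> real" where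
  "sgn_at0 s t = (if t = 0 then s else sgn t)"

definition sine_source :: "real \<Rightarrow> (int \<Rightarrow> int \<Rightarrow> int \<Rightarrow> int) \<Rightarrow> nat \<Rightarrow> int list \<Rightarrow> real" where
  "sine_source s F p v =
     sgn_at0 s (sin (2 * pi * real_of_int (F (v ! 0) (v ! 1) (v ! 2) mod int p) / real p))"

lemma is_source_sine_source:
  assumes "s \<in> {-1, 1}"
  shows "is_source 3 (sine_source s F)"
  using assms by (auto simp: is_source_def sine_source_def sgn_at0_def sgn_real_def)

end

theory Submission
  imports Defs "HOL-Library.Set_Algebras" "HOL-Number_Theory.Modular_Inverse" "HOL-Analysis.Analysis"
    "HOL-Real_Asymp.Real_Asymp"
begin

text \<open>
  Write \<open>e(n)\<close> for the character \<open>exp (2 \<pi> i n / p)\<close>. As a function on \<open>\<int> / p\<close> the sign of the sine has a mean of order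
  \<open>1 / p\<close> and Fourier coefficients with absolute sum \<open>O(ln p)\<close>. It is therefore enough to save a power of
  \<open>p\<close> in the sums of \<open>e(r F(x, y, z))\<close> with \<open>r\<close> prime to \<open>p\<close>. Fix \<open>z\<close> outside the boundedly many zeros
  of \<open>a\<close> and \<open>b\<close>. The term \<open>h\<close> disappears in the absolute value of the inner sum over \<open>x\<close>, and what remains is the
  sum over \<open>y \<in> B\<close> of the absolute values of the sums over \<open>x \<in> A\<close> of \<open>e(\<alpha> x y + \<beta> x\<^sup>2 g(y))\<close>, with units \<open>\<alpha>\<close>, \<open>\<beta>\<close> and sets of at
  least \<open>p\<^bsup>1/2 - \<delta>\<^esup>\<close> elements.

  This is a bilinear form in the points \<open>(x, x\<^sup>2)\<close> of a parabola and the points \<open>(\<alpha> y, \<beta> g(y))\<close> of another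
  curve. Hoelder's inequality bounds it by the additive energies of the two sets of points
  (\<open>bilinear_sum_power16\<close>). For the curve, elementary counting of roots gives the best possible bound \<open>O(|B|\<^sup>2)\<close>
  (\<open>curve_energy\<close>). For the parabola let \<open>J(A)\<close> be the number of solutions of
  \<open>x1 + x2 - x3 = x4 + x5 - x6\<close> and of the same equation for the squares. The trivial bound \<open>O(|A|\<^sup>4)\<close> makes the estimate
  exactly useless at \<open>|A| = |B| = p\<^bsup>1/2\<^esup>\<close>. So any improvement \<open>J(A) = O(|A|\<^bsup>4 - c\<^esup>)\<close> with \<open>c > 0\<close> gives
  cancellation somewhat below \<open>p\<^bsup>1/2\<^esup>\<close>, and larger sets are cut into pieces of this size.

  The improvement is an incidence statement. If \<open>x + y - z = u\<close> and \<open>x\<^sup>2 + y\<^sup>2 - z\<^sup>2 = v\<close> with \<open>z\<close> different from \<open>x\<close> and \<open>y\<close>, then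
  \<open>1 / (z - x) = 2 (x - u) / (u\<^sup>2 - v)\<close>: all these points \<open>(x, 1 / (z - x))\<close> lie on one line, the line of
  \<open>(u, v)\<close>. If \<open>J(A) \<ge> |A|\<^sup>4 / K\<close>, about \<open>|A|\<^sup>2\<close> lines contain about \<open>|A|\<close> of these points, up to powers of \<open>K\<close>.
  Parametrizing the lines by their heights \<open>s\<close>, \<open>t\<close> over two suitable abscissas, one finds for many further abscissas
  that a combination \<open>s + m t\<close> takes only \<open>|A|\<close> values on a dense set of pairs
  (\<open>parabola_energy_dichotomy\<close>). The Balog--Szemeredi--Gowers theorem and Ruzsa's triangle inequality produce
  one set \<open>Y\<close> and many multipliers \<open>m\<close> for which \<open>Y - m Y\<close> is not much larger than \<open>Y\<close>
  (\<open>partial_sumsets_small\<close>). By the sum-product phenomenon in \<open>\<int> / p\<close>, which has no proper subfields, this is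
  impossible (\<open>sum_product_dilates\<close>) unless \<open>K\<close> is at least a small power of \<open>|A|\<close>.
\<close>

section \<open>Sumsets in abelian groups\<close>

definition diffset :: "'a::ab_group_add set \<Rightarrow> 'a set \<Rightarrow> 'a set" (infixl \<open>-\<^sub>s\<close> 65) where
  "A -\<^sub>s B = (\<lambda>(a, b). a - b) ` (A \<times> B)"

lemma finite_diffset: "finite A \<Longrightarrow> finite B \<Longrightarrow> finite (A -\<^sub>s B)"
  by (simp add: diffset_def)

text \<open>
  Each difference \<open>a - c\<close>, written once and for all with fixed \<open>a\<close> and \<open>c\<close>, splits as
  \<open>(a - b) + (b - c)\<close> in \<open>card B\<close> ways; the two summands determine \<open>a - c\<close>, hence \<open>a\<close>, \<open>c\<close> and \<open>b\<close>.
\<close>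

lemma ruzsa_triangle:
  fixes A B C :: "'a::ab_group_add set"
  assumes "finite A" "finite B" "finite C"
  shows "card (A -\<^sub>s C) * card B \<le> card (A -\<^sub>s B) * card (B -\<^sub>s C)"
proof -
  have "\<forall>d\<in>A -\<^sub>s C. \<exists>ac. fst ac \<in> A \<and> snd ac \<in> C \<and> d = fst ac - snd ac"
    by (auto simp: diffset_def)
  then obtain s where s: "\<And>d. d \<in> A -\<^sub>s C \<Longrightarrow> fst (s d) \<in> A \<and> snd (s d) \<in> C \<and> d = fst (s d) - snd (s d)"
    by metis
  let ?f = "\<lambda>(d, b). (fst (s d) - b, b - snd (s d))"
  have "inj_on ?f ((A -\<^sub>s C) \<times> B)"
  proof (rule inj_onI, clarsimp)
    fix d b d' b'
    assume d: "d \<in> A -\<^sub>s C" "d' \<in> A -\<^sub>s C"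
      and e: "fst (s d) - b = fst (s d') - b'" "b - snd (s d) = b' - snd (s d')"
    have "d = (fst (s d) - b) + (b - snd (s d))"
      using s[OF d(1)] by simp
    also have "\<dots> = d'"
      unfolding e using s[OF d(2)] by simp
    finally show "d = d' \<and> b = b'"
      using e by auto
  qed
  moreover have "?f ` ((A -\<^sub>s C) \<times> B) \<subseteq> (A -\<^sub>s B) \<times> (B -\<^sub>s C)"
    using s by (force simp: diffset_def)
  ultimately have "card ((A -\<^sub>s C) \<times> B) \<le> card ((A -\<^sub>s B) \<times> (B -\<^sub>s C))"
    using assms by (intro card_inj_on_le[of ?f]) (auto simp: finite_diffset)
  then show ?thesis
    by (simp add: card_cartesian_product)
qed

lemma card_plus_singleton: "card (A + {c :: 'a::ab_group_add}) = card A"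
proof -
  have "A + {c} = (\<lambda>a. a + c) ` A"
    by (auto simp: set_plus_def)
  then show ?thesis
    by (simp add: card_image inj_on_def)
qed

text \<open>
  Petridis' form of Pluennecke's inequality: a subset that grows least when \<open>B\<close> is added does not
  grow more, relatively, after a further set \<open>C\<close> is added. The elements of \<open>C\<close> are added one at a time. A
  new element \<open>c\<close> contributes to \<open>X + B + C\<close> at most the part of \<open>X + B + c\<close> outside \<open>Z + B + c\<close>, where \<open>Z\<close>
  collects the \<open>z\<close> whose translates \<open>z + B + c\<close> are already covered; minimality bounds \<open>Z + B\<close> from below.
\<close>

lemma petridis:
  fixes X B C :: "'a::ab_group_add set"
  assumes fin: "finite X" "finite B" "finite C"
    and min: "\<And>Z. Z \<subseteq> X \<Longrightarrow> card (X + B) * card Z \<le> card (Z + B) * card X"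
  shows "card (X + B + C) * card X \<le> card (X + B) * card (X + C)"
  using \<open>finite C\<close>
proof (induction C rule: finite_induct)
  case empty
  have "X + B + {} = {}"
    by (auto simp: set_plus_def)
  then show ?case
    by simp
next
  case (insert c C)
  \<comment> \<open>the elements whose contribution to the new sumset is already present\<close>
  define Z where "Z = {z \<in> X. \<forall>b\<in>B. z + b + c \<in> X + B + C}"
  have Z: "Z \<subseteq> X"
    by (auto simp: Z_def)
  have "finite Z"
    using Z fin finite_subset by blast
  note fin = fin this insert.hyps(1)
  have "X + B + insert c C \<subseteq> (X + B + C) \<union> ((X + B + {c}) - (Z + B + {c}))"
  proof
    fix t assume "t \<in> X + B + insert c C"
    then obtain x b e where t: "t = x + b + e" "x \<in> X" "b \<in> B" "e \<in> insert c C"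
      by (auto simp: set_plus_def)
    show "t \<in> (X + B + C) \<union> ((X + B + {c}) - (Z + B + {c}))"
    proof (cases "t \<in> X + B + C")
      case False
      then have "e = c"
        using t by (auto intro!: set_plus_intro)
      then have "t \<in> X + B + {c}"
        using t by (auto intro!: set_plus_intro)
      moreover have "t \<notin> Z + B + {c}"
      proof
        assume "t \<in> Z + B + {c}"
        then obtain z b' where "z \<in> Z" "b' \<in> B" "t = z + b' + c"
          by (auto simp: set_plus_def)
        then show False
          using False by (auto simp: Z_def)
      qed
      ultimately show ?thesis
        by blast
    qed simp
  qed
  then have "card (X + B + insert c C) \<le> card (X + B + C) + card ((X + B + {c}) - (Z + B + {c}))"
    using fin by (intro order_trans[OF card_mono card_Un_le]) (auto intro!: finite_set_plus)
  also have "card ((X + B + {c}) - (Z + B + {c})) = card (X + B) - card (Z + B)"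
  proof (subst card_Diff_subset)
    show "Z + B + {c} \<subseteq> X + B + {c}"
      using Z by (intro set_plus_mono2) auto
  qed (use fin in \<open>auto intro!: finite_set_plus simp: card_plus_singleton\<close>)
  finally have 1: "card (X + B + insert c C) \<le> card (X + B + C) + (card (X + B) - card (Z + B))" .
  have "(X + C) \<inter> ((X - Z) + {c}) = {}"
  proof (rule ccontr)
    assume "\<not> ?thesis"
    then obtain x where x: "x \<in> X" "x \<notin> Z" "x + c \<in> X + C"
      by (auto simp: set_plus_def[of "X - Z"])
    have "x + b + c \<in> X + B + C" if "b \<in> B" for b
    proof -
      have "(x + c) + b \<in> X + C + B"
        using x that by blast
      then show ?thesis
        by (simp add: ac_simps)
    qed
    then show False
      using x by (auto simp: Z_def)
  qed
  then have "card (X + C) + card ((X - Z) + {c}) = card ((X + C) \<union> ((X - Z) + {c}))"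
    using fin by (subst card_Un_disjoint) (auto intro!: finite_set_plus)
  also have "\<dots> \<le> card (X + insert c C)"
    using fin by (intro card_mono) (auto intro!: finite_set_plus simp: set_plus_def)
  finally have 2: "card (X + C) + (card X - card Z) \<le> card (X + insert c C)"
    using fin Z by (simp add: card_plus_singleton card_Diff_subset)
  have 3: "card (Z + B) \<le> card (X + B)" "card Z \<le> card X"
    using fin Z set_plus_mono2[OF Z order_refl[of B]] by (auto intro!: card_mono finite_set_plus)
  have "int (card (X + B + insert c C)) * int (card X)
      \<le> (int (card (X + B + C)) + int (card (X + B)) - int (card (Z + B))) * int (card X)"
    using 1 3 by (intro mult_right_mono) auto
  also have "\<dots> \<le> int (card (X + B)) * (int (card (X + C)) + int (card X) - int (card Z))"
    using min[OF Z] insert.IH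
    unfolding left_diff_distrib distrib_right right_diff_distrib distrib_left
    by (simp flip: of_nat_mult of_nat_add)
  also have "\<dots> \<le> int (card (X + B)) * int (card (X + insert c C))"
    using 2 3 by (intro mult_left_mono) auto
  finally show ?case
    by (simp flip: of_nat_mult)
qed

definition nfold :: "nat \<Rightarrow> 'a::ab_group_add set \<Rightarrow> 'a set" where
  "nfold n B = ((+) B ^^ n) {0}"

lemma finite_nfold: "finite B \<Longrightarrow> finite (nfold n B)"
  by (induction n) (auto simp: nfold_def intro!: finite_set_plus)

lemma nfold_Suc_I: "b \<in> B \<Longrightarrow> s \<in> nfold n B \<Longrightarrow> b + s \<in> nfold (Suc n) B"
  by (auto simp: nfold_def)

lemma nfold_0_I: "0 \<in> nfold 0 B"
  by (simp add: nfold_def)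

text \<open>
  The minimizing subset \<open>X\<close> of the previous lemma grows by the factor \<open>K\<close> at most at each addition
  of \<open>B\<close>. Ruzsa's triangle inequality through \<open>- X\<close> then eliminates \<open>X\<close> and turns sums into differences.
\<close>

lemma plunnecke:
  fixes A B :: "'a::ab_group_add set" and K :: real
  assumes fin: "finite A" "finite B" and "A \<noteq> {}"
    and small: "real (card (A + B)) \<le> K * card A"
  shows "real (card (nfold n B -\<^sub>s nfold m B)) \<le> K ^ (n + m) * card A"
proof -
  have "finite (Pow A - {{}})" "Pow A - {{}} \<noteq> {}"
    using assms by auto
  from ex_is_arg_min_if_finite[OF this, of "\<lambda>X. real (card (X + B)) / card X"]
  obtain X where X: "X \<subseteq> A" "X \<noteq> {}"
    and min: "\<And>Z. Z \<subseteq> A \<Longrightarrow> Z \<noteq> {} \<Longrightarrow>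
      real (card (X + B)) / card X \<le> real (card (Z + B)) / card Z"
    unfolding is_arg_min_linorder by auto
  have finX: "finite X"
    using X fin finite_subset by blast
  have posX: "card X > 0" and posA: "card A > 0"
    using X finX assms by (auto simp: card_gt_0_iff)
  have "real (card (X + B)) / card X \<le> K"
    using min[of A] assms posA by (intro order_trans[OF min[of A]]) (auto simp: pos_divide_le_eq)
  then have XB: "real (card (X + B)) \<le> K * card X"
    using posX by (simp add: field_simps)
  have K: "K \<ge> 0"
  proof (rule ccontr)
    assume "\<not> K \<ge> 0"
    then have "K * card A < 0"
      using posA by (simp add: mult_neg_pos)
    then show False
      using small by linarith
  qed
  have pet: "card (X + B + C) * card X \<le> card (X + B) * card (X + C)" if "finite C" for C
  proof (rule petridis[OF finX fin(2) that])
    fix Z assume Z: "Z \<subseteq> X"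
    show "card (X + B) * card Z \<le> card (Z + B) * card X"
    proof (cases "Z = {}")
      case False
      then have "card Z > 0"
        using Z finX by (auto simp: card_gt_0_iff dest: finite_subset)
      then have "real (card (X + B) * card Z) \<le> real (card (Z + B) * card X)"
        using min[of Z] Z X False posX by (simp add: field_simps)
      then show ?thesis
        by (simp only: of_nat_le_iff)
    qed simp
  qed
  have growth: "real (card (X + nfold n B)) \<le> K ^ n * card X" for n
  proof (induction n)
    case 0
    then show ?case
      by (simp add: nfold_def card_plus_singleton)
  next
    case (Suc n)
    have eq: "X + nfold (Suc n) B = X + B + nfold n B"
      by (simp add: nfold_def ac_simps)
    have "real (card (X + B + nfold n B)) * card X \<le> real (card (X + B)) * card (X + nfold n B)"
      using pet[of "nfold n B"] finite_nfold[of B n] fin by (simp flip: of_nat_mult)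
    also have "\<dots> \<le> (K * card X) * (K ^ n * card X)"
      using XB Suc.IH K by (intro mult_mono) auto
    finally show ?case
      using posX by (simp add: eq)
  qed
  let ?Y = "uminus ` X"
  have cY: "card ?Y = card X"
    by (simp add: card_image)
  have "nfold n B -\<^sub>s ?Y = X + nfold n B"
  proof -
    have "nfold n B -\<^sub>s ?Y = nfold n B + X"
      by (force simp: diffset_def set_plus_def)
    then show ?thesis
      by (simp add: ac_simps)
  qed
  moreover have "?Y -\<^sub>s nfold m B = uminus ` (X + nfold m B)"
  proof -
    have "?Y -\<^sub>s nfold m B = (\<lambda>(x, s). - x - s) ` (X \<times> nfold m B)"
      by (force simp: diffset_def)
    also have "\<dots> = uminus ` (X + nfold m B)"
      by (auto simp: set_plus_image image_image case_prod_beta)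
    finally show ?thesis .
  qed
  ultimately have "card (nfold n B -\<^sub>s nfold m B) * card X
      \<le> card (X + nfold n B) * card (X + nfold m B)"
    using ruzsa_triangle[of "nfold n B" ?Y "nfold m B"] finX fin finite_nfold[of B] cY
    by (simp add: card_image)
  then have "real (card (nfold n B -\<^sub>s nfold m B)) * card X
      \<le> real (card (X + nfold n B)) * card (X + nfold m B)"
    by (simp flip: of_nat_mult)
  also have "\<dots> \<le> (K ^ n * card X) * (K ^ m * card X)"
    using growth K by (intro mult_mono) auto
  finally have "real (card (nfold n B -\<^sub>s nfold m B)) \<le> K ^ (n + m) * card X"
    using posX by (simp add: power_add)
  also have "\<dots> \<le> K ^ (n + m) * card A"
    using X fin K by (intro mult_left_mono) (auto intro!: card_mono)
  finally show ?thesis .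
qed

section \<open>Dense bipartite graphs and partial sumsets\<close>

lemma sum_power2_le: 
  fixes f :: "'a \<Rightarrow> real"
  assumes "finite S"
  shows "(\<Sum>s\<in>S. f s)\<^sup>2 \<le> card S * (\<Sum>s\<in>S. (f s)\<^sup>2)"
  using sum_squared_le_sum_of_squares[of f S] by (simp add: mult.commute)

lemma card_eq_sum_fibres:
  assumes "finite A" "finite B" "E \<subseteq> A \<times> B"
  shows "card E = (\<Sum>b\<in>B. card {a\<in>A. (a, b) \<in> E})"
    and "card E = (\<Sum>a\<in>A. card {b\<in>B. (a, b) \<in> E})"
proof -
  have E: "finite E"
    using assms finite_subset by blast
  have "card E = card (\<Union>b\<in>B. (\<lambda>a. (a, b)) ` {a\<in>A. (a, b) \<in> E})"
    using assms by (intro arg_cong[where f = card]) auto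
  also have "\<dots> = (\<Sum>b\<in>B. card ((\<lambda>a. (a, b)) ` {a\<in>A. (a, b) \<in> E}))"
    using assms by (intro card_UN_disjoint) auto
  finally show "card E = (\<Sum>b\<in>B. card {a\<in>A. (a, b) \<in> E})"
    by (simp add: card_image inj_on_def)
  have "card E = card (\<Union>a\<in>A. Pair a ` {b\<in>B. (a, b) \<in> E})"
    using assms by (intro arg_cong[where f = card]) auto
  also have "\<dots> = (\<Sum>a\<in>A. card (Pair a ` {b\<in>B. (a, b) \<in> E}))"
    using assms by (intro card_UN_disjoint) auto
  finally show "card E = (\<Sum>a\<in>A. card {b\<in>B. (a, b) \<in> E})"
    by (simp add: card_image inj_on_def)
qed

definition collisions :: "('a \<Rightarrow> 'b) \<Rightarrow> 'a set \<Rightarrow> ('a \<times> 'a) set" where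
  "collisions f S = {(s, t). s \<in> S \<and> t \<in> S \<and> f s = f t}"

lemma finite_collisions: "finite S \<Longrightarrow> finite (collisions f S)"
  by (rule finite_subset[of _ "S \<times> S"]) (auto simp: collisions_def)

lemma card_collisions:
  assumes "finite S"
  shows "card (collisions f S) = (\<Sum>v\<in>f ` S. (card {s\<in>S. f s = v})\<^sup>2)"
proof -
  have "collisions f S = (\<Union>v\<in>f ` S. {s\<in>S. f s = v} \<times> {s\<in>S. f s = v})"
    by (auto simp: collisions_def)
  also have "card \<dots> = (\<Sum>v\<in>f ` S. card ({s\<in>S. f s = v} \<times> {s\<in>S. f s = v}))"
    using assms by (intro card_UN_disjoint) auto
  finally show ?thesis
    by (simp add: card_cartesian_product power2_eq_square)
qed

lemma card_eq_sum_fibres_of_map: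
  assumes "finite S"
  shows "card S = (\<Sum>v\<in>f ` S. card {s\<in>S. f s = v})"
proof -
  have "{a \<in> S. (a, v) \<in> (\<lambda>s. (s, f s)) ` S} = {s \<in> S. f s = v}" for v
    by auto
  then show ?thesis
    using card_eq_sum_fibres(1)[of S "f ` S" "(\<lambda>s. (s, f s)) ` S"] assms
    by (simp add: card_image inj_on_def image_subset_iff)
qed

text \<open>
  Vertices of degree below \<open>N / (2 * K)\<close> carry at most \<open>N\<^sup>2 / (2 * K)\<close> edges.
\<close>

lemma dense_graph_pruned:
  fixes N K :: real
  assumes fin: "finite A" "finite B" and "E \<subseteq> A \<times> B"
    and N: "N > 0" "real (card A) \<le> N" "real (card B) \<le> N"
    and K: "K > 0" and E: "N\<^sup>2 / K \<le> real (card E)"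
  obtains A' where "A' \<subseteq> A" "N\<^sup>2 / (2 * K) \<le> real (card (E \<inter> A' \<times> B))"
    "\<And>a. a \<in> A' \<Longrightarrow> N / (2 * K) \<le> real (card {b\<in>B. (a, b) \<in> E})"
proof
  let ?d = "\<lambda>a. card {b\<in>B. (a, b) \<in> E}"
  define A' where "A' = {a\<in>A. N / (2 * K) \<le> real (?d a)}"
  show "A' \<subseteq> A"
    by (auto simp: A'_def)
  show "N / (2 * K) \<le> real (?d a)" if "a \<in> A'" for a
    using that by (simp add: A'_def)
  have A': "finite A'"
    using fin by (simp add: A'_def)
  have "card E = (\<Sum>a\<in>A'. ?d a) + (\<Sum>a\<in>A - A'. ?d a)"
    using card_eq_sum_fibres(2)[of A B E] assms sum.subset_diff[of A' A ?d]
    by (simp add: A'_def)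
  moreover have "(\<Sum>a\<in>A'. ?d a) = card (E \<inter> A' \<times> B)"
    using card_eq_sum_fibres(2)[of A' B "E \<inter> A' \<times> B"] A' fin by (simp add: conj_commute cong: conj_cong)
  moreover have "real (\<Sum>a\<in>A - A'. ?d a) \<le> (\<Sum>a\<in>A - A'. N / (2 * K))"
    unfolding of_nat_sum by (intro sum_mono) (auto simp: A'_def)
  moreover have "(\<Sum>a\<in>A - A'. N / (2 * K)) \<le> N * (N / (2 * K))"
    using N K fin card_mono[of A "A - A'"] by (auto intro!: mult_right_mono divide_right_mono)
  ultimately have "N\<^sup>2 / K \<le> real (card (E \<inter> A' \<times> B)) + N * (N / (2 * K))"
    using E by linarith
  then show "N\<^sup>2 / (2 * K) \<le> real (card (E \<inter> A' \<times> B))"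
    using K by (simp add: field_simps power2_eq_square)
qed

text \<open>
  The graph part of the Balog--Szemeredi--Gowers theorem. Call a pair in \<open>A\<close> bad if it has few common
  neighbours. A bad pair lies in few neighbourhoods of vertices of \<open>B\<close>, so by averaging some
  neighbourhood \<open>A1\<close> is large and contains few bad pairs. Keep in \<open>A'\<close> the vertices of \<open>A1\<close> with few bad
  partners and in \<open>B'\<close> the vertices with many neighbours in \<open>A1\<close>: a path from \<open>a\<close> to \<open>b\<close> goes first to a
  neighbour \<open>a1\<close> of \<open>b\<close> in \<open>A1\<close> that is not a bad partner of \<open>a\<close>, and then to \<open>a\<close> through a common neighbour.
\<close>

lemma paths_of_length_three_aux:
  fixes N K :: real
  assumes fin: "finite A" "finite B" and EAB: "E \<subseteq> A \<times> B"
    and N: "N > 0" "real (card A) \<le> N" "real (card B) \<le> N"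
    and K: "K > 0" and E: "N\<^sup>2 / K \<le> real (card E)"
    and deg: "\<And>a. a \<in> A \<Longrightarrow> N / K \<le> real (card {b\<in>B. (a, b) \<in> E})"
  obtains A' B' where "A' \<subseteq> A" "B' \<subseteq> B" "N / (4 * K) \<le> real (card A')" "N / (2 * K) \<le> real (card B')"
    "\<And>a b. a \<in> A' \<Longrightarrow> b \<in> B' \<Longrightarrow>
      N\<^sup>2 / (128 * K ^ 5) \<le> real (card {(b1, a1). (a, b1) \<in> E \<and> (a1, b1) \<in> E \<and> (a1, b) \<in> E})"
proof -
  define nb where "nb b = {a\<in>A. (a, b) \<in> E}" for b
  define cm where "cm a a' = {b\<in>B. (a, b) \<in> E \<and> (a', b) \<in> E}" for a a'
  \<comment> \<open>this threshold makes the bad pairs weigh half of the second moment in the averaging below\<close>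
  define bad where "bad a a' \<longleftrightarrow> real (card (cm a a')) < N / (16 * K ^ 3)" for a a'
  define bp where "bp b = {(a, a'). a \<in> nb b \<and> a' \<in> nb b \<and> bad a a'}" for b
  have finnb [simp]: "finite (nb b)" for b
    using fin by (simp add: nb_def)
  have "bp b \<subseteq> nb b \<times> nb b" for b
    by (auto simp: bp_def)
  then have finbp [simp]: "finite (bp b)" for b
    using finnb finite_subset by blast
  have sumnb: "real (card E) = (\<Sum>b\<in>B. real (card (nb b)))"
    using card_eq_sum_fibres(1)[of A B E] fin EAB by (simp add: nb_def)
  have "(N\<^sup>2 / K)\<^sup>2 \<le> (real (card E))\<^sup>2"
    using E K by (intro power_mono) auto
  also have "\<dots> \<le> card B * (\<Sum>b\<in>B. (real (card (nb b)))\<^sup>2)"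
    unfolding sumnb using fin by (intro sum_power2_le)
  also have "\<dots> \<le> N * (\<Sum>b\<in>B. (real (card (nb b)))\<^sup>2)"
    using N by (intro mult_right_mono sum_nonneg) auto
  finally have sq: "N ^ 3 / K\<^sup>2 \<le> (\<Sum>b\<in>B. (real (card (nb b)))\<^sup>2)"
    using N K by (simp add: field_simps eval_nat_numeral)
  have "(\<Sum>b\<in>B. real (card (bp b))) = real (card {((a, a'), b). (a, a') \<in> A \<times> A \<and> b \<in> B \<and> (a, b) \<in> E \<and> (a', b) \<in> E \<and> bad a a'})"
    (is "_ = real (card ?T)")
  proof -
    have "?T \<subseteq> (A \<times> A) \<times> B"
      by auto
    from card_eq_sum_fibres(1)[OF _ fin(2) this] fin
    have "card ?T = (\<Sum>b\<in>B. card {x \<in> A \<times> A. (x, b) \<in> ?T})"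
      by blast
    also have "\<dots> = (\<Sum>b\<in>B. card (bp b))"
      using EAB by (intro sum.cong refl arg_cong[where f = card]) (auto simp: bp_def nb_def)
    finally show ?thesis
      by simp
  qed
  also have "real (card ?T) \<le> N\<^sup>2 * (N / (16 * K ^ 3))"
  proof -
    have "?T \<subseteq> (A \<times> A) \<times> B"
      by auto
    from card_eq_sum_fibres(2)[OF _ fin(2) this] fin
    have "real (card ?T) = (\<Sum>x\<in>A \<times> A. real (card {b \<in> B. (x, b) \<in> ?T}))"
      by simp
    also have "\<dots> \<le> (\<Sum>x\<in>A \<times> A. N / (16 * K ^ 3))"
    proof (rule sum_mono)
      fix x assume "x \<in> A \<times> A"
      then obtain a a' where x: "x = (a, a')" "a \<in> A" "a' \<in> A"
        by auto
      show "real (card {b \<in> B. (x, b) \<in> ?T}) \<le> N / (16 * K ^ 3)"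
      proof (cases "bad a a'")
        case True
        then have "{b \<in> B. (x, b) \<in> ?T} = cm a a'"
          using x by (auto simp: cm_def)
        then show ?thesis
          using True by (simp add: bad_def)
      next
        case False
        then have "{b \<in> B. (x, b) \<in> ?T} = {}"
          using x by auto
        then show ?thesis
          using N K by (simp only: card.empty) auto
      qed
    qed
    also have "\<dots> = (real (card A))\<^sup>2 * (N / (16 * K ^ 3))"
      by (simp add: card_cartesian_product power2_eq_square)
    also have "\<dots> \<le> N\<^sup>2 * (N / (16 * K ^ 3))"
      using N K by (intro mult_right_mono power_mono) auto
    finally show ?thesis .
  qed
  finally have "8 * K * (\<Sum>b\<in>B. real (card (bp b))) \<le> N ^ 3 / (2 * K\<^sup>2)"
    using K by (simp add: field_simps eval_nat_numeral)
  then have bpsum: "(\<Sum>b\<in>B. 8 * K * real (card (bp b))) \<le> N ^ 3 / (2 * K\<^sup>2)"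
    by (simp add: sum_distrib_left)
  have "\<exists>b\<in>B. N\<^sup>2 / (2 * K\<^sup>2) + 8 * K * real (card (bp b)) \<le> (real (card (nb b)))\<^sup>2"
  proof (rule ccontr)
    assume c: "\<not> ?thesis"
    have "B \<noteq> {}"
      using EAB E N K by (auto simp: divide_le_0_iff)
    then have "(\<Sum>b\<in>B. (real (card (nb b)))\<^sup>2) < (\<Sum>b\<in>B. N\<^sup>2 / (2 * K\<^sup>2) + 8 * K * real (card (bp b)))"
      using c fin by (intro sum_strict_mono) (auto simp: not_le)
    also have "\<dots> = card B * (N\<^sup>2 / (2 * K\<^sup>2)) + (\<Sum>b\<in>B. 8 * K * real (card (bp b)))"
      by (simp add: sum.distrib)
    also have "\<dots> \<le> N * (N\<^sup>2 / (2 * K\<^sup>2)) + N ^ 3 / (2 * K\<^sup>2)"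
      using N K bpsum by (intro add_mono mult_right_mono) auto
    also have "\<dots> = N ^ 3 / K\<^sup>2"
      using K by (simp add: field_simps eval_nat_numeral)
    finally show False
      using sq by simp
  qed
  then obtain b0 where b0: "b0 \<in> B"
    and b0': "N\<^sup>2 / (2 * K\<^sup>2) + 8 * K * real (card (bp b0)) \<le> (real (card (nb b0)))\<^sup>2"
    by blast
  define A1 where "A1 = nb b0"
  define n where "n = real (card A1)"
  have A1: "A1 \<subseteq> A" "finite A1"
    by (auto simp: A1_def nb_def fin)
  have n: "n \<ge> N / (2 * K)"
  proof (rule power2_le_imp_le)
    have "(N / (2 * K))\<^sup>2 \<le> N\<^sup>2 / (2 * K\<^sup>2)"
      using K by (simp add: field_simps power2_eq_square)
    moreover have "0 \<le> 8 * K * real (card (bp b0))"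
      using K by simp
    ultimately show "(N / (2 * K))\<^sup>2 \<le> n\<^sup>2"
      using b0' by (simp add: n_def A1_def)
  qed (simp add: n_def)
  have n0: "n > 0"
    using n N K by (metis divide_pos_pos less_le_trans mult_pos_pos zero_less_numeral)
  have bpn: "8 * K * real (card (bp b0)) \<le> n\<^sup>2"
  proof -
    have "0 \<le> N\<^sup>2 / (2 * K\<^sup>2)"
      by simp
    then show ?thesis
      using b0' unfolding n_def A1_def by linarith
  qed
  define B' where "B' = {b\<in>B. n / (2 * K) \<le> real (card (nb b \<inter> A1))}"
  define badn where "badn a = {a1\<in>A1. bad a a1}" for a
  define A' where "A' = {a\<in>A1. real (card (badn a)) \<le> n / (4 * K)}"
  show ?thesis
  proof
    show "A' \<subseteq> A" "B' \<subseteq> B"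
      using A1 by (auto simp: A'_def B'_def)
    have "n * (N / K) = (\<Sum>a\<in>A1. N / K)"
      by (simp add: n_def)
    also have "\<dots> \<le> (\<Sum>a\<in>A1. real (card {b\<in>B. (a, b) \<in> E}))"
      using A1 deg by (intro sum_mono) auto
    also have "\<dots> = real (card (E \<inter> A1 \<times> B))"
      using card_eq_sum_fibres(2)[of A1 B "E \<inter> A1 \<times> B"] A1 fin by (simp add: conj_commute cong: conj_cong)
    also have "\<dots> = (\<Sum>b\<in>B. real (card {a\<in>A1. (a, b) \<in> E}))"
      using card_eq_sum_fibres(1)[of A1 B "E \<inter> A1 \<times> B"] A1 fin by (simp add: conj_commute cong: conj_cong)
    also have "\<dots> = (\<Sum>b\<in>B. real (card (nb b \<inter> A1)))"
      using A1 by (intro sum.cong refl arg_cong[where f = "\<lambda>x. real (card x)"]) (auto simp: nb_def)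
    also have "\<dots> = (\<Sum>b\<in>B'. real (card (nb b \<inter> A1))) + (\<Sum>b\<in>B - B'. real (card (nb b \<inter> A1)))"
      using fin by (simp add: B'_def add.commute sum.subset_diff[of B' B])
    also have "\<dots> \<le> (\<Sum>b\<in>B'. n) + (\<Sum>b\<in>B - B'. n / (2 * K))"
      using A1 by (intro add_mono sum_mono) (auto simp: n_def B'_def intro!: card_mono)
    also have "\<dots> \<le> card B' * n + N * (n / (2 * K))"
      using N K fin card_mono[of B "B - B'"] n0 by (auto intro!: mult_right_mono divide_right_mono)
    finally have "n * (N / K) - N * (n / (2 * K)) \<le> card B' * n"
      by (simp only: diff_le_eq)
    also have "n * (N / K) - N * (n / (2 * K)) = (N / (2 * K)) * n"
      using K by (simp add: field_simps)
    finally show "N / (2 * K) \<le> real (card B')"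
      by (rule mult_right_le_imp_le[OF _ n0])
    have "(\<Sum>a\<in>A1 - A'. n / (4 * K)) \<le> (\<Sum>a\<in>A1 - A'. real (card (badn a)))"
      by (intro sum_mono) (auto simp: A'_def)
    also have "\<dots> \<le> (\<Sum>a\<in>A1. real (card (badn a)))"
      using A1 by (intro sum_mono2) auto
    also have "\<dots> = real (card (bp b0))"
    proof -
      have "card (bp b0) = (\<Sum>a\<in>A1. card {a1\<in>A1. (a, a1) \<in> bp b0})"
        using A1 by (intro card_eq_sum_fibres(2)) (auto simp: bp_def A1_def)
      also have "\<dots> = (\<Sum>a\<in>A1. card (badn a))"
        by (intro sum.cong refl arg_cong[where f = card]) (auto simp: bp_def A1_def badn_def)
      finally show ?thesis
        by simp
    qed
    finally have "2 * n * card (A1 - A') \<le> 8 * K * real (card (bp b0))"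
      using K by (simp add: field_simps)
    then have "n * (2 * card (A1 - A')) \<le> n * n"
      using bpn by (simp add: power2_eq_square)
    then have "2 * real (card (A1 - A')) \<le> n"
      using n0 by simp
    moreover have "n = real (card A') + real (card (A1 - A'))"
      using A1 card_mono[of A1 A'] by (simp add: n_def A'_def card_Diff_subset)
    moreover have "N / (4 * K) = N / (2 * K) / 2"
      by simp
    ultimately show "N / (4 * K) \<le> real (card A')"
      using n by linarith
    fix a b assume a: "a \<in> A'" and b: "b \<in> B'"
    define G where "G = (nb b \<inter> A1) - badn a"
    have "n / (2 * K) \<le> real (card (nb b \<inter> A1))" "real (card (badn a)) \<le> n / (4 * K)"
      using a b by (auto simp: A'_def B'_def)
    moreover have "card (nb b \<inter> A1) - card (badn a) \<le> card G"
      unfolding G_def using A1 by (intro diff_card_le_card_Diff) (auto simp: badn_def)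
    moreover have "n / (2 * K) = 2 * (n / (4 * K))"
      by simp
    ultimately have "n / (4 * K) \<le> real (card G)"
      by linarith
    moreover have "N / (8 * K\<^sup>2) = N / (2 * K) / (4 * K)"
      by (simp add: power2_eq_square)
    moreover have "N / (2 * K) / (4 * K) \<le> n / (4 * K)"
      using n K by (intro divide_right_mono) auto
    ultimately have G: "N / (8 * K\<^sup>2) \<le> real (card G)"
      by linarith
    let ?P = "{(b1, a1). (a, b1) \<in> E \<and> (a1, b1) \<in> E \<and> (a1, b) \<in> E}"
    have "?P \<subseteq> B \<times> A"
      using EAB by auto
    then have finP: "finite ?P"
      using fin finite_subset by blast
    have "N\<^sup>2 / (128 * K ^ 5) = N / (8 * K\<^sup>2) * (N / (16 * K ^ 3))"
      by (simp add: eval_nat_numeral)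
    also have "\<dots> \<le> real (card G) * (N / (16 * K ^ 3))"
      using N K G by (intro mult_right_mono) auto
    also have "\<dots> = (\<Sum>a1\<in>G. N / (16 * K ^ 3))"
      by simp
    also have "\<dots> \<le> (\<Sum>a1\<in>G. real (card {b1\<in>B. (b1, a1) \<in> ?P}))"
    proof (rule sum_mono)
      fix a1 assume a1: "a1 \<in> G"
      then have "\<not> bad a a1" and "(a1, b) \<in> E"
        by (auto simp: G_def badn_def nb_def)
      then have "{b1\<in>B. (b1, a1) \<in> ?P} = cm a a1"
        by (auto simp: cm_def)
      then show "N / (16 * K ^ 3) \<le> real (card {b1\<in>B. (b1, a1) \<in> ?P})"
        using \<open>\<not> bad a a1\<close> by (simp add: bad_def)
    qed
    also have "\<dots> \<le> (\<Sum>a1\<in>A. real (card {b1\<in>B. (b1, a1) \<in> ?P}))"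
      using fin A1 by (intro sum_mono2) (auto simp: G_def)
    also have "\<dots> = real (card ?P)"
      using card_eq_sum_fibres(1)[OF fin(2,1) \<open>?P \<subseteq> B \<times> A\<close>] by simp
    finally show "N\<^sup>2 / (128 * K ^ 5) \<le> real (card ?P)" .
  qed
qed

lemma paths_of_length_three:
  fixes N K :: real
  assumes fin: "finite A" "finite B" and EAB: "E \<subseteq> A \<times> B"
    and N: "N > 0" "real (card A) \<le> N" "real (card B) \<le> N"
    and K: "K > 0" and E: "N\<^sup>2 / K \<le> real (card E)"
  obtains A' B' where "A' \<subseteq> A" "B' \<subseteq> B" "N / (8 * K) \<le> real (card A')" "N / (8 * K) \<le> real (card B')"
    "\<And>a b. a \<in> A' \<Longrightarrow> b \<in> B' \<Longrightarrow>
      N\<^sup>2 / (4096 * K ^ 5) \<le> real (card {(b1, a1). (a, b1) \<in> E \<and> (a1, b1) \<in> E \<and> (a1, b) \<in> E})"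
proof -
  obtain A0 where A0: "A0 \<subseteq> A" "N\<^sup>2 / (2 * K) \<le> real (card (E \<inter> A0 \<times> B))"
    and deg: "\<And>a. a \<in> A0 \<Longrightarrow> N / (2 * K) \<le> real (card {b\<in>B. (a, b) \<in> E})"
    using dense_graph_pruned[OF assms] by blast
  let ?E = "E \<inter> A0 \<times> B"
  have finA0: "finite A0" and cA0: "real (card A0) \<le> N"
    using A0 fin N card_mono[of A A0] finite_subset by fastforce+
  have deg': "N / (2 * K) \<le> real (card {b\<in>B. (a, b) \<in> ?E})" if "a \<in> A0" for a
    using deg[OF that] that by (simp cong: conj_cong)
  obtain A' B' where *: "A' \<subseteq> A0" "B' \<subseteq> B" "N / (4 * (2 * K)) \<le> real (card A')"
      "N / (2 * (2 * K)) \<le> real (card B')"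
    and path: "\<And>a b. a \<in> A' \<Longrightarrow> b \<in> B' \<Longrightarrow> N\<^sup>2 / (128 * (2 * K) ^ 5)
      \<le> real (card {(b1, a1). (a, b1) \<in> ?E \<and> (a1, b1) \<in> ?E \<and> (a1, b) \<in> ?E})"
    by (rule paths_of_length_three_aux[of A0 B ?E N "2 * K"])
      (use finA0 fin N cA0 K A0 deg' in auto)
  show ?thesis
  proof
    show "A' \<subseteq> A" "B' \<subseteq> B"
      using * A0 by auto
    show "N / (8 * K) \<le> real (card A')"
      using * by simp
    have "N / (8 * K) \<le> N / (4 * K)"
      using N K by (simp add: field_simps)
    then show "N / (8 * K) \<le> real (card B')"
      using * by simp
    fix a b assume ab: "a \<in> A'" "b \<in> B'"
    let ?P = "{(b1, a1). (a, b1) \<in> E \<and> (a1, b1) \<in> E \<and> (a1, b) \<in> E}"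
    have "?P \<subseteq> B \<times> A"
      using EAB by auto
    then have "finite ?P"
      using fin finite_subset by blast
    then have "card {(b1, a1). (a, b1) \<in> ?E \<and> (a1, b1) \<in> ?E \<and> (a1, b) \<in> ?E} \<le> card ?P"
      by (rule card_mono) auto
    with path[OF ab] show "N\<^sup>2 / (4096 * K ^ 5) \<le> real (card ?P)"
      by (simp add: power_mult_distrib)
  qed
qed

text \<open>
  Along a path \<open>a, b1, a1, b\<close> one has \<open>f a + g b = (f a + g b1) - (f a1 + g b1) + (f a1 + g b)\<close>, so each
  sum over \<open>X' \<times> Y'\<close> has many representations by triples of the at most \<open>N\<close> sums that occur on \<open>E\<close>.
\<close>

lemma balog_szemeredi_gowers:
  fixes f :: "'a \<Rightarrow> 'g::ab_group_add" and g :: "'b \<Rightarrow> 'g" and N K :: real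
  assumes fin: "finite X" "finite Y" and EXY: "E \<subseteq> X \<times> Y"
    and N: "N > 0" "real (card X) \<le> N" "real (card Y) \<le> N"
    and K: "K > 0" and E: "N\<^sup>2 / K \<le> real (card E)"
    and inj: "inj_on f X" "inj_on g Y"
    and S: "real (card ((\<lambda>(x, y). f x + g y) ` E)) \<le> N"
  obtains X' Y' where "X' \<subseteq> X" "Y' \<subseteq> Y" "N / (8 * K) \<le> real (card X')" "N / (8 * K) \<le> real (card Y')"
    "real (card ((\<lambda>(x, y). f x + g y) ` (X' \<times> Y'))) \<le> 4096 * K ^ 5 * N"
proof -
  obtain X' Y' where *: "X' \<subseteq> X" "Y' \<subseteq> Y" "N / (8 * K) \<le> real (card X')" "N / (8 * K) \<le> real (card Y')"
    and path: "\<And>a b. a \<in> X' \<Longrightarrow> b \<in> Y' \<Longrightarrow> N\<^sup>2 / (4096 * K ^ 5)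
      \<le> real (card {(b1, a1). (a, b1) \<in> E \<and> (a1, b1) \<in> E \<and> (a1, b) \<in> E})"
    using paths_of_length_three[OF fin EXY N K E] by blast
  let ?s = "\<lambda>(x, y). f x + g y"
  let ?S = "?s ` E" and ?T = "?s ` (X' \<times> Y')"
  have finE: "finite E" and finT: "finite ?T"
    using fin EXY * finite_subset by (blast intro: finite_subset)+
  have "\<forall>v\<in>?T. \<exists>q. fst q \<in> X' \<and> snd q \<in> Y' \<and> v = f (fst q) + g (snd q)"
    by force
  then obtain q where q: "\<And>v. v \<in> ?T \<Longrightarrow> fst (q v) \<in> X' \<and> snd (q v) \<in> Y' \<and> v = f (fst (q v)) + g (snd (q v))"
    by metis
  define P where "P v = {(b1, a1). (fst (q v), b1) \<in> E \<and> (a1, b1) \<in> E \<and> (a1, snd (q v)) \<in> E}" for v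
  have P: "P v \<subseteq> Y \<times> X" for v
    using EXY by (auto simp: P_def)
  have finP: "finite (P v)" for v
    using P fin finite_subset by blast
  let ?h = "\<lambda>(v, (b1, a1)). (f (fst (q v)) + g b1, f a1 + g b1, f a1 + g (snd (q v)))"
  have "inj_on ?h (Sigma ?T P)"
  proof (rule inj_onI)
    fix w w' assume w: "w \<in> Sigma ?T P" "w' \<in> Sigma ?T P" "?h w = ?h w'"
    obtain v b1 a1 where w1: "w = (v, (b1, a1))"
      by (metis prod.exhaust)
    obtain v' b1' a1' where w2: "w' = (v', (b1', a1'))"
      by (metis prod.exhaust)
    have v: "v \<in> ?T" "(b1, a1) \<in> P v" "v' \<in> ?T" "(b1', a1') \<in> P v'"
      and e: "f (fst (q v)) + g b1 = f (fst (q v')) + g b1'" "f a1 + g b1 = f a1' + g b1'"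
        "f a1 + g (snd (q v)) = f a1' + g (snd (q v'))"
      using w unfolding w1 w2 by (simp_all del: split_paired_All)
    have "v = (f (fst (q v)) + g b1) - (f a1 + g b1) + (f a1 + g (snd (q v)))"
      using q[OF v(1)] by simp
    also have "\<dots> = v'"
      unfolding e using q[OF v(3)] by simp
    finally have vv: "v = v'" .
    then have "g b1 = g b1'" "f a1 = f a1'"
      using e by auto
    moreover have "b1 \<in> Y" "b1' \<in> Y" "a1 \<in> X" "a1' \<in> X"
      using v P by blast+
    ultimately show "w = w'"
      unfolding w1 w2 using vv inj by (auto dest: inj_onD)
  qed
  moreover have "?h ` Sigma ?T P \<subseteq> ?S \<times> ?S \<times> ?S"
    by (force simp: P_def)
  ultimately have "card (Sigma ?T P) \<le> card (?S \<times> ?S \<times> ?S)"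
    using finE by (intro card_inj_on_le[of ?h]) auto
  then have "real (card (Sigma ?T P)) \<le> real (card ?S) ^ 3"
    by (simp add: card_cartesian_product eval_nat_numeral flip: of_nat_mult)
  also have "\<dots> \<le> N ^ 3"
    using S by (intro power_mono) auto
  finally have 1: "real (card (Sigma ?T P)) \<le> N ^ 3" .
  have "real (card ?T) * (N\<^sup>2 / (4096 * K ^ 5)) = (\<Sum>v\<in>?T. N\<^sup>2 / (4096 * K ^ 5))"
    by simp
  also have "\<dots> \<le> (\<Sum>v\<in>?T. real (card (P v)))"
    unfolding P_def using q path by (intro sum_mono) blast
  also have "\<dots> = real (card (Sigma ?T P))"
    using finT finP by (subst card_SigmaI) auto
  finally have "real (card ?T) * (N\<^sup>2 / (4096 * K ^ 5)) \<le> N ^ 3"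
    using 1 by (rule order_trans)
  then have "N\<^sup>2 * real (card ?T) \<le> N\<^sup>2 * (4096 * K ^ 5 * N)"
    using K by (simp add: field_simps eval_nat_numeral)
  then have "real (card ?T) \<le> 4096 * K ^ 5 * N"
    using N by simp
  with * show ?thesis
    using that by blast
qed

text \<open>
  By Cauchy--Schwarz the sets \<open>R m\<close> meet pairwise, on average, at least as much as random sets of
  their density; so some \<open>R m0\<close> has a large intersection with a positive proportion of them.
\<close>

lemma popular_intersection:
  fixes t z :: real
  assumes fin: "finite M" "finite Z" and "M \<noteq> {}" and R: "\<And>m. m \<in> M \<Longrightarrow> R m \<subseteq> Z"
    and t: "\<And>m. m \<in> M \<Longrightarrow> t \<le> real (card (R m))" "t > 0" and z: "real (card Z) \<le> z"
  obtains m0 where "m0 \<in> M"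
    "real (card M) * (t\<^sup>2 / (2 * z\<^sup>2)) \<le> real (card {m\<in>M. t\<^sup>2 / (2 * z) \<le> real (card (R m \<inter> R m0))})"
proof -
  define d where "d x = card {m\<in>M. x \<in> R m}" for x
  have z0: "z > 0"
  proof -
    obtain m where "m \<in> M"
      using assms by blast
    then have "t \<le> real (card Z)"
      using t(1) R card_mono[OF fin(2) R] by (meson of_nat_le_iff order_trans)
    then show ?thesis
      using t z by linarith
  qed
  have finR: "finite (R m)" if "m \<in> M" for m
    using R fin that finite_subset by blast
  have sumd: "(\<Sum>m\<in>M. card (R m \<inter> W)) = (\<Sum>x\<in>W. d x)" if W: "W \<subseteq> Z" for W
  proof -
    have fW: "finite W"
      using W fin finite_subset by blast
    let ?E = "{(m, x). m \<in> M \<and> x \<in> R m \<inter> W}"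
    have E: "?E \<subseteq> M \<times> W"
      by auto
    have "(\<Sum>m\<in>M. card (R m \<inter> W)) = (\<Sum>m\<in>M. card {x\<in>W. (m, x) \<in> ?E})"
      by (intro sum.cong refl arg_cong[where f = card]) auto
    also have "\<dots> = (\<Sum>x\<in>W. card {m\<in>M. (m, x) \<in> ?E})"
      using card_eq_sum_fibres[OF fin(1) fW E] by simp
    also have "\<dots> = (\<Sum>x\<in>W. d x)"
      unfolding d_def by (intro sum.cong refl arg_cong[where f = card]) auto
    finally show ?thesis .
  qed
  have "real (card M) * t = (\<Sum>m\<in>M. t)"
    by simp
  also have "\<dots> \<le> (\<Sum>m\<in>M. real (card (R m \<inter> Z)))"
    using t R by (intro sum_mono) (simp add: Int_absorb2)
  also have "\<dots> = (\<Sum>x\<in>Z. real (d x))"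
    using sumd[of Z] by (simp flip: of_nat_sum)
  finally have "(real (card M) * t)\<^sup>2 \<le> (\<Sum>x\<in>Z. real (d x))\<^sup>2"
    using t by (intro power_mono) auto
  also have "\<dots> \<le> card Z * (\<Sum>x\<in>Z. (real (d x))\<^sup>2)"
    using fin by (intro sum_power2_le)
  also have "\<dots> \<le> z * (\<Sum>x\<in>Z. (real (d x))\<^sup>2)"
    using z by (intro mult_right_mono sum_nonneg) auto
  also have "(\<Sum>x\<in>Z. (real (d x))\<^sup>2) = (\<Sum>m\<in>M. \<Sum>x\<in>R m. real (d x))"
  proof -
    have "(\<Sum>m\<in>M. \<Sum>x\<in>R m. real (d x)) = (\<Sum>m\<in>M. \<Sum>x\<in>Z. if x \<in> R m then real (d x) else 0)"
    proof (rule sum.cong[OF refl])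
      fix m assume "m \<in> M"
      then show "(\<Sum>x\<in>R m. real (d x)) = (\<Sum>x\<in>Z. if x \<in> R m then real (d x) else 0)"
        using fin R by (intro sum.mono_neutral_cong_left) auto
    qed
    also have "\<dots> = (\<Sum>x\<in>Z. \<Sum>m\<in>M. if x \<in> R m then real (d x) else 0)"
      by (rule sum.swap)
    also have "\<dots> = (\<Sum>x\<in>Z. (real (d x))\<^sup>2)"
      using fin by (intro sum.cong refl) (simp add: sum.If_cases d_def power2_eq_square Collect_conj_eq)
    finally show ?thesis by simp
  qed
  also have "\<dots> = (\<Sum>m0\<in>M. \<Sum>m\<in>M. real (card (R m \<inter> R m0)))"
    using sumd R by (intro sum.cong refl) (simp flip: of_nat_sum)
  finally have "card M * (card M * (t\<^sup>2 / z)) \<le> (\<Sum>m0\<in>M. \<Sum>m\<in>M. real (card (R m \<inter> R m0)))"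
    using z0 by (simp add: field_simps power2_eq_square)
  then have "(\<Sum>m0\<in>M. card M * (t\<^sup>2 / z)) \<le> (\<Sum>m0\<in>M. \<Sum>m\<in>M. real (card (R m \<inter> R m0)))"
    by simp
  then have "\<exists>m0\<in>M. card M * (t\<^sup>2 / z) \<le> (\<Sum>m\<in>M. real (card (R m \<inter> R m0)))"
    using sum_strict_mono[OF fin(1) \<open>M \<noteq> {}\<close>] by (meson linorder_not_le)
  then obtain m0 where m0: "m0 \<in> M" and le: "card M * (t\<^sup>2 / z) \<le> (\<Sum>m\<in>M. real (card (R m \<inter> R m0)))"
    by blast
  let ?M' = "{m\<in>M. t\<^sup>2 / (2 * z) \<le> real (card (R m \<inter> R m0))}"
  have cz: "real (card (R m \<inter> R m0)) \<le> z" for m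
  proof -
    have "card (R m \<inter> R m0) \<le> card Z"
      using R[OF m0] fin by (intro card_mono) auto
    then show ?thesis
      using z by linarith
  qed
  have "(\<Sum>m\<in>M. real (card (R m \<inter> R m0))) =
      (\<Sum>m\<in>?M'. real (card (R m \<inter> R m0))) + (\<Sum>m\<in>M - ?M'. real (card (R m \<inter> R m0)))"
    using fin by (subst sum.subset_diff[of ?M' M]) auto
  also have "\<dots> \<le> (\<Sum>m\<in>?M'. z) + (\<Sum>m\<in>M - ?M'. t\<^sup>2 / (2 * z))"
    using cz by (intro add_mono sum_mono) auto
  also have "\<dots> \<le> card ?M' * z + card M * (t\<^sup>2 / (2 * z))"
    using fin z0 by (auto intro!: mult_right_mono divide_right_mono card_mono)
  finally have "card M * (t\<^sup>2 / z) - card M * (t\<^sup>2 / (2 * z)) \<le> card ?M' * z"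
    using le by (simp only: diff_le_eq order_trans)
  also have "card M * (t\<^sup>2 / z) - card M * (t\<^sup>2 / (2 * z)) = card M * (t\<^sup>2 / (2 * z))"
    by (simp add: field_simps)
  finally have "card M * (t\<^sup>2 / (2 * z\<^sup>2)) \<le> card ?M'"
    using z0 by (simp add: field_simps power2_eq_square)
  with m0 show ?thesis
    using that by blast
qed

section \<open>Residue classes in the circle group\<close>

text \<open>
  The circle group contains a copy of \<open>\<int> / p\<close> for every \<open>p\<close>. Sumset estimates proved for types of
  class \<open>ab_group_add\<close> thus apply to residue classes for all \<open>p\<close> at once, although the prime fields
  themselves are not types.
\<close>

quotient_type circle = real / "\<lambda>x y::real. x - y \<in> \<int>"
proof (rule equivpI)
  show "reflp (\<lambda>x y::real. x - y \<in> \<int>)"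
    by (simp add: reflp_def)
  show "symp (\<lambda>x y::real. x - y \<in> \<int>)"
    by (metis (mono_tags, lifting) Ints_minus minus_diff_eq sympI)
  show "transp (\<lambda>x y::real. x - y \<in> \<int>)"
  proof (rule transpI)
    fix x y z :: real assume "x - y \<in> \<int>" "y - z \<in> \<int>"
    then have "(x - y) + (y - z) \<in> \<int>"
      by (rule Ints_add)
    then show "x - z \<in> \<int>"
      by simp
  qed
qed

instantiation circle :: ab_group_add
begin

lift_definition zero_circle :: circle is 0 .

lift_definition plus_circle :: "circle \<Rightarrow> circle \<Rightarrow> circle" is "(+)"
  by (metis Ints_add add_diff_add)

lift_definition uminus_circle :: "circle \<Rightarrow> circle" is uminus
  by (metis Ints_minus minus_diff_minus)

definition minus_circle :: "circle \<Rightarrow> circle \<Rightarrow> circle" where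
  "minus_circle x y = x + - y"

instance
proof
  fix a b c :: circle
  show "a + b + c = a + (b + c)"
    by transfer (simp add: add.assoc)
  show "a + b = b + a"
    by transfer (simp add: add.commute)
  show "0 + a = a"
    by transfer simp
  show "- a + a = 0"
    by transfer simp
  show "a - b = a + - b"
    by (simp add: minus_circle_def)
qed

end

lift_definition circle_of :: "real \<Rightarrow> circle" is "\<lambda>x. x" .

text \<open>
  The embedding of \<open>\<int> / p\<close>, as the subgroup of order \<open>p\<close>, into the circle.
\<close>

definition cls :: "nat \<Rightarrow> int \<Rightarrow> circle" where
  "cls p n = circle_of (real_of_int n / real p)"

lemma cls_add: "cls p (a + b) = cls p a + cls p b"
  unfolding cls_def by transfer (simp add: add_divide_distrib)

lemma cls_minus: "cls p (- a) = - cls p a"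
  unfolding cls_def by transfer simp

lemma cls_diff: "cls p (a - b) = cls p a - cls p b"
  using cls_add[of p a "- b"] by (simp add: cls_minus)

lemma cls_0: "cls p 0 = 0"
  unfolding cls_def by transfer simp

lemma cls_eq_iff:
  assumes "p > 0"
  shows "cls p a = cls p b \<longleftrightarrow> int p dvd a - b"
proof -
  have "cls p a = cls p b \<longleftrightarrow> real_of_int (a - b) / real p \<in> \<int>"
    unfolding cls_def by transfer (simp add: diff_divide_distrib)
  also have "\<dots> \<longleftrightarrow> int p dvd a - b"
  proof
    assume "real_of_int (a - b) / real p \<in> \<int>"
    then obtain k where "real_of_int (a - b) / real p = of_int k"
      by (auto elim: Ints_cases)
    then have "real_of_int (a - b) = of_int (int p * k)"
      using assms by (simp add: field_simps)
    then have "a - b = int p * k"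
      by (simp only: of_int_eq_iff)
    then show "int p dvd a - b"
      by simp
  next
    assume "int p dvd a - b"
    then obtain k where "a - b = int p * k"
      by (auto elim: dvdE)
    then show "real_of_int (a - b) / real p \<in> \<int>"
      using assms by simp
  qed
  finally show ?thesis .
qed

lemma inj_on_cls: "p > 0 \<Longrightarrow> S \<subseteq> {0..<int p} \<Longrightarrow> inj_on (cls p) S"
  by (rule inj_onI) (smt (verit) atLeastLessThan_iff cls_eq_iff subset_iff zdvd_not_zless)

definition dilate :: "nat \<Rightarrow> int \<Rightarrow> int set \<Rightarrow> circle set" where
  "dilate p c A = (\<lambda>a. cls p (c * a)) ` A"

lemma card_image_eq_of_same_kernel:
  assumes "\<And>x y. x \<in> S \<Longrightarrow> y \<in> S \<Longrightarrow> f x = f y \<longleftrightarrow> g x = g y"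
  shows "card (f ` S) = card (g ` S)"
proof -
  define h where "h v = f (inv_into S g v)" for v
  have h: "h (g x) = f x" if "x \<in> S" for x
    unfolding h_def using that assms inv_into_into[of "g x" g S] f_inv_into_f[of "g x" g S] by blast
  then have "f ` S = h ` (g ` S)"
    by force
  moreover have "inj_on h (g ` S)"
    using h assms by (auto simp: inj_on_def)
  ultimately show ?thesis
    by (simp add: card_image)
qed

lemma dilate_diff_eq: "dilate p c A -\<^sub>s dilate p d B = (\<lambda>(a, b). cls p (c * a - d * b)) ` (A \<times> B)"
  by (force simp: dilate_def diffset_def cls_diff)

lemma finite_dilate: "finite A \<Longrightarrow> finite (dilate p c A)"
  by (simp add: dilate_def)

lemma card_dilate:
  assumes "prime p" "\<not> int p dvd c" "A \<subseteq> {0..<int p}"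
  shows "card (dilate p c A) = card A"
proof -
  have p: "p > 0" "prime (int p)"
    using assms by (auto simp: prime_gt_0_nat)
  have "inj_on (\<lambda>a. cls p (c * a)) A"
  proof (rule inj_onI)
    fix a b assume ab: "a \<in> A" "b \<in> A" "cls p (c * a) = cls p (c * b)"
    then have "int p dvd c * (a - b)"
      using p by (simp add: cls_eq_iff algebra_simps)
    then have "cls p a = cls p b"
      using p assms by (simp add: cls_eq_iff prime_dvd_mult_iff)
    then show "a = b"
      using inj_on_cls[OF p(1) assms(3)] ab by (auto dest: inj_onD)
  qed
  then show ?thesis
    by (simp add: dilate_def card_image)
qed

text \<open>
  Multiplication by a unit modulo \<open>p\<close> is an automorphism of \<open>\<int> / p\<close>; hence only the ratio of the two
  multipliers matters for the size of a difference of dilates.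
\<close>

lemma card_dilate_diff_scale:
  assumes "prime p" "\<not> int p dvd k" "int p dvd c' - k * c" "int p dvd d' - k * d"
  shows "card (dilate p c' A -\<^sub>s dilate p d' B) = card (dilate p c A -\<^sub>s dilate p d B)"
  unfolding dilate_diff_eq
proof (rule card_image_eq_of_same_kernel, clarsimp)
  fix a b a' b'
  have p: "p > 0" "prime (int p)"
    using assms by (auto simp: prime_gt_0_nat)
  have "(c' * a - d' * b) - (c' * a' - d' * b') =
      k * ((c * a - d * b) - (c * a' - d * b')) + ((c' - k * c) * (a - a') - (d' - k * d) * (b - b'))"
    by (simp add: algebra_simps)
  moreover have "int p dvd (c' - k * c) * (a - a') - (d' - k * d) * (b - b')"
    using assms by simp
  ultimately have "int p dvd (c' * a - d' * b) - (c' * a' - d' * b') \<longleftrightarrow>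
      int p dvd k * ((c * a - d * b) - (c * a' - d * b'))"
    by (simp add: dvd_add_left_iff)
  also have "\<dots> \<longleftrightarrow> int p dvd (c * a - d * b) - (c * a' - d * b')"
    using p assms by (simp add: prime_dvd_mult_iff)
  finally show "cls p (c' * a - d' * b) = cls p (c' * a' - d' * b') \<longleftrightarrow>
      cls p (c * a - d * b) = cls p (c * a' - d * b')"
    using p by (simp add: cls_eq_iff)
qed

lemma card_sq_le_collisions:
  assumes "finite S"
  shows "(card S)\<^sup>2 \<le> card (f ` S) * card (collisions f S)"
proof -
  have "real ((card S)\<^sup>2) \<le> real (card (f ` S) * card (collisions f S))"
    using sum_power2_le[of "f ` S" "\<lambda>v. real (card {s\<in>S. f s = v})"] assms
    by (simp add: card_collisions card_eq_sum_fibres_of_map[of S f])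
  then show ?thesis
    by (simp only: of_nat_le_iff)
qed

section \<open>Sums and products of residue classes\<close>

text \<open>
  If \<open>A - x A\<close> is small then the equation \<open>a - x b = c - x d\<close> has many solutions in \<open>A\<close>. But a quadruple with
  \<open>b \<noteq> d\<close> solves it for one \<open>x\<close> only, so this cannot happen for many \<open>x\<close>.
\<close>

lemma dilates_average:
  fixes L :: real
  assumes p: "prime p" and A: "A \<subseteq> {0..<int p}" and X: "X \<subseteq> {0..<int p}"
    and L: "L > 0" and small: "\<And>x. x \<in> X \<Longrightarrow> real (card (dilate p 1 A -\<^sub>s dilate p x A)) \<le> L * card A"
    and big: "2 * L \<le> card A"
  shows "real (card X) \<le> 2 * L * card A"
proof -
  have p0: "p > 0" "prime (int p)"
    using p by (auto simp: prime_gt_0_nat)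
  have fin: "finite A" "finite X"
    using A X finite_subset by auto
  define n where "n = real (card A)"
  have n: "n > 0"
    using big L by (simp add: n_def)
  define E where "E x = collisions (\<lambda>s. cls p (1 * fst s - x * snd s)) (A \<times> A)" for x
  have lower: "n ^ 3 / L \<le> real (card (E x))" if x: "x \<in> X" for x
  proof -
    have "dilate p 1 A -\<^sub>s dilate p x A = (\<lambda>s. cls p (1 * fst s - x * snd s)) ` (A \<times> A)"
      unfolding dilate_diff_eq by (simp add: case_prod_beta)
    with card_sq_le_collisions[of "A \<times> A" "\<lambda>s. cls p (1 * fst s - x * snd s)"] fin
    have "(card (A \<times> A))\<^sup>2 \<le> card (dilate p 1 A -\<^sub>s dilate p x A) * card (E x)"
      by (simp add: E_def)
    then have "real ((card (A \<times> A))\<^sup>2) \<le> real (card (dilate p 1 A -\<^sub>s dilate p x A) * card (E x))"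
      by (simp only: of_nat_le_iff)
    then have "n ^ 4 \<le> real (card (dilate p 1 A -\<^sub>s dilate p x A)) * card (E x)"
      by (simp add: card_cartesian_product n_def power_mult_distrib flip: power_mult)
    also have "\<dots> \<le> (L * n) * card (E x)"
      using small[OF x] by (intro mult_right_mono) (auto simp: n_def)
    finally have "n * n ^ 3 \<le> n * (L * card (E x))"
      by (simp add: eval_nat_numeral algebra_simps)
    then show ?thesis
      using n L by (simp add: field_simps)
  qed
  define D where "D = {(x, (s, t)). x \<in> X \<and> (s, t) \<in> E x \<and> snd s \<noteq> snd t}"
  have D: "D \<subseteq> X \<times> ((A \<times> A) \<times> (A \<times> A))"
    by (auto simp: D_def E_def collisions_def)
  have finE: "finite (E x)" for x
    unfolding E_def using fin by (intro finite_collisions finite_cartesian_product)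
  have injD: "inj_on snd D"
  proof (rule inj_onI)
    fix d d' assume d: "d \<in> D" "d' \<in> D" "snd d = snd d'"
    obtain x a b c e where d1: "d = (x, ((a, b), (c, e)))"
      by (metis prod.exhaust)
    obtain x' where d2: "d' = (x', ((a, b), (c, e)))"
      using d d1 by (metis prod.collapse snd_conv)
    have h: "x \<in> X" "x' \<in> X" "b \<noteq> e" "b \<in> A" "e \<in> A"
      "int p dvd (a - x * b) - (c - x * e)" "int p dvd (a - x' * b) - (c - x' * e)"
      using d p0 by (auto simp: d1 d2 D_def E_def collisions_def cls_eq_iff)
    have "(x - x') * (b - e) = ((a - x' * b) - (c - x' * e)) - ((a - x * b) - (c - x * e))"
      by (simp add: algebra_simps)
    then have "int p dvd (x - x') * (b - e)"
      using h by (metis dvd_diff)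
    moreover have "\<not> int p dvd b - e"
      using h inj_on_cls[OF p0(1) A] p0 by (auto simp: cls_eq_iff[symmetric] dest: inj_onD)
    ultimately have "cls p x = cls p x'"
      using p0 by (simp add: prime_dvd_mult_iff cls_eq_iff)
    then have "x = x'"
      using h inj_on_cls[OF p0(1) X] by (auto dest: inj_onD)
    then show "d = d'"
      by (simp add: d1 d2)
  qed
  have "card D \<le> card ((A \<times> A) \<times> (A \<times> A))"
    using injD D fin by (intro card_inj_on_le[of snd]) auto
  then have cD: "real (card D) \<le> n ^ 4"
    by (simp add: card_cartesian_product n_def eval_nat_numeral mult.assoc flip: of_nat_mult)
  have diag: "card (E x \<inter> {(s, t). snd s = snd t}) \<le> (card A)\<^sup>2" for x
  proof -
    have "E x \<inter> {(s, t). snd s = snd t} \<subseteq> (\<lambda>s. (s, s)) ` (A \<times> A)"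
    proof (clarsimp simp: E_def collisions_def)
      fix a b c assume h: "a \<in> A" "c \<in> A" "b \<in> A" "cls p (a - x * b) = cls p (c - x * b)"
      then have "cls p a = cls p c"
        by (simp add: cls_diff)
      then have "a = c"
        using h inj_on_cls[OF p0(1) A] by (auto dest: inj_onD)
      with h show "((a, b), (c, b)) \<in> (\<lambda>s. (s, s)) ` (A \<times> A)"
        by auto
    qed
    then have "card (E x \<inter> {(s, t). snd s = snd t}) \<le> card ((\<lambda>s. (s, s)) ` (A \<times> A))"
      using fin by (intro card_mono) auto
    also have "\<dots> \<le> (card A)\<^sup>2"
      using card_image_le[of "A \<times> A" "\<lambda>s. (s, s)"] fin
      by (simp add: card_cartesian_product power2_eq_square)
    finally show ?thesis .
  qed
  have "card X * (n ^ 3 / L) = (\<Sum>x\<in>X. n ^ 3 / L)"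
    by simp
  also have "\<dots> \<le> (\<Sum>x\<in>X. real (card (E x)))"
    using lower by (intro sum_mono)
  also have "\<dots> \<le> (\<Sum>x\<in>X. n\<^sup>2 + real (card {st \<in> (A \<times> A) \<times> (A \<times> A). (x, st) \<in> D}))"
  proof (rule sum_mono)
    fix x assume x: "x \<in> X"
    have "E x \<subseteq> (E x \<inter> {(s, t). snd s = snd t}) \<union> {st \<in> (A \<times> A) \<times> (A \<times> A). (x, st) \<in> D}"
      using x by (auto simp: D_def E_def collisions_def)
    then have "card (E x) \<le> card (E x \<inter> {(s, t). snd s = snd t})
        + card {st \<in> (A \<times> A) \<times> (A \<times> A). (x, st) \<in> D}"
      using finE fin by (intro order_trans[OF card_mono card_Un_le]) auto
    also have "\<dots> \<le> (card A)\<^sup>2 + card {st \<in> (A \<times> A) \<times> (A \<times> A). (x, st) \<in> D}"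
      using diag by simp
    finally show "real (card (E x)) \<le> n\<^sup>2 + real (card {st \<in> (A \<times> A) \<times> (A \<times> A). (x, st) \<in> D})"
      by (simp add: n_def flip: of_nat_power of_nat_add)
  qed
  also have "\<dots> = card X * n\<^sup>2 + card D"
    using card_eq_sum_fibres(2)[OF fin(2) _ D] fin by (simp add: sum.distrib)
  also have "\<dots> \<le> card X * (n ^ 3 / (2 * L)) + n ^ 4"
  proof -
    have "n\<^sup>2 * (2 * L) \<le> n\<^sup>2 * n"
      using big by (intro mult_left_mono) (auto simp: n_def)
    then have "n\<^sup>2 \<le> n ^ 3 / (2 * L)"
      using L by (simp add: field_simps eval_nat_numeral)
    then show ?thesis
      using cD by (intro add_mono mult_left_mono) auto
  qed
  finally have "n ^ 3 * card X \<le> n ^ 3 * (2 * L * n)"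
    using L by (simp add: field_simps eval_nat_numeral)
  then show ?thesis
    using n by (simp add: n_def)
qed

text \<open>
  All the dilates \<open>q A\<close> are put into the single set \<open>B\<close>, to which Pluennecke's inequality applies; a
  difference of sums of dilates is then covered by \<open>nfold i B -\<^sub>s nfold j B\<close>. The sign in \<open>B\<close> turns
  the hypothesis on differences into one on sums.
\<close>

lemma dilates_nfold_bound:
  fixes K r :: real
  assumes p: "prime p" and A: "A \<subseteq> {0..<int p}" "A \<noteq> {}"
    and Q: "finite Q" "real (card Q) \<le> r" and K: "K \<ge> 0"
    and small: "\<And>q. q \<in> Q \<Longrightarrow> real (card (dilate p 1 A -\<^sub>s dilate p q A)) \<le> K * card A"
  defines "B \<equiv> (\<Union>q\<in>Q. uminus ` dilate p q A)"
  shows "real (card (nfold i B -\<^sub>s nfold j B)) \<le> (r * K) ^ (i + j) * card A"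
proof -
  have finA: "finite A"
    using A finite_subset by auto
  have finB: "finite B"
    using finA Q by (simp add: B_def finite_dilate)
  have "\<not> int p dvd 1"
    using p by (auto dest: prime_gt_1_nat)
  then have cA: "card (dilate p 1 A) = card A"
    using card_dilate[OF p _ A(1)] by blast
  have "dilate p 1 A + B \<subseteq> (\<Union>q\<in>Q. dilate p 1 A -\<^sub>s dilate p q A)"
  proof
    fix t assume "t \<in> dilate p 1 A + B"
    then obtain x q y where "x \<in> dilate p 1 A" "q \<in> Q" "y \<in> dilate p q A" "t = x + - y"
      by (auto simp: B_def elim!: set_plus_elim)
    then show "t \<in> (\<Union>q\<in>Q. dilate p 1 A -\<^sub>s dilate p q A)"
      by (auto simp: diffset_def)
  qed
  then have "card (dilate p 1 A + B) \<le> card (\<Union>q\<in>Q. dilate p 1 A -\<^sub>s dilate p q A)"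
    using Q finA by (intro card_mono) (auto simp: finite_dilate finite_diffset)
  also have "\<dots> \<le> (\<Sum>q\<in>Q. card (dilate p 1 A -\<^sub>s dilate p q A))"
    using Q(1) by (rule card_UN_le)
  finally have "real (card (dilate p 1 A + B)) \<le> (\<Sum>q\<in>Q. real (card (dilate p 1 A -\<^sub>s dilate p q A)))"
    by (simp flip: of_nat_sum)
  also have "\<dots> \<le> (\<Sum>q\<in>Q. K * card A)"
    using small by (intro sum_mono)
  also have "\<dots> = real (card Q) * (K * card A)"
    by simp
  also have "\<dots> \<le> r * (K * card A)"
    using Q K by (intro mult_right_mono) auto
  finally have "real (card (dilate p 1 A + B)) \<le> (r * K) * card (dilate p 1 A)"
    by (simp add: cA mult.assoc)
  moreover have "dilate p 1 A \<noteq> {}"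
    using A by (simp add: dilate_def)
  ultimately show ?thesis
    using plunnecke[OF finite_dilate[OF finA] finB] by (metis cA)
qed

lemma dilate_product:
  fixes K :: real
  assumes p: "prime p" and A: "A \<subseteq> {0..<int p}" "A \<noteq> {}" and m: "\<not> int p dvd m"
    and 1: "real (card (dilate p 1 A -\<^sub>s dilate p m A)) \<le> K * card A"
    and 2: "real (card (dilate p 1 A -\<^sub>s dilate p m' A)) \<le> K * card A"
  shows "real (card (dilate p 1 A -\<^sub>s dilate p (m * m') A)) \<le> K\<^sup>2 * card A"
proof -
  have finA: "finite A"
    using A finite_subset by auto
  then have A0: "real (card A) > 0"
    using A by (simp add: card_gt_0_iff)
  have "card (dilate p 1 A -\<^sub>s dilate p (m * m') A) * card (dilate p m A)
      \<le> card (dilate p 1 A -\<^sub>s dilate p m A) * card (dilate p m A -\<^sub>s dilate p (m * m') A)"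
    using finA by (intro ruzsa_triangle finite_dilate)
  also have "card (dilate p m A -\<^sub>s dilate p (m * m') A) = card (dilate p 1 A -\<^sub>s dilate p m' A)"
    by (rule card_dilate_diff_scale[OF p m]) auto
  also have "card (dilate p m A) = card A"
    by (rule card_dilate[OF p m A(1)])
  finally have "real (card (dilate p 1 A -\<^sub>s dilate p (m * m') A)) * card A
      \<le> real (card (dilate p 1 A -\<^sub>s dilate p m A)) * real (card (dilate p 1 A -\<^sub>s dilate p m' A))"
    by (simp flip: of_nat_mult)
  also have "\<dots> \<le> (K * card A) * (K * card A)"
    using 1 2 by (intro mult_mono) (auto intro: order_trans[OF of_nat_0_le_iff])
  finally show ?thesis
    using A0 by (simp add: power2_eq_square)
qed

lemma uminus_cls_in_dilates: "q \<in> Q \<Longrightarrow> a \<in> A \<Longrightarrow> - cls p (q * a) \<in> (\<Union>q\<in>Q. uminus ` dilate p q A)"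
  by (auto simp: dilate_def)

lemma diffset_I: "a \<in> A \<Longrightarrow> b \<in> B \<Longrightarrow> t = a - b \<Longrightarrow> t \<in> A -\<^sub>s B"
  by (auto simp: diffset_def)

text \<open>
  The quotients \<open>(a - b) / (c - d)\<close> modulo \<open>p\<close>.
\<close>

definition ratios :: "nat \<Rightarrow> int set \<Rightarrow> int set" where
  "ratios p M = {x \<in> {0..<int p}. \<exists>a\<in>M. \<exists>b\<in>M. \<exists>c\<in>M. \<exists>d\<in>M. c \<noteq> d \<and> int p dvd x * (c - d) - (a - b)}"

text \<open>
  The set of ratios contains \<open>0\<close>; if it were closed under adding \<open>1\<close> it would contain every residue.
\<close>

lemma ratios_dichotomy:
  assumes "p > 0" and "ratios p M \<noteq> {0..<int p}" and "m \<in> M" "m' \<in> M" "m \<noteq> m'"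
  obtains x where "x \<in> ratios p M" "(x + 1) mod int p \<notin> ratios p M"
proof -
  have "\<not> (\<forall>x\<in>ratios p M. (x + 1) mod int p \<in> ratios p M)"
  proof
    assume closed: "\<forall>x\<in>ratios p M. (x + 1) mod int p \<in> ratios p M"
    have "int n \<in> ratios p M" if "n < p" for n
      using that
    proof (induction n)
      case 0
      have "\<exists>a\<in>M. \<exists>b\<in>M. \<exists>c\<in>M. \<exists>d\<in>M. c \<noteq> d \<and> int p dvd 0 * (c - d) - (a - b)"
        using assms(3-5) by (intro bexI[of _ m] bexI[of _ m']) auto
      then show ?case
        using assms by (simp add: ratios_def)
    next
      case (Suc n)
      then have "(int n + 1) mod int p \<in> ratios p M"
        using closed by auto
      moreover have "(int n + 1) mod int p = int (Suc n)"
        using Suc.prems by (simp add: add.commute)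
      ultimately show ?case
        by metis
    qed
    then have "{0..<int p} \<subseteq> ratios p M"
      by (metis atLeastLessThan_iff nat_0_le subsetI nat_less_iff)
    then show False
      using assms by (auto simp: ratios_def)
  qed
  then show ?thesis
    using that by blast
qed

text \<open>
  The sum-product phenomenon, by the pivot argument of Glibichuk and Konyagin. The multipliers \<open>x\<close> for which \<open>A - x A\<close> is
  small include, with a loss that is polynomial in \<open>K\<close>, all expressions of bounded length in elements of \<open>M\<close>. If the
  ratios of \<open>M\<close> exhaust \<open>\<int> / p\<close>, these are \<open>p\<close> multipliers. Otherwise some ratio
  \<open>x = (a - b) / (c - d)\<close> has \<open>x + 1\<close> outside the set of ratios, which means that \<open>m + (x + 1) m'\<close>
  takes \<open>(card M)\<^sup>2\<close> different values; multiplied by \<open>c - d\<close> these are expressions of degree two.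
  In both cases the averaging lemma bounds the number of multipliers by \<open>card A\<close>, up to powers of \<open>K\<close>.
\<close>

lemma sum_product_dilates:
  fixes K L :: real
  assumes p: "prime p" and A: "A \<subseteq> {0..<int p}" "A \<noteq> {}" and M: "M \<subseteq> {0<..<int p}" "1 \<in> M"
    and small: "\<And>m. m \<in> M \<Longrightarrow> real (card (dilate p 1 A -\<^sub>s dilate p m A)) \<le> K * card A"
    and K: "K \<ge> 1"
  defines "L \<equiv> (7 * K\<^sup>2) ^ 7"
  shows "card A \<le> 2 * L \<or> p \<le> 2 * L * card A \<or> (card M)\<^sup>2 \<le> 2 * L * card A"
proof -
  have p0: "p > 0" "prime (int p)"
    using p by (auto simp: prime_gt_0_nat)
  have finM: "finite M" and finA: "finite A"
    using M A finite_subset by auto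
  have ndvd: "\<not> int p dvd m" if "m \<in> M" for m
    using M that zdvd_not_zless[of m "int p"] by auto
  have cdist: "\<not> int p dvd c - d" if "c \<in> M" "d \<in> M" "c \<noteq> d" for c d
  proof -
    have "M \<subseteq> {0..<int p}"
      using M by auto
    then show ?thesis
      using that inj_on_cls[OF p0(1)] p0(1) by (auto simp: cls_eq_iff[symmetric] dest: inj_onD)
  qed
  have A1: "card A \<ge> 1"
    using A finA by (simp add: card_gt_0_iff Suc_leI)
  have K2: "1 \<le> 7 * K\<^sup>2"
  proof -
    have "1 \<le> K\<^sup>2"
      using K by (simp add: one_le_power)
    then show ?thesis
      by simp
  qed
  then have L: "L \<ge> 1"
    unfolding L_def by (rule one_le_power)
  have prod: "real (card (dilate p 1 A -\<^sub>s dilate p (m * m') A)) \<le> K\<^sup>2 * card A" if "m \<in> M" "m' \<in> M" for m m'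
    using dilate_product[OF p A ndvd small small] that by blast
  have lin: "real (card (dilate p 1 A -\<^sub>s dilate p m A)) \<le> K\<^sup>2 * card A" if "m \<in> M" for m
    using prod[OF M(2) that] by simp
  have nfold_le: "real (card (nfold i (\<Union>q\<in>Q. uminus ` dilate p q A) -\<^sub>s nfold j (\<Union>q\<in>Q. uminus ` dilate p q A))) \<le> L * card A"
    if "finite Q" "card Q \<le> 7" "i + j \<le> 7"
      and "\<And>q. q \<in> Q \<Longrightarrow> real (card (dilate p 1 A -\<^sub>s dilate p q A)) \<le> K\<^sup>2 * card A" for Q i j
  proof -
    have "real (card (nfold i (\<Union>q\<in>Q. uminus ` dilate p q A) -\<^sub>s nfold j (\<Union>q\<in>Q. uminus ` dilate p q A)))
        \<le> (7 * K\<^sup>2) ^ (i + j) * card A"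
      using that by (intro dilates_nfold_bound[OF p A]) auto
    also have "\<dots> \<le> L * card A"
      unfolding L_def using that K2 by (intro mult_right_mono power_increasing) auto
    finally show ?thesis .
  qed
  have finnf: "finite (nfold i (\<Union>q\<in>Q. uminus ` dilate p q A) -\<^sub>s nfold j (\<Union>q\<in>Q. uminus ` dilate p q A))"
    if "finite Q" for i j Q
    using that finA by (intro finite_diffset finite_nfold) (auto simp: finite_dilate)
  consider "card M \<le> 1" | m m' where "m \<in> M" "m' \<in> M" "m \<noteq> m'"
    using finM by (metis One_nat_def card_le_Suc0_iff_eq)
  then show ?thesis
  proof cases
    case 1
    have "(card M)\<^sup>2 \<le> 1"
      using power_mono[OF 1, of 2] by simp
    moreover have "1 * 1 \<le> L * card A"
      using L A1 by (intro mult_mono) auto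
    ultimately have "real ((card M)\<^sup>2) \<le> 2 * L * card A"
      by linarith
    then show ?thesis
      by simp
  next
    case 2
    show ?thesis
    proof (cases "ratios p M = {0..<int p}")
      case True
      have "real (card (dilate p 1 A -\<^sub>s dilate p x A)) \<le> L * card A" if x: "x \<in> {0..<int p}" for x
      proof -
        have "x \<in> ratios p M"
          using True x by simp
        then obtain a b c d where h: "a \<in> M" "b \<in> M" "c \<in> M" "d \<in> M" "c \<noteq> d"
            "int p dvd x * (c - d) - (a - b)"
          by (auto simp: ratios_def)
        let ?Q = "{a, b, c, d}"
        let ?B = "\<Union>q\<in>?Q. uminus ` dilate p q A"
        have "card (dilate p 1 A -\<^sub>s dilate p x A) = card (dilate p (c - d) A -\<^sub>s dilate p (a - b) A)"
        proof (rule card_dilate_diff_scale[symmetric, OF p cdist])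
          show "int p dvd a - b - (c - d) * x"
            using h(6) by (metis dvd_minus_iff minus_diff_eq mult.commute)
        qed (use h in auto)
        also have "\<dots> \<le> card (nfold 2 ?B -\<^sub>s nfold 2 ?B)"
        proof (rule card_mono[OF finnf])
          show "dilate p (c - d) A -\<^sub>s dilate p (a - b) A \<subseteq> nfold 2 ?B -\<^sub>s nfold 2 ?B"
          proof
            fix t assume "t \<in> dilate p (c - d) A -\<^sub>s dilate p (a - b) A"
            then obtain y z where yz: "y \<in> A" "z \<in> A" "t = cls p ((c - d) * y - (a - b) * z)"
              by (auto simp: dilate_diff_eq)
            show "t \<in> nfold 2 ?B -\<^sub>s nfold 2 ?B"
              unfolding numeral_2_eq_2
            proof (rule diffset_I)
              show "- cls p (d * y) + (- cls p (a * z) + 0) \<in> nfold (Suc (Suc 0)) ?B"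
                by (intro nfold_Suc_I nfold_0_I uminus_cls_in_dilates yz) auto
              show "- cls p (c * y) + (- cls p (b * z) + 0) \<in> nfold (Suc (Suc 0)) ?B"
                by (intro nfold_Suc_I nfold_0_I uminus_cls_in_dilates yz) auto
              show "t = - cls p (d * y) + (- cls p (a * z) + 0) - (- cls p (c * y) + (- cls p (b * z) + 0))"
                by (simp add: yz(3) left_diff_distrib cls_diff)
            qed
          qed
        qed auto
        finally have "real (card (dilate p 1 A -\<^sub>s dilate p x A)) \<le> real (card (nfold 2 ?B -\<^sub>s nfold 2 ?B))"
          by simp
        also have "\<dots> \<le> L * card A"
        proof (rule nfold_le)
          show "card ?Q \<le> 7"
            using card_insert_le_m1 card_length[of "[a, b, c, d]"] by simp
        qed (use lin h in auto)
        finally show ?thesis .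
      qed
      then have "real (card {0..<int p}) \<le> 2 * L * card A" if "2 * L \<le> card A"
        using L that by (intro dilates_average[OF p A(1)]) auto
      then show ?thesis
        by auto
    next
      case False
      then obtain x where x: "x \<in> ratios p M" "(x + 1) mod int p \<notin> ratios p M"
        using ratios_dichotomy[OF p0(1) _ 2] by blast
      then obtain a b c d where h: "a \<in> M" "b \<in> M" "c \<in> M" "d \<in> M" "c \<noteq> d"
          "int p dvd x * (c - d) - (a - b)"
        by (auto simp: ratios_def)
      define \<phi> where "\<phi> = (\<lambda>(m, m'). ((c - d) * m + (a - b + (c - d)) * m') mod int p)"
      have inj: "inj_on \<phi> (M \<times> M)"
      proof (rule inj_onI, clarify)
        fix m1 m1' m2 m2'
        assume m: "m1 \<in> M" "m1' \<in> M" "m2 \<in> M" "m2' \<in> M" "\<phi> (m1, m1') = \<phi> (m2, m2')"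
        have "int p dvd ((c - d) * m1 + (a - b + (c - d)) * m1') - ((c - d) * m2 + (a - b + (c - d)) * m2')"
          using m(5) by (simp add: \<phi>_def mod_eq_dvd_iff)
        then have *: "int p dvd (c - d) * (m1 - m2) - (a - b + (c - d)) * (m2' - m1')"
          by (simp add: algebra_simps)
        have "m1' = m2'"
        proof (rule ccontr)
          assume ne: "m1' \<noteq> m2'"
          \<comment> \<open>a collision would exhibit \<open>x + 1\<close> as the ratio \<open>(m1 - m2) / (m2' - m1')\<close>\<close>
          have "(c - d) * ((x + 1) * (m2' - m1') - (m1 - m2)) =
              (x * (c - d) - (a - b)) * (m2' - m1') - ((c - d) * (m1 - m2) - (a - b + (c - d)) * (m2' - m1'))"
            by (simp add: algebra_simps)
          also have "int p dvd \<dots>"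
            by (rule dvd_diff[OF dvd_mult2[OF h(6)] *])
          finally have "int p dvd (x + 1) * (m2' - m1') - (m1 - m2)"
            using cdist[OF h(3,4,5)] p0 prime_dvd_mult_iff by blast
          moreover have "((x + 1) mod int p) * (m2' - m1') - (m1 - m2) =
              (x + 1) * (m2' - m1') - (m1 - m2) - int p * (((x + 1) div int p) * (m2' - m1'))"
            by (simp add: minus_mult_div_eq_mod[symmetric] algebra_simps)
          ultimately have "int p dvd ((x + 1) mod int p) * (m2' - m1') - (m1 - m2)"
            by (metis dvd_diff dvd_triv_left)
          then have "(x + 1) mod int p \<in> ratios p M"
            using m ne p0 unfolding ratios_def
            by (intro CollectI conjI bexI[of _ m1] bexI[of _ m2] bexI[of _ m2'] bexI[of _ m1']) auto
          then show False
            using x by simp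
        qed
        moreover from this * have "int p dvd (c - d) * (m1 - m2)"
          by simp
        then have "int p dvd m1 - m2"
          using cdist[OF h(3,4,5)] p0 prime_dvd_mult_iff by blast
        then have "m1 = m2"
          using cdist[OF m(1,3)] by blast
        ultimately show "m1 = m2 \<and> m1' = m2'"
          by simp
      qed
      have "real (card (dilate p 1 A -\<^sub>s dilate p y A)) \<le> L * card A" if y: "y \<in> \<phi> ` (M \<times> M)" for y
      proof -
        obtain m m' where m: "m \<in> M" "m' \<in> M" "y = \<phi> (m, m')"
          using y by auto
        let ?Q = "{1, c * m, d * m, a * m', b * m', c * m', d * m'}"
        let ?B = "\<Union>q\<in>?Q. uminus ` dilate p q A"
        have "dilate p 1 A -\<^sub>s dilate p y A \<subseteq> nfold 3 ?B -\<^sub>s nfold 4 ?B"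
        proof
          fix t assume "t \<in> dilate p 1 A -\<^sub>s dilate p y A"
          then obtain u v where uv: "u \<in> A" "v \<in> A" "t = cls p (1 * u - y * v)"
            by (auto simp: dilate_diff_eq)
          let ?y = "(c - d) * m + (a - b + (c - d)) * m'"
          have "?y - y = int p * (?y div int p)"
            by (simp add: m \<phi>_def minus_mod_eq_mult_div)
          then have "int p dvd (?y - y) * v"
            by simp
          moreover have "(1 * u - y * v) - (1 * u - ?y * v) = (?y - y) * v"
            by (simp add: algebra_simps)
          ultimately have t: "t = cls p (1 * u - ?y * v)"
            using p0 by (simp only: uv cls_eq_iff)
          have e: "1 * u - ?y * v = - (c * m * v) + (- (a * m' * v) + (- (c * m' * v) + 0))
              - (- (1 * u) + (- (d * m * v) + (- (b * m' * v) + (- (d * m' * v) + 0))))"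
            by (simp add: algebra_simps)
          have n: "3 = Suc (Suc (Suc 0))" "4 = Suc (Suc (Suc (Suc 0)))"
            by simp_all
          show "t \<in> nfold 3 ?B -\<^sub>s nfold 4 ?B"
            unfolding n
          proof (rule diffset_I)
            show "- cls p (c * m * v) + (- cls p (a * m' * v) + (- cls p (c * m' * v) + 0)) \<in> nfold (Suc (Suc (Suc 0))) ?B"
              by (intro nfold_Suc_I nfold_0_I uminus_cls_in_dilates uv) auto
            show "- cls p (1 * u) + (- cls p (d * m * v) + (- cls p (b * m' * v) + (- cls p (d * m' * v) + 0)))
                \<in> nfold (Suc (Suc (Suc (Suc 0)))) ?B"
              by (intro nfold_Suc_I nfold_0_I uminus_cls_in_dilates uv) auto
            show "t = - cls p (c * m * v) + (- cls p (a * m' * v) + (- cls p (c * m' * v) + 0))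
                - (- cls p (1 * u) + (- cls p (d * m * v) + (- cls p (b * m' * v) + (- cls p (d * m' * v) + 0))))"
              unfolding t e by (simp only: cls_diff cls_add cls_minus cls_0)
          qed
        qed
        then have "card (dilate p 1 A -\<^sub>s dilate p y A) \<le> card (nfold 3 ?B -\<^sub>s nfold 4 ?B)"
          by (intro card_mono finnf) auto
        then have "real (card (dilate p 1 A -\<^sub>s dilate p y A)) \<le> real (card (nfold 3 ?B -\<^sub>s nfold 4 ?B))"
          by simp
        also have "\<dots> \<le> L * card A"
        proof (rule nfold_le)
          show "card ?Q \<le> 7"
            using card_length[of "[1, c * m, d * m, a * m', b * m', c * m', d * m']"] by simp
        qed (use lin[OF M(2)] prod h m in auto)
        finally show ?thesis .
      qed
      moreover have "\<phi> ` (M \<times> M) \<subseteq> {0..<int p}"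
        using p0 by (auto simp: \<phi>_def)
      ultimately have "real (card (\<phi> ` (M \<times> M))) \<le> 2 * L * card A" if "2 * L \<le> card A"
        using L that by (intro dilates_average[OF p A(1)]) auto
      moreover have "card (\<phi> ` (M \<times> M)) = (card M)\<^sup>2"
        using inj by (simp add: card_image card_cartesian_product power2_eq_square)
      ultimately show ?thesis
        by auto
    qed
  qed
qed

section \<open>Partial sumsets in many directions\<close>

lemma card_diffset_commute: "card (A -\<^sub>s B) = card (B -\<^sub>s A)"
proof -
  have "A -\<^sub>s B = uminus ` (B -\<^sub>s A)"
    by (force simp: diffset_def)
  then show ?thesis
    by (simp add: card_image)
qed

lemma diffset_mono: "A \<subseteq> A' \<Longrightarrow> B \<subseteq> B' \<Longrightarrow> A -\<^sub>s B \<subseteq> A' -\<^sub>s B'"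
  by (auto simp: diffset_def)

lemma dilate_mono: "A \<subseteq> A' \<Longrightarrow> dilate p c A \<subseteq> dilate p c A'"
  by (auto simp: dilate_def)

lemma ruzsa_triangle_real:
  fixes A B C :: "'a::ab_group_add set" and u v b :: real
  assumes "finite A" "finite B" "finite C" "real (card (A -\<^sub>s B)) \<le> u" "real (card (B -\<^sub>s C)) \<le> v"
    "b \<le> real (card B)" "b > 0"
  shows "real (card (A -\<^sub>s C)) \<le> u * v / b"
proof -
  have "real (card (A -\<^sub>s C)) * b \<le> real (card (A -\<^sub>s C)) * card B"
    using assms by (intro mult_left_mono) auto
  also have "\<dots> \<le> real (card (A -\<^sub>s B)) * card (B -\<^sub>s C)"
    using ruzsa_triangle[OF assms(1-3)] by (simp flip: of_nat_mult)
  also have "\<dots> \<le> u * v"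
    using assms by (intro mult_mono) (auto intro: order_trans[OF of_nat_0_le_iff])
  finally show ?thesis
    using assms by (simp add: field_simps)
qed

text \<open>
  If \<open>x + m y\<close> takes few values on a dense part of \<open>X \<times> Y\<close> for many \<open>m\<close>, the Balog--Szemeredi--Gowers
  theorem gives for each \<open>m\<close> large sets \<open>X' m\<close>, \<open>Y' m\<close> with few sums \<open>x + m y\<close>. These
  sets vary with \<open>m\<close>; but for one \<open>m0\<close> and many \<open>m\<close> they have large intersections with those of \<open>m0\<close>,
  and Ruzsa's triangle inequality, used through the intersections \<open>I\<close> and \<open>J\<close>, transfers the estimate to
  the single set \<open>Y0 = Y' m0\<close>: the difference \<open>m0 Y0 - m Y0\<close> is small. The sum-product
  estimate applies to \<open>Y0\<close> and the multipliers \<open>m / m0\<close>.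
\<close>

lemma partial_sumsets_small:
  fixes N K :: real
  assumes p: "prime p" and X: "X \<subseteq> {0..<int p}" and Y: "Y \<subseteq> {0..<int p}"
    and M: "M \<subseteq> {0<..<int p}"
    and N: "N > 0" "real (card X) \<le> N" "real (card Y) \<le> N"
    and K: "K \<ge> 1" and cM: "N / K \<le> real (card M)"
    and EXY: "\<And>m. m \<in> M \<Longrightarrow> E m \<subseteq> X \<times> Y"
    and E: "\<And>m. m \<in> M \<Longrightarrow> N\<^sup>2 / K \<le> real (card (E m))"
    and S: "\<And>m. m \<in> M \<Longrightarrow> real (card ((\<lambda>(x, y). cls p (x + m * y)) ` E m)) \<le> N"
  defines "K1 \<equiv> 8 * K * (4096 * K ^ 5) ^ 4 * (8192 * K ^ 4) ^ 3"
  defines "L \<equiv> (7 * K1\<^sup>2) ^ 7"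
  shows "N \<le> 2 ^ 27 * K ^ 10 * L \<or> real p \<le> 2 * L * N"
proof -
  have p0: "p > 0" "prime (int p)"
    using p by (auto simp: prime_gt_0_nat)
  have fin: "finite X" "finite Y" "finite M"
    using finite_subset[OF X] finite_subset[OF Y] finite_subset[OF M] by simp_all
  define D c where "D = 4096 * K ^ 5" and "c = 8192 * K ^ 4"
  have Kc: "8 * K \<le> c" "c > 0" "D > 0"
  proof -
    have "K ^ 1 \<le> K ^ 4"
      using K by (intro power_increasing) auto
    then have "8 * K \<le> 8192 * K ^ 4"
      using K by (intro mult_mono) auto
    then show "8 * K \<le> c" "c > 0" "D > 0"
      using K by (auto simp: c_def D_def)
  qed
  have ndvd: "\<not> int p dvd m" if "m \<in> M" for m
    using M that zdvd_not_zless[of m "int p"] by auto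
  have "\<exists>X' Y'. X' \<subseteq> X \<and> Y' \<subseteq> Y \<and> N / (8 * K) \<le> real (card X') \<and> N / (8 * K) \<le> real (card Y') \<and>
    real (card (dilate p 1 X' -\<^sub>s dilate p (- m) Y')) \<le> D * N" if m: "m \<in> M" for m
  proof -
    have "inj_on (\<lambda>y. cls p (m * y)) Y"
      using card_dilate[OF p ndvd[OF m] Y] fin by (simp add: dilate_def eq_card_imp_inj_on)
    moreover have "real (card ((\<lambda>(x, y). cls p x + cls p (m * y)) ` E m)) \<le> N"
      using S[OF m] by (simp add: cls_add)
    ultimately obtain X' Y' where "X' \<subseteq> X" "Y' \<subseteq> Y" "N / (8 * K) \<le> real (card X')" "N / (8 * K) \<le> real (card Y')"
      "real (card ((\<lambda>(x, y). cls p x + cls p (m * y)) ` (X' \<times> Y'))) \<le> 4096 * K ^ 5 * N"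
      using balog_szemeredi_gowers[OF fin(1,2) EXY[OF m] N _ E[OF m] inj_on_cls[OF p0(1) X], of "\<lambda>y. cls p (m * y)"] K
      by auto
    then show ?thesis
      unfolding dilate_diff_eq D_def by (intro exI[of _ X'] exI[of _ Y']) (simp add: cls_add)
  qed
  then obtain X' Y' where XY: "\<And>m. m \<in> M \<Longrightarrow> X' m \<subseteq> X" "\<And>m. m \<in> M \<Longrightarrow> Y' m \<subseteq> Y"
    "\<And>m. m \<in> M \<Longrightarrow> N / (8 * K) \<le> real (card (X' m))" "\<And>m. m \<in> M \<Longrightarrow> N / (8 * K) \<le> real (card (Y' m))"
    and small: "\<And>m. m \<in> M \<Longrightarrow> real (card (dilate p 1 (X' m) -\<^sub>s dilate p (- m) (Y' m))) \<le> D * N"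
    by metis
  define R where "R m = X' m \<times> Y' m" for m
  have "M \<noteq> {}"
    using cM N K by (auto simp: divide_le_0_iff)
  moreover have "R m \<subseteq> X \<times> Y" if "m \<in> M" for m
    using XY that by (auto simp: R_def)
  moreover have "N\<^sup>2 / (64 * K\<^sup>2) \<le> real (card (R m))" if "m \<in> M" for m
  proof -
    have "N / (8 * K) * (N / (8 * K)) \<le> real (card (X' m)) * real (card (Y' m))"
      using XY(3,4)[OF that] N K by (intro mult_mono) auto
    then show ?thesis
      by (simp add: R_def card_cartesian_product power2_eq_square)
  qed
  moreover have "real (card (X \<times> Y)) \<le> N\<^sup>2"
    using N by (auto simp: card_cartesian_product power2_eq_square intro!: mult_mono)
  moreover have "N\<^sup>2 / (64 * K\<^sup>2) > 0"
    using N K by simp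
  ultimately obtain m0 where m0: "m0 \<in> M" and M'0:
    "real (card M) * ((N\<^sup>2 / (64 * K\<^sup>2))\<^sup>2 / (2 * (N\<^sup>2)\<^sup>2)) \<le>
      real (card {m\<in>M. (N\<^sup>2 / (64 * K\<^sup>2))\<^sup>2 / (2 * N\<^sup>2) \<le> real (card (R m \<inter> R m0))})"
    using popular_intersection[of M "X \<times> Y" R "N\<^sup>2 / (64 * K\<^sup>2)" "N\<^sup>2"] fin by blast
  define M' where "M' = {m\<in>M. N\<^sup>2 / c \<le> real (card (R m \<inter> R m0))}"
  have e: "(N\<^sup>2 / (64 * K\<^sup>2))\<^sup>2 / (2 * N\<^sup>2) = N\<^sup>2 / c" "(N\<^sup>2 / (64 * K\<^sup>2))\<^sup>2 / (2 * (N\<^sup>2)\<^sup>2) = 1 / c"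
    using N K by (simp_all add: c_def field_simps eval_nat_numeral)
  have cM': "real (card M) / c \<le> real (card M')"
    using M'0[unfolded e] by (simp add: M'_def)
  have M': "M' \<subseteq> M"
    by (auto simp: M'_def)
  define Y0 where "Y0 = Y' m0"
  have Y0: "Y0 \<subseteq> {0..<int p}" "finite Y0" "N / (8 * K) \<le> real (card Y0)" "real (card Y0) \<le> N"
  proof -
    show "Y0 \<subseteq> {0..<int p}" "N / (8 * K) \<le> real (card Y0)"
      using XY(2,4)[OF m0] Y by (auto simp: Y0_def)
    have "card Y0 \<le> card Y"
      using XY m0 fin by (intro card_mono) (auto simp: Y0_def)
    then show "real (card Y0) \<le> N"
      using N by linarith
    show "finite Y0"
      unfolding Y0_def by (rule finite_subset[OF XY(2)[OF m0] fin(2)])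
  qed
  have N8: "N / c \<le> N / (8 * K)"
    using Kc K N by (intro divide_left_mono) auto
  have p1: "\<not> int p dvd 1"
    using p by (auto dest: prime_gt_1_nat)
  \<comment> \<open>the chain \<open>m0 Y0\<close>, \<open>I\<close>, \<open>m J\<close>, \<open>m Y0\<close> of small differences, up to signs\<close>
  have bound: "real (card (dilate p m0 Y0 -\<^sub>s dilate p m Y0)) \<le> K1 * card Y0" if m: "m \<in> M'" for m
  proof -
    have mM: "m \<in> M" and IJ: "N\<^sup>2 / c \<le> real (card (R m \<inter> R m0))"
      using m by (auto simp: M'_def)
    define I J where "I = X' m \<inter> X' m0" and "J = Y' m \<inter> Y0"
    have I: "I \<subseteq> X' m" "I \<subseteq> X' m0" "finite I" "I \<subseteq> {0..<int p}" "real (card I) \<le> N"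
      and J: "J \<subseteq> Y' m" "J \<subseteq> Y0" "finite J" "J \<subseteq> {0..<int p}" "real (card J) \<le> N"
    proof -
      show "I \<subseteq> X' m" "I \<subseteq> X' m0" "J \<subseteq> Y' m" "J \<subseteq> Y0"
        by (auto simp: I_def J_def)
      have "I \<subseteq> X" "J \<subseteq> Y"
        using XY m0 by (auto simp: I_def J_def Y0_def)
      then show "finite I" "finite J" "I \<subseteq> {0..<int p}" "J \<subseteq> {0..<int p}"
        using X Y fin finite_subset by blast+
      show "real (card I) \<le> N" "real (card J) \<le> N"
        using card_mono[OF fin(1) \<open>I \<subseteq> X\<close>] card_mono[OF fin(2) \<open>J \<subseteq> Y\<close>] N by linarith+
    qed
    have "R m \<inter> R m0 = I \<times> J"
      by (auto simp: R_def I_def J_def Y0_def)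
    then have prod: "N\<^sup>2 / c \<le> real (card I) * real (card J)"
      using IJ by (simp add: card_cartesian_product)
    have cI: "N / c \<le> real (card I)"
    proof -
      have "N * (N / c) \<le> N * real (card I)"
        using prod mult_left_mono[OF J(5), of "real (card I)"] by (simp add: power2_eq_square mult.commute)
      then show ?thesis
        by (rule mult_left_le_imp_le[OF _ N(1)])
    qed
    have cJ: "N / c \<le> real (card J)"
    proof -
      have "N * (N / c) \<le> N * real (card J)"
        using prod mult_right_mono[OF I(5), of "real (card J)"] by (simp add: power2_eq_square)
      then show ?thesis
        by (rule mult_left_le_imp_le[OF _ N(1)])
    qed
    have c0: "N / c > 0"
      using N Kc by simp
    note fins = finite_dilate[OF Y0(2)] finite_dilate[OF I(3)] finite_dilate[OF J(3)]
    have finX0: "finite (dilate p c (X' m0))" for c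
      using finite_subset[OF XY(1)[OF m0] fin(1)] by (rule finite_dilate)
    have YI: "real (card (dilate p (- m0) Y0 -\<^sub>s dilate p 1 I)) \<le> D * N"
    proof -
      have "card (dilate p (- m0) Y0 -\<^sub>s dilate p 1 I) = card (dilate p 1 I -\<^sub>s dilate p (- m0) Y0)"
        by (rule card_diffset_commute)
      also have "\<dots> \<le> card (dilate p 1 (X' m0) -\<^sub>s dilate p (- m0) Y0)"
        using I by (intro card_mono diffset_mono dilate_mono finite_diffset finX0 fins) auto
      finally show ?thesis
        using small[OF m0] by (simp add: Y0_def)
    qed
    have IJ: "real (card (dilate p 1 I -\<^sub>s dilate p (- m) J)) \<le> D * N"
    proof -
      have "finite (X' m)" "finite (Y' m)"
        using finite_subset[OF XY(1)[OF mM] fin(1)] finite_subset[OF XY(2)[OF mM] fin(2)] by simp_all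
      then have "card (dilate p 1 I -\<^sub>s dilate p (- m) J) \<le> card (dilate p 1 (X' m) -\<^sub>s dilate p (- m) (Y' m))"
        using I J by (intro card_mono diffset_mono dilate_mono finite_diffset finite_dilate) auto
      then show ?thesis
        using small[OF mM] by linarith
    qed
    have "real (card (dilate p 1 I)) \<ge> N / c"
      using cI card_dilate[OF p p1 I(4)] by simp
    from ruzsa_triangle_real[OF fins(1) fins(2) fins(3) YI IJ this c0]
    have 1: "real (card (dilate p (- m0) Y0 -\<^sub>s dilate p (- m) J)) \<le> D * N * (D * N) / (N / c)" .
    have "real (card (dilate p 1 (X' m0))) \<ge> N / c"
      using XY(1,3)[OF m0] X card_dilate[OF p p1, of "X' m0"] N8 by fastforce
    moreover have sY: "real (card (dilate p 1 (X' m0) -\<^sub>s dilate p (- m0) Y0)) \<le> D * N"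
      using small[OF m0] by (simp add: Y0_def)
    moreover have "real (card (dilate p (- m0) Y0 -\<^sub>s dilate p 1 (X' m0))) \<le> D * N"
      using sY by (subst card_diffset_commute)
    ultimately have YY: "real (card (dilate p (- m0) Y0 -\<^sub>s dilate p (- m0) Y0)) \<le> D * N * (D * N) / (N / c)"
      using ruzsa_triangle_real[OF fins(1) finX0 fins(1) _ _ _ c0] by blast
    have "card (dilate p (- m) J -\<^sub>s dilate p (- m) Y0) = card (dilate p 1 J -\<^sub>s dilate p 1 Y0)"
      by (rule card_dilate_diff_scale[OF p, of "- m"]) (use ndvd[OF mM] in auto)
    also have "\<dots> = card (dilate p (- m0) J -\<^sub>s dilate p (- m0) Y0)"
      by (rule card_dilate_diff_scale[OF p, of "- m0", symmetric]) (use ndvd[OF m0] in auto)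
    also have "\<dots> \<le> card (dilate p (- m0) Y0 -\<^sub>s dilate p (- m0) Y0)"
      using J by (intro card_mono diffset_mono dilate_mono finite_diffset fins) auto
    finally have 2: "real (card (dilate p (- m) J -\<^sub>s dilate p (- m) Y0)) \<le> D * N * (D * N) / (N / c)"
      using YY by linarith
    have "\<not> int p dvd - m"
      using ndvd[OF mM] by simp
    then have "real (card (dilate p (- m) J)) \<ge> N / c"
      using cJ card_dilate[OF p _ J(4)] by simp
    from ruzsa_triangle_real[OF fins(1) fins(3) fins(1) 1 2 this c0]
    have 3: "real (card (dilate p (- m0) Y0 -\<^sub>s dilate p (- m) Y0)) \<le>
        D * N * (D * N) / (N / c) * (D * N * (D * N) / (N / c)) / (N / c)" .
    also have "\<dots> = D ^ 4 * c ^ 3 * N"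
      using N Kc by (simp add: field_simps eval_nat_numeral)
    also have "\<dots> \<le> D ^ 4 * c ^ 3 * (8 * K * card Y0)"
      using Y0(3) K Kc by (intro mult_left_mono) (auto simp: field_simps)
    also have "\<dots> = K1 * card Y0"
      by (simp add: K1_def D_def c_def)
    also have "card (dilate p (- m0) Y0 -\<^sub>s dilate p (- m) Y0) = card (dilate p m0 Y0 -\<^sub>s dilate p m Y0)"
      by (rule card_dilate_diff_scale[OF p, of "-1"]) (use p1 in auto)
    finally show ?thesis .
  qed
  have "coprime m0 (int p)"
    using p0(2) ndvd[OF m0] by (metis coprime_commute prime_imp_coprime)
  then obtain k where "[m0 * k = 1] (mod int p)"
    using cong_solve_coprime_int by blast
  then have k: "int p dvd m0 * k - 1"
    by (simp add: cong_iff_dvd_diff)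
  have pk: "\<not> int p dvd k"
  proof
    assume "int p dvd k"
    then have "int p dvd m0 * k"
      by simp
    then have "int p dvd m0 * k - (m0 * k - 1)"
      using k by (rule dvd_diff)
    then show False
      using p1 by simp
  qed
  define M2 where "M2 = (\<lambda>m. (m * k) mod int p) ` M'"
  have m0M': "m0 \<in> M'"
  proof -
    have "N\<^sup>2 / c \<le> N\<^sup>2 / (64 * K\<^sup>2)"
    proof (intro divide_left_mono)
      have "K\<^sup>2 \<le> K ^ 4"
        using K by (intro power_increasing) auto
      then show "64 * K\<^sup>2 \<le> c"
        unfolding c_def by (intro mult_mono) auto
    qed (use N K Kc in auto)
    also have "\<dots> = N / (8 * K) * (N / (8 * K))"
      by (simp add: power2_eq_square)
    also have "\<dots> \<le> real (card (X' m0)) * real (card (Y' m0))"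
      using XY(3,4)[OF m0] N K by (intro mult_mono) auto
    finally show ?thesis
      using m0 by (simp add: M'_def R_def card_cartesian_product)
  qed
  have "inj_on (\<lambda>m. (m * k) mod int p) M'"
  proof (rule inj_onI)
    fix m n assume mn: "m \<in> M'" "n \<in> M'" "(m * k) mod int p = (n * k) mod int p"
    then have "int p dvd (m - n) * k"
      by (simp add: mod_eq_dvd_iff left_diff_distrib)
    then have "cls p m = cls p n"
      using pk p0 by (simp add: prime_dvd_mult_iff cls_eq_iff)
    moreover have "M' \<subseteq> {0..<int p}"
      using M' M by auto
    ultimately show "m = n"
      using mn inj_on_cls[OF p0(1)] by (auto dest: inj_onD)
  qed
  then have cM2: "card M2 = card M'"
    by (simp add: M2_def card_image)
  have M2: "M2 \<subseteq> {0<..<int p}"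
  proof
    fix x assume "x \<in> M2"
    then obtain m where m: "m \<in> M'" "x = (m * k) mod int p"
      by (auto simp: M2_def)
    have "\<not> int p dvd m * k"
      using ndvd m M' pk p0 by (auto simp: prime_dvd_mult_iff)
    then have "x \<noteq> 0"
      by (auto simp: m mod_eq_0_iff_dvd)
    moreover have "0 \<le> x" "x < int p"
      using p0 by (auto simp: m)
    ultimately show "x \<in> {0<..<int p}"
      by auto
  qed
  have one: "1 \<in> M2"
  proof -
    have "(m0 * k) mod int p = 1 mod int p"
      using k by (simp add: mod_eq_dvd_iff)
    also have "\<dots> = 1"
      using prime_gt_1_nat[OF p] by simp
    finally show ?thesis
      using m0M' by (force simp: M2_def)
  qed
  have small2: "real (card (dilate p 1 Y0 -\<^sub>s dilate p x Y0)) \<le> K1 * card Y0" if x: "x \<in> M2" for x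
  proof -
    obtain m where m: "m \<in> M'" "x = (m * k) mod int p"
      using x by (auto simp: M2_def)
    have "m - m0 * x = m0 * (m * k - x) - m * (m0 * k - 1)"
      by (simp add: algebra_simps)
    also have "int p dvd \<dots>"
    proof (rule dvd_diff[OF dvd_mult dvd_mult[OF k]])
      show "int p dvd m * k - x"
        by (simp add: m minus_mod_eq_mult_div)
    qed
    finally have "card (dilate p m0 Y0 -\<^sub>s dilate p m Y0) = card (dilate p 1 Y0 -\<^sub>s dilate p x Y0)"
      by (intro card_dilate_diff_scale[OF p ndvd[OF m0]]) auto
    then show ?thesis
      using bound[OF m(1)] by simp
  qed
  have "Y0 \<noteq> {}"
    using Y0(3) N K by (auto simp: divide_le_0_iff)
  moreover have "K1 \<ge> 1"
  proof -
    have "1 \<le> K * ((K ^ 5) ^ 4 * (K ^ 4) ^ 3)"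
      using K by (metis one_le_power mult_ge1_I)
    then show ?thesis
      unfolding K1_def power_mult_distrib by (simp add: algebra_simps)
  qed
  ultimately have "card Y0 \<le> 2 * L \<or> p \<le> 2 * L * card Y0 \<or> (card M2)\<^sup>2 \<le> 2 * L * card Y0"
    unfolding L_def using sum_product_dilates[OF p Y0(1) _ M2 one small2] by blast
  moreover have L0: "L \<ge> 0"
    using K by (simp add: L_def)
  moreover have N1: "N \<le> 2 ^ 27 * K ^ 10 * L" if "N \<le> 16 * K * L"
  proof -
    have "16 * K ^ 1 \<le> 2 ^ 27 * K ^ 10"
      using K by (intro mult_mono power_increasing) auto
    then have "16 * K * L \<le> 2 ^ 27 * K ^ 10 * L"
      using L0 by (intro mult_right_mono) auto
    then show ?thesis
      using that by linarith
  qed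
  moreover have "N \<le> 16 * K * L" if "card Y0 \<le> 2 * L"
  proof -
    have "N / (8 * K) \<le> 2 * L"
      using that Y0(3) by linarith
    then show ?thesis
      using K by (simp add: field_simps)
  qed
  moreover have "real p \<le> 2 * L * N" if "p \<le> 2 * L * card Y0"
    using that Y0(4) L0 mult_left_mono[of "real (card Y0)" N "2 * L"] by linarith
  moreover have "N \<le> 2 ^ 27 * K ^ 10 * L" if "(card M2)\<^sup>2 \<le> 2 * L * card Y0"
  proof -
    have "N / K / c \<le> real (card M2)"
      using divide_right_mono[OF cM, of c] cM' cM2 Kc by linarith
    then have "(N / K / c)\<^sup>2 \<le> (real (card M2))\<^sup>2"
      using N K Kc by (intro power_mono) auto
    also have "\<dots> \<le> 2 * L * N"
      using that Y0(4) L0 mult_left_mono[of "real (card Y0)" N "2 * L"] by simp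
    finally have "N * N \<le> N * (2 * L * (K * c)\<^sup>2)"
      using K Kc by (simp add: field_simps power2_eq_square)
    then have "N \<le> 2 * L * (K * c)\<^sup>2"
      using N by simp
    also have "\<dots> = 2 ^ 27 * K ^ 10 * L"
      by (simp add: c_def power_mult_distrib eval_nat_numeral)
    finally show ?thesis .
  qed
  ultimately show ?thesis
    by blast
qed

section \<open>The additive energy of points on the parabola\<close>

text \<open>
  The combination \<open>P x + P y - P z\<close> of three points \<open>P x = (x, x\<^sup>2)\<close> of the parabola modulo \<open>p\<close>. The number of
  its collisions is the sixth-moment additive energy of a set of points on the parabola.
\<close>

definition psum :: "nat \<Rightarrow> int \<times> int \<times> int \<Rightarrow> int \<times> int" where
  "psum p = (\<lambda>(x, y, z). ((x + y - z) mod int p, (x\<^sup>2 + y\<^sup>2 - z\<^sup>2) mod int p))"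

definition nondegenerate :: "int set \<Rightarrow> (int \<times> int \<times> int) set" where
  "nondegenerate A = {(x, y, z). x \<in> A \<and> y \<in> A \<and> z \<in> A \<and> z \<noteq> x \<and> z \<noteq> y}"

lemma residues_eqI:
  assumes "p > 0" "A \<subseteq> {0..<int p}" "x \<in> A" "y \<in> A" "int p dvd x - y"
  shows "x = y"
  using assms inj_on_cls[of p A] by (auto simp: cls_eq_iff[symmetric] dest: inj_onD)

text \<open>
  The identity behind the incidence structure. With \<open>u = x + y - z\<close> and \<open>v = x\<^sup>2 + y\<^sup>2 - z\<^sup>2\<close> one has
  \<open>u\<^sup>2 - v = 2 (z - x) (z - y)\<close> and \<open>z - y = x - u\<close>; so for \<open>z \<noteq> x\<close> and \<open>z \<noteq> y\<close> the reciprocal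
  \<open>1 / (z - x) = 2 (x - u) / (u\<^sup>2 - v)\<close> is a linear function of \<open>x\<close>, determined by \<open>(u, v)\<close>.
\<close>

lemma psum_discriminant:
  assumes "psum p (x, y, z) = (u, v)"
  shows "int p dvd (u\<^sup>2 - v) - 2 * (z - x) * (z - y)" "int p dvd (x - u) - (z - y)"
proof -
  have u: "int p dvd (x + y - z) - u" and v: "int p dvd (x\<^sup>2 + y\<^sup>2 - z\<^sup>2) - v"
    using assms by (auto simp: psum_def minus_mod_eq_mult_div)
  have "(u\<^sup>2 - v) - 2 * (z - x) * (z - y) =
      ((x\<^sup>2 + y\<^sup>2 - z\<^sup>2) - v) - ((x + y - z) - u) * ((x + y - z) + u)"
    by (simp add: algebra_simps power2_eq_square)
  also have "int p dvd \<dots>"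
    by (rule dvd_diff[OF v dvd_mult2[OF u]])
  finally show "int p dvd (u\<^sup>2 - v) - 2 * (z - x) * (z - y)" .
  show "int p dvd (x - u) - (z - y)"
    using u by (simp add: algebra_simps)
qed

lemma psum_nondegenerate_iff:
  assumes p: "prime p" "p > 2" and A: "A \<subseteq> {0..<int p}" and s: "(x, y, z) \<in> A \<times> A \<times> A" "psum p (x, y, z) = (u, v)"
  shows "(x, y, z) \<in> nondegenerate A \<longleftrightarrow> \<not> int p dvd u\<^sup>2 - v"
proof -
  have p0: "p > 0" "prime (int p)"
    using p by auto
  have p2: "\<not> int p dvd 2"
    using p by (auto dest: zdvd_imp_le)
  have xyz: "x \<in> A" "y \<in> A" "z \<in> A"
    using s by auto
  have "int p dvd u\<^sup>2 - v \<longleftrightarrow> int p dvd 2 * (z - x) * (z - y)"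
    using psum_discriminant(1)[OF s(2)] by (metis dvd_diff_commute dvd_diff_right_iff)
  also have "\<dots> \<longleftrightarrow> int p dvd z - x \<or> int p dvd z - y"
    using p0 p2 by (metis prime_dvd_mult_iff)
  also have "\<dots> \<longleftrightarrow> z = x \<or> z = y"
    using residues_eqI[OF p0(1) A] xyz by auto
  finally show ?thesis
    using xyz by (auto simp: nondegenerate_def)
qed

text \<open>
  A degenerate triple is of the form \<open>(x, y, x)\<close> or \<open>(y, x, x)\<close> and has the sum \<open>P y\<close>, with \<open>x\<close> free. A
  collision of two of them is given by one \<open>y\<close>, two free parameters and the two forms.
\<close>

lemma degenerate_collisions:
  assumes p: "prime p" "p > 2" and A: "A \<subseteq> {0..<int p}"
  shows "card (collisions (psum p) (A \<times> A \<times> A)) \<le> card (collisions (psum p) (nondegenerate A)) + 4 * (card A) ^ 3"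
proof -
  let ?S = "A \<times> A \<times> A"
  have p0: "p > 0"
    using p by auto
  have fin: "finite A"
    using A finite_subset by auto
  define d where "d = (\<lambda>b (x::int) (y::int). if b then (x, y, x) else (y, x, x))"
  let ?h = "\<lambda>(x, x', y, b, b'). (d b x y, d b' x' y)"
  have dpar: "fst (psum p (d b x y)) = y mod int p" for b x y
    by (simp add: d_def psum_def)
  have degD: "\<exists>b x y. x \<in> A \<and> y \<in> A \<and> s = d b x y" if "s \<in> ?S" "s \<notin> nondegenerate A" for s
  proof -
    obtain x y z where s: "s = (x, y, z)"
      by (metis prod.exhaust)
    then have "s = d True x y \<or> s = d False y x" "x \<in> A" "y \<in> A"
      using that by (auto simp: d_def nondegenerate_def)
    then show ?thesis
      by blast
  qed
  have "collisions (psum p) ?S \<subseteq> collisions (psum p) (nondegenerate A) \<union> ?h ` (A \<times> A \<times> A \<times> UNIV \<times> UNIV)"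
  proof
    fix st assume st: "st \<in> collisions (psum p) ?S"
    then obtain s t where s: "st = (s, t)" "s \<in> ?S" "t \<in> ?S" "psum p s = psum p t"
      by (auto simp: collisions_def)
    have iff: "s \<in> nondegenerate A \<longleftrightarrow> t \<in> nondegenerate A"
    proof -
      obtain u v where "psum p s = (u, v)"
        by (metis prod.exhaust)
      moreover obtain x y z x' y' z' where "s = (x, y, z)" "t = (x', y', z')"
        by (metis prod.exhaust)
      ultimately show ?thesis
        using psum_nondegenerate_iff[OF p A] s by metis
    qed
    show "st \<in> collisions (psum p) (nondegenerate A) \<union> ?h ` (A \<times> A \<times> A \<times> UNIV \<times> UNIV)"
    proof (cases "s \<in> nondegenerate A")
      case True
      then show ?thesis
        using iff s by (simp add: collisions_def)
    next
      case False
      then obtain b x y b' x' y' where *: "s = d b x y" "t = d b' x' y'" "x \<in> A" "y \<in> A" "x' \<in> A" "y' \<in> A"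
        using iff degD[OF s(2)] degD[OF s(3)] by metis
      then have "y mod int p = y' mod int p"
        using s(4) dpar by metis
      then have "y = y'"
        using residues_eqI[OF p0 A *(4,6)] by (simp add: mod_eq_dvd_iff)
      then have "st = ?h (x, x', y, b, b')"
        using * s by simp
      then show ?thesis
        using * by blast
    qed
  qed
  then have "card (collisions (psum p) ?S) \<le>
      card (collisions (psum p) (nondegenerate A) \<union> ?h ` (A \<times> A \<times> A \<times> UNIV \<times> UNIV))"
  proof (rule card_mono[rotated])
    have "nondegenerate A \<subseteq> ?S"
      by (auto simp: nondegenerate_def)
    then show "finite (collisions (psum p) (nondegenerate A) \<union> ?h ` (A \<times> A \<times> A \<times> UNIV \<times> UNIV))"
      using fin by (intro finite_UnI finite_collisions) (auto intro: finite_subset)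
  qed
  also have "\<dots> \<le> card (collisions (psum p) (nondegenerate A)) + card (?h ` (A \<times> A \<times> A \<times> (UNIV :: bool set) \<times> (UNIV :: bool set)))"
    by (rule card_Un_le)
  also have "card (?h ` (A \<times> A \<times> A \<times> (UNIV :: bool set) \<times> (UNIV :: bool set))) \<le> card (A \<times> A \<times> A \<times> (UNIV :: bool set) \<times> (UNIV :: bool set))"
    using fin by (intro card_image_le) auto
  also have "\<dots> = 4 * (card A) ^ 3"
    by (simp add: card_cartesian_product power3_eq_cube)
  finally show ?thesis
    by simp
qed

text \<open>
  The abscissas of the points \<open>(x, 1 / (z - x))\<close> that the nondegenerate triples \<open>(x, y, z)\<close> with sum \<open>w\<close>
  put on the line of \<open>w\<close>.
\<close>

definition first_coords :: "nat \<Rightarrow> int set \<Rightarrow> int \<times> int \<Rightarrow> int set" where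
  "first_coords p A w = fst ` {s \<in> nondegenerate A. psum p s = w}"

lemma card_first_coords:
  assumes p: "prime p" "p > 2" and A: "A \<subseteq> {0..<int p}"
  shows "card (first_coords p A w) = card {s \<in> nondegenerate A. psum p s = w}"
  unfolding first_coords_def
proof (rule card_image, rule inj_onI)
  have p0: "p > 0" "prime (int p)"
    using p by auto
  have p2: "\<not> int p dvd 2"
    using p by (auto dest: zdvd_imp_le)
  obtain u v where w: "w = (u, v)"
    by (metis prod.exhaust)
  fix s t assume st: "s \<in> {s \<in> nondegenerate A. psum p s = w}" "t \<in> {s \<in> nondegenerate A. psum p s = w}" "fst s = fst t"
  obtain x y z where s: "s = (x, y, z)"
    by (metis prod.exhaust)
  obtain y' z' where t: "t = (x, y', z')"
    using st s by (metis fst_conv prod.exhaust)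
  have mem: "x \<in> A" "y \<in> A" "z \<in> A" "y' \<in> A" "z' \<in> A" "z \<noteq> y" "z' \<noteq> x"
    using st by (auto simp: s t nondegenerate_def)
  have psum: "psum p (x, y, z) = (u, v)" "psum p (x, y', z') = (u, v)"
    using st by (auto simp: s t w)
  note 1 = psum_discriminant[OF psum(1)] and 2 = psum_discriminant[OF psum(2)]
  have "2 * ((z - z') * (z - y)) = ((u\<^sup>2 - v) - 2 * (z' - x) * (z' - y')) - ((u\<^sup>2 - v) - 2 * (z - x) * (z - y))
      + 2 * (z' - x) * (((x - u) - (z - y)) - ((x - u) - (z' - y')))"
    by (simp add: algebra_simps)
  also have "int p dvd \<dots>"
    by (rule dvd_add[OF dvd_diff[OF 2(1) 1(1)] dvd_mult[OF dvd_diff[OF 1(2) 2(2)]]])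
  finally have "int p dvd z - z' \<or> int p dvd z - y"
    using p0 p2 by (metis prime_dvd_mult_iff)
  then have z: "z = z'"
    using residues_eqI[OF p0(1) A] mem by blast
  have "y - y' = ((x - u) - (z - y)) - ((x - u) - (z' - y'))"
    by (simp add: z)
  also have "int p dvd \<dots>"
    by (rule dvd_diff[OF 1(2) 2(2)])
  finally have "y = y'"
    using residues_eqI[OF p0(1) A] mem by blast
  then show "s = t"
    by (simp add: s t z)
qed

definition reciprocals :: "nat \<Rightarrow> int set \<Rightarrow> int \<Rightarrow> int set" where
  "reciprocals p A x = (\<lambda>b. modular_inverse (int p) (b - x)) ` (A - {x})"

lemma reciprocals:
  assumes "p > 0" "finite A"
  shows "reciprocals p A x \<subseteq> {0..<int p}" "card (reciprocals p A x) \<le> card A"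
proof -
  show "reciprocals p A x \<subseteq> {0..<int p}"
    using assms by (auto simp: reciprocals_def modular_inverse_int_nonneg modular_inverse_int_less)
  have "card (reciprocals p A x) \<le> card (A - {x})"
    unfolding reciprocals_def using assms by (intro card_image_le) auto
  also have "\<dots> \<le> card A"
    using assms by (intro card_mono) auto
  finally show "card (reciprocals p A x) \<le> card A" .
qed

lemma dvd_modular_inverse:
  assumes "prime p" "\<not> int p dvd a"
  shows "int p dvd a * modular_inverse (int p) a - 1"
proof -
  have "coprime a (int p)"
    using assms by (metis coprime_commute prime_imp_coprime prime_nat_int_transfer)
  then show ?thesis
    using cong_modular_inverse1 cong_iff_dvd_diff by blast
qed

lemma first_coords_on_line:
  assumes p: "prime p" "p > 2" and A: "A \<subseteq> {0..<int p}" and x: "x \<in> first_coords p A (u, v)"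
  obtains r where "r \<in> reciprocals p A x" "int p dvd (u\<^sup>2 - v) * r - 2 * (x - u)"
proof -
  have p0: "p > 0" "prime (int p)"
    using p by auto
  obtain y z where s: "(x, y, z) \<in> nondegenerate A" "psum p (x, y, z) = (u, v)"
    using x by (auto simp: first_coords_def)
  define r where "r = modular_inverse (int p) (z - x)"
  have "\<not> int p dvd z - x"
    using s residues_eqI[OF p0(1) A] by (auto simp: nondegenerate_def)
  then have r: "int p dvd (z - x) * r - 1"
    unfolding r_def using p by (intro dvd_modular_inverse)
  note d = psum_discriminant[OF s(2)]
  have "(u\<^sup>2 - v) * r - 2 * (x - u) = ((u\<^sup>2 - v) - 2 * (z - x) * (z - y)) * r
      + 2 * (z - y) * ((z - x) * r - 1) - 2 * ((x - u) - (z - y))"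
    by (simp add: algebra_simps)
  also have "int p dvd \<dots>"
    by (rule dvd_diff[OF dvd_add[OF dvd_mult2[OF d(1)] dvd_mult[OF r]] dvd_mult[OF d(2)]])
  finally have "int p dvd (u\<^sup>2 - v) * r - 2 * (x - u)" .
  moreover have "r \<in> reciprocals p A x"
    using s by (auto simp: reciprocals_def r_def nondegenerate_def)
  ultimately show ?thesis
    using that by blast
qed

text \<open>
  Large energy makes many lines rich: the third moment of the number of points per line is bounded
  below by the second moment, which is the energy. The third moment counts lines together with three abscissas \<open>x\<close>, \<open>y\<close>, \<open>z\<close>
  on them, those with a coincidence being negligible, and the best pair \<open>x\<close>, \<open>y\<close> is fixed by averaging.
\<close>

lemma three_distinct_coordinates:
  fixes K :: real
  assumes p: "prime p" "p > 2" and A: "A \<subseteq> {0..<int p}" and K: "K \<ge> 1"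
    and J: "real (card A) ^ 4 / K \<le> real (card (collisions (psum p) (A \<times> A \<times> A)))"
    and big: "24 * K\<^sup>2 \<le> real (card A)"
  defines "n \<equiv> \<lambda>x y z. card {w \<in> psum p ` nondegenerate A. distinct [x, y, z] \<and> {x, y, z} \<subseteq> first_coords p A w}"
  obtains x y where "x \<in> A" "y \<in> A" "real (card A) ^ 3 / (8 * K\<^sup>2) \<le> (\<Sum>z\<in>A. real (n x y z))"
proof -
  define N where "N = real (card A)"
  have fin: "finite A"
    using A finite_subset by auto
  have N: "N \<ge> 24" "24 * K\<^sup>2 \<le> N"
  proof -
    have "1 \<le> K\<^sup>2"
      using K by (simp add: one_le_power)
    then show "N \<ge> 24" "24 * K\<^sup>2 \<le> N"
      using big by (auto simp: N_def)
  qed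
  have nd: "nondegenerate A \<subseteq> A \<times> A \<times> A"
    by (auto simp: nondegenerate_def)
  then have finnd: "finite (nondegenerate A)"
    using fin by (auto intro: finite_subset)
  let ?W = "psum p ` nondegenerate A"
  let ?R = "first_coords p A"
  define r where "r w = real (card (?R w))" for w
  have R: "?R w \<subseteq> A" for w
    by (auto simp: first_coords_def nondegenerate_def)
  then have finR: "finite (?R w)" for w
    using fin finite_subset by blast
  have rN: "r w \<le> N" for w
    unfolding r_def N_def using R fin by (simp add: card_mono)
  have "real (card (collisions (psum p) (nondegenerate A))) = (\<Sum>w\<in>?W. (r w)\<^sup>2)"
    unfolding card_collisions[OF finnd] r_def card_first_coords[OF p A] by simp
  then have "N ^ 4 / K \<le> (\<Sum>w\<in>?W. (r w)\<^sup>2) + 4 * N ^ 3"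
    using J of_nat_mono[OF degenerate_collisions[OF p A], where ?'a = real] by (simp add: N_def)
  moreover have "4 * N ^ 3 \<le> N ^ 4 / (2 * K)"
  proof -
    have "K ^ 1 \<le> K\<^sup>2"
      using K by (intro power_increasing) auto
    then have "8 * K \<le> N"
      using N K by simp
    then have "N ^ 3 * (8 * K) \<le> N ^ 3 * N"
      using N by (intro mult_left_mono) auto
    then show ?thesis
      using K by (simp add: field_simps eval_nat_numeral)
  qed
  moreover have "N ^ 4 / K = 2 * (N ^ 4 / (2 * K))"
    by simp
  ultimately have sq: "N ^ 4 / (2 * K) \<le> (\<Sum>w\<in>?W. (r w)\<^sup>2)"
    by linarith
  have "(\<Sum>w\<in>?W. r w) = real (card (nondegenerate A))"
    unfolding card_eq_sum_fibres_of_map[OF finnd, of "psum p"] r_def card_first_coords[OF p A] by simp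
  also have "\<dots> \<le> real (card (A \<times> A \<times> A))"
    unfolding of_nat_le_iff using nd fin by (intro card_mono) auto
  also have "\<dots> = N ^ 3"
    by (simp add: N_def card_cartesian_product eval_nat_numeral)
  finally have lin: "(\<Sum>w\<in>?W. r w) \<le> N ^ 3" .
  \<comment> \<open>the tangent parameter in \<open>r\<^sup>3 \<ge> 2 l r\<^sup>2 - l\<^sup>2 r\<close>; it maximizes the resulting lower bound\<close>
  define l where "l = N / (2 * K)"
  have l: "l \<ge> 0"
    using N K by (simp add: l_def)
  have "2 * l * (N ^ 4 / (2 * K)) - l\<^sup>2 * N ^ 3 \<le> 2 * l * (\<Sum>w\<in>?W. (r w)\<^sup>2) - l\<^sup>2 * (\<Sum>w\<in>?W. r w)"
    using sq lin l by (intro diff_mono mult_left_mono) auto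
  also have "\<dots> = (\<Sum>w\<in>?W. 2 * l * (r w)\<^sup>2 - l\<^sup>2 * r w)"
    by (simp add: sum_distrib_left sum_subtractf)
  also have "\<dots> \<le> (\<Sum>w\<in>?W. r w ^ 3)"
  proof (rule sum_mono)
    fix w
    have "0 \<le> r w * (r w - l)\<^sup>2"
      by (simp add: r_def)
    then show "2 * l * (r w)\<^sup>2 - l\<^sup>2 * r w \<le> r w ^ 3"
      by (simp add: algebra_simps power2_eq_square power3_eq_cube)
  qed
  also have "2 * l * (N ^ 4 / (2 * K)) - l\<^sup>2 * N ^ 3 = N ^ 5 / (4 * K\<^sup>2)"
    using K by (simp add: l_def field_simps eval_nat_numeral)
  finally have cube: "N ^ 5 / (4 * K\<^sup>2) \<le> (\<Sum>w\<in>?W. r w ^ 3)" .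
  have sq': "(\<Sum>w\<in>?W. (r w)\<^sup>2) \<le> N ^ 4"
  proof -
    have "(\<Sum>w\<in>?W. (r w)\<^sup>2) \<le> (\<Sum>w\<in>?W. N * r w)"
      using rN by (intro sum_mono) (auto simp: power2_eq_square r_def intro!: mult_right_mono)
    also have "\<dots> \<le> N * N ^ 3"
      using lin N by (simp flip: sum_distrib_left)
    finally show ?thesis
      by (simp add: eval_nat_numeral)
  qed
  define D where "D w = {(x, y, z). distinct [x, y, z] \<and> {x, y, z} \<subseteq> ?R w}" for w
  have DR: "D w \<subseteq> ?R w \<times> ?R w \<times> ?R w" for w
    by (auto simp: D_def)
  have finD: "finite (D w)" for w
    by (rule finite_subset[OF DR]) (simp add: finR)
  have D: "r w ^ 3 - 3 * (r w)\<^sup>2 \<le> real (card (D w))" for w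
  proof -
    let ?R' = "?R w"
    have "?R' \<times> ?R' \<times> ?R' \<subseteq> D w \<union> ((\<lambda>(x, y). (x, x, y)) ` (?R' \<times> ?R') \<union>
        ((\<lambda>(x, y). (x, y, x)) ` (?R' \<times> ?R') \<union> (\<lambda>(x, y). (y, x, x)) ` (?R' \<times> ?R')))"
      by (auto simp: D_def)
    then have "card (?R' \<times> ?R' \<times> ?R') \<le> card (D w \<union> ((\<lambda>(x, y). (x, x, y)) ` (?R' \<times> ?R') \<union>
        ((\<lambda>(x, y). (x, y, x)) ` (?R' \<times> ?R') \<union> (\<lambda>(x, y). (y, x, x)) ` (?R' \<times> ?R'))))"
      using finD finR by (intro card_mono finite_UnI finite_imageI finite_cartesian_product)
    also have "\<dots> \<le> card (D w) + (card (?R' \<times> ?R') + (card (?R' \<times> ?R') + card (?R' \<times> ?R')))"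
      using finR by (intro order_trans[OF card_Un_le] add_mono card_image_le order_refl) auto
    finally have "real (card (?R' \<times> ?R' \<times> ?R')) \<le> real (card (D w) + (card (?R' \<times> ?R') + (card (?R' \<times> ?R') + card (?R' \<times> ?R'))))"
      by (simp only: of_nat_le_iff)
    then show ?thesis
      by (simp add: card_cartesian_product r_def power2_eq_square power3_eq_cube)
  qed
  have "(\<Sum>w\<in>?W. r w ^ 3) - 3 * (\<Sum>w\<in>?W. (r w)\<^sup>2) = (\<Sum>w\<in>?W. r w ^ 3 - 3 * (r w)\<^sup>2)"
    by (simp add: sum_distrib_left sum_subtractf)
  also have "\<dots> \<le> (\<Sum>w\<in>?W. real (card (D w)))"
    using D by (intro sum_mono)
  finally have "N ^ 5 / (4 * K\<^sup>2) - 3 * N ^ 4 \<le> (\<Sum>w\<in>?W. real (card (D w)))"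
    using cube sq' by linarith
  moreover have "3 * N ^ 4 \<le> N ^ 5 / (8 * K\<^sup>2)"
  proof -
    have "N ^ 4 * (24 * K\<^sup>2) \<le> N ^ 4 * N"
      using N by (intro mult_left_mono) auto
    then show ?thesis
      using K by (simp add: field_simps eval_nat_numeral)
  qed
  moreover have "N ^ 5 / (4 * K\<^sup>2) = 2 * (N ^ 5 / (8 * K\<^sup>2))"
    by simp
  ultimately have "N ^ 5 / (8 * K\<^sup>2) \<le> (\<Sum>w\<in>?W. real (card (D w)))"
    by linarith
  also have "\<dots> = (\<Sum>t\<in>A \<times> A \<times> A. real (card {w\<in>?W. t \<in> D w}))"
  proof -
    let ?E = "{(w, t). w \<in> ?W \<and> t \<in> D w}"
    have DA: "D w \<subseteq> A \<times> A \<times> A" for w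
      using DR[of w] R[of w] by blast
    have E: "?E \<subseteq> ?W \<times> (A \<times> A \<times> A)"
      using DA by blast
    have "D w = {t \<in> A \<times> A \<times> A. (w, t) \<in> ?E}" if "w \<in> ?W" for w
      using DA[of w] that by blast
    then have "(\<Sum>w\<in>?W. card (D w)) = (\<Sum>w\<in>?W. card {t \<in> A \<times> A \<times> A. (w, t) \<in> ?E})"
      by (intro sum.cong refl arg_cong[where f = card])
    also have "\<dots> = (\<Sum>t\<in>A \<times> A \<times> A. card {w\<in>?W. (w, t) \<in> ?E})"
      using card_eq_sum_fibres[OF _ _ E] finnd fin by simp
    also have "\<dots> = (\<Sum>t\<in>A \<times> A \<times> A. card {w\<in>?W. t \<in> D w})"
      by (intro sum.cong refl arg_cong[where f = card]) auto
    finally show ?thesis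
      by (simp flip: of_nat_sum)
  qed
  also have "\<dots> = (\<Sum>x\<in>A. \<Sum>y\<in>A. \<Sum>z\<in>A. real (n x y z))"
    by (simp add: n_def D_def sum.cartesian_product case_prod_beta)
  finally have tot: "N ^ 5 / (8 * K\<^sup>2) \<le> (\<Sum>x\<in>A. \<Sum>y\<in>A. \<Sum>z\<in>A. real (n x y z))" .
  have "\<exists>x\<in>A. \<exists>y\<in>A. N ^ 3 / (8 * K\<^sup>2) \<le> (\<Sum>z\<in>A. real (n x y z))"
  proof (rule ccontr)
    assume "\<not> ?thesis"
    then have less: "(\<Sum>z\<in>A. real (n x y z)) < N ^ 3 / (8 * K\<^sup>2)" if "x \<in> A" "y \<in> A" for x y
      using that by force
    have "A \<noteq> {}"
      using N by (auto simp: N_def)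
    then have "(\<Sum>x\<in>A. \<Sum>y\<in>A. \<Sum>z\<in>A. real (n x y z)) < (\<Sum>x\<in>A. \<Sum>y\<in>A. N ^ 3 / (8 * K\<^sup>2))"
      using fin less by (intro sum_strict_mono)
    also have "\<dots> = N ^ 5 / (8 * K\<^sup>2)"
      by (simp add: N_def eval_nat_numeral)
    finally show False
      using tot by simp
  qed
  then show ?thesis
    using that by (auto simp: N_def)
qed

text \<open>
  A line is determined by its heights \<open>s\<close> and \<open>t\<close> over the two fixed abscissas \<open>x\<close> and \<open>y\<close>, which lie in sets of
  at most \<open>card A\<close> reciprocals. Its height over a third abscissa \<open>z\<close> is proportional to \<open>s + m t\<close> with
  \<open>m = (x - z) / (z - y)\<close>, and lies in a set of that size again. So for many \<open>z\<close> the sums \<open>s + m t\<close> take few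
  values on a dense set of pairs, which is the situation of \<open>partial_sumsets_small\<close>.
\<close>

lemma parabola_energy_dichotomy:
  fixes K :: real
  assumes p: "prime p" "p > 2" and A: "A \<subseteq> {0..<int p}" and K: "K \<ge> 1"
    and J: "real (card A) ^ 4 / K \<le> real (card (collisions (psum p) (A \<times> A \<times> A)))"
    and big: "24 * K\<^sup>2 \<le> real (card A)"
  defines "K' \<equiv> 16 * K\<^sup>2"
  defines "K1 \<equiv> 8 * K' * (4096 * K' ^ 5) ^ 4 * (8192 * K' ^ 4) ^ 3"
  defines "L \<equiv> (7 * K1\<^sup>2) ^ 7"
  shows "real (card A) \<le> 2 ^ 27 * K' ^ 10 * L \<or> real p \<le> 2 * L * real (card A)"
proof -
  define N where "N = real (card A)"
  define n where "n x y z = card {w \<in> psum p ` nondegenerate A. distinct [x, y, z] \<and> {x, y, z} \<subseteq> first_coords p A w}" for x y z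
  have p0: "p > 0" "prime (int p)"
    using p by auto
  have p2: "\<not> int p dvd 2"
    using p by (auto dest: zdvd_imp_le)
  have fin: "finite A"
    using A finite_subset by auto
  have finW: "finite (psum p ` nondegenerate A)"
    using fin by (intro finite_imageI) (rule finite_subset[of _ "A \<times> A \<times> A"], auto simp: nondegenerate_def)
  have K2: "1 \<le> K\<^sup>2"
    using K by (simp add: one_le_power)
  have N: "N \<ge> 24"
    using big K2 by (simp add: N_def)
  obtain x y where xy: "x \<in> A" "y \<in> A" and sum_n: "N ^ 3 / (8 * K\<^sup>2) \<le> (\<Sum>z\<in>A. real (n x y z))"
    using three_distinct_coordinates[OF p A K J big] by (auto simp: N_def n_def)
  have nd: "\<not> int p dvd a - b" if "a \<in> A" "b \<in> A" "a \<noteq> b" for a b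
    using that residues_eqI[OF p0(1) A] by blast
  \<comment> \<open>the line of \<open>w\<close> has slope \<open>2 / q w\<close> and vanishes at \<open>fst w\<close>\<close>
  define q where "q w = (fst w)\<^sup>2 - snd w" for w :: "int \<times> int"
  have q: "\<not> int p dvd q w" if w: "w \<in> psum p ` nondegenerate A" for w
  proof -
    obtain a b c where abc: "(a, b, c) \<in> nondegenerate A" "w = psum p (a, b, c)"
      using w by auto
    then have "(a, b, c) \<in> A \<times> A \<times> A"
      by (auto simp: nondegenerate_def)
    then show ?thesis
      using psum_nondegenerate_iff[OF p A, of a b c "fst w" "snd w"] abc by (simp add: q_def)
  qed
  have "\<exists>r. \<forall>w t. t \<in> first_coords p A w \<longrightarrow>
      r w t \<in> reciprocals p A t \<and> int p dvd q w * r w t - 2 * (t - fst w)"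
  proof -
    have "\<exists>r. t \<in> first_coords p A w \<longrightarrow> r \<in> reciprocals p A t \<and> int p dvd q w * r - 2 * (t - fst w)" for w t
      using first_coords_on_line[OF p A, of t "fst w" "snd w"] by (auto simp: q_def)
    then have "\<forall>w t. \<exists>r. t \<in> first_coords p A w \<longrightarrow> r \<in> reciprocals p A t \<and> int p dvd q w * r - 2 * (t - fst w)"
      by blast
    then show ?thesis
      by (simp only: choice_iff)
  qed
  then obtain r where r: "\<And>w t. t \<in> first_coords p A w \<Longrightarrow> r w t \<in> reciprocals p A t"
    and rq: "\<And>w t. t \<in> first_coords p A w \<Longrightarrow> int p dvd q w * r w t - 2 * (t - fst w)"
    by blast
  define Wz where "Wz z = {w \<in> psum p ` nondegenerate A. distinct [x, y, z] \<and> {x, y, z} \<subseteq> first_coords p A w}" for z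
  define E where "E z = (\<lambda>w. (r w x, r w y)) ` Wz z" for z
  have E: "E z \<subseteq> reciprocals p A x \<times> reciprocals p A y" for z
    using r by (auto simp: E_def Wz_def)
  have cardE: "card (E z) = n x y z" for z
  proof -
    have "inj_on (\<lambda>w. (r w x, r w y)) (Wz z)"
    proof (rule inj_onI)
      fix w w' assume w: "w \<in> Wz z" "w' \<in> Wz z" "(r w x, r w y) = (r w' x, r w' y)"
      have xy': "x \<noteq> y" "x \<in> first_coords p A w" "y \<in> first_coords p A w"
        "x \<in> first_coords p A w'" "y \<in> first_coords p A w'" "w \<in> psum p ` nondegenerate A" "w' \<in> psum p ` nondegenerate A"
        using w by (auto simp: Wz_def)
      define a b where "a = r w x" and "b = r w y"
      have ab: "r w' x = a" "r w' y = b"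
        using w(3) by (auto simp: a_def b_def)
      have d: "int p dvd q w * a - 2 * (x - fst w)" "int p dvd q w * b - 2 * (y - fst w)"
        "int p dvd q w' * a - 2 * (x - fst w')" "int p dvd q w' * b - 2 * (y - fst w')"
        using rq[OF xy'(2)] rq[OF xy'(3)] rq[OF xy'(4)] rq[OF xy'(5)] ab by (simp_all add: a_def b_def)
      have "\<not> int p dvd a - b"
      proof
        assume ab: "int p dvd a - b"
        have "2 * (x - y) = q w * (a - b) - ((q w * a - 2 * (x - fst w)) - (q w * b - 2 * (y - fst w)))"
          by (simp add: algebra_simps)
        also have "int p dvd \<dots>"
          by (rule dvd_diff[OF dvd_mult[OF ab] dvd_diff[OF d(1,2)]])
        finally show False
          using p0 p2 nd[OF xy xy'(1)] by (metis prime_dvd_mult_iff)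
      qed
      moreover have "(a - b) * (q w - q w') = ((q w * a - 2 * (x - fst w)) - (q w * b - 2 * (y - fst w)))
          - ((q w' * a - 2 * (x - fst w')) - (q w' * b - 2 * (y - fst w')))"
        by (simp add: algebra_simps)
      moreover have "int p dvd ((q w * a - 2 * (x - fst w)) - (q w * b - 2 * (y - fst w)))
          - ((q w' * a - 2 * (x - fst w')) - (q w' * b - 2 * (y - fst w')))"
        by (rule dvd_diff[OF dvd_diff[OF d(1,2)] dvd_diff[OF d(3,4)]])
      ultimately have qq: "int p dvd q w - q w'"
        using p0 by (metis prime_dvd_mult_iff)
      have "2 * (fst w - fst w') = ((q w * a - 2 * (x - fst w)) - (q w' * a - 2 * (x - fst w'))) - (q w - q w') * a"
        by (simp add: algebra_simps)
      also have "int p dvd \<dots>" 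
        by (rule dvd_diff[OF dvd_diff[OF d(1,3)] dvd_mult2[OF qq]])
      finally have f: "int p dvd fst w - fst w'"
        using p0 p2 by (metis prime_dvd_mult_iff)
      have "snd w - snd w' = (fst w - fst w') * (fst w + fst w') - (q w - q w')"
        by (simp add: q_def algebra_simps power2_eq_square)
      also have "int p dvd \<dots>"
        by (rule dvd_diff[OF dvd_mult2[OF f] qq])
      finally have s: "int p dvd snd w - snd w'" .
      have range: "fst w \<in> {0..<int p} \<and> snd w \<in> {0..<int p}" if "w \<in> psum p ` nondegenerate A" for w
        using that p0 by (auto simp: psum_def)
      have "fst w = fst w'" "snd w = snd w'"
        using residues_eqI[OF p0(1) order_refl _ _ f] residues_eqI[OF p0(1) order_refl _ _ s]
          range[OF xy'(6)] range[OF xy'(7)] by auto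
      then show "w = w'"
        by (simp add: prod_eq_iff)
    qed
    then show ?thesis
      by (simp add: E_def n_def Wz_def card_image)
  qed
  have nN: "real (n x y z) \<le> N\<^sup>2" for z
  proof -
    have "card (E z) \<le> card (reciprocals p A x \<times> reciprocals p A y)"
      by (intro card_mono finite_cartesian_product E) (auto simp: reciprocals_def fin)
    also have "\<dots> \<le> card A * card A"
      using reciprocals[OF p0(1) fin] by (simp add: card_cartesian_product mult_mono)
    finally have "real (card (E z)) \<le> real (card A * card A)"
      by (simp only: of_nat_le_iff)
    then show ?thesis
      by (simp add: cardE N_def power2_eq_square)
  qed
  define Z where "Z = {z\<in>A. N\<^sup>2 / K' \<le> real (n x y z)}"
  have K': "K' \<ge> 1"
    using K2 by (simp add: K'_def)
  have cardZ: "N / K' \<le> real (card Z)"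
  proof -
    have "N ^ 3 / (8 * K\<^sup>2) \<le> (\<Sum>z\<in>Z. real (n x y z)) + (\<Sum>z\<in>A - Z. real (n x y z))"
      using sum_n fin by (simp add: Z_def sum.subset_diff[of Z A] add.commute)
    also have "\<dots> \<le> (\<Sum>z\<in>Z. N\<^sup>2) + (\<Sum>z\<in>A - Z. N\<^sup>2 / K')"
      using nN by (intro add_mono sum_mono) (auto simp: Z_def)
    also have "\<dots> \<le> card Z * N\<^sup>2 + N * (N\<^sup>2 / K')"
      using fin K' by (auto simp: N_def intro!: mult_right_mono divide_right_mono card_mono)
    finally have "N ^ 3 / (8 * K\<^sup>2) \<le> card Z * N\<^sup>2 + N * (N\<^sup>2 / K')" .
    moreover have "N ^ 3 / (8 * K\<^sup>2) = 2 * (N\<^sup>2 * (N / K'))" "N * (N\<^sup>2 / K') = N\<^sup>2 * (N / K')"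
      by (simp_all add: K'_def eval_nat_numeral)
    ultimately have "N\<^sup>2 * (N / K') \<le> N\<^sup>2 * card Z"
      by (simp only: mult.commute[of "real (card Z)"])
    then show ?thesis
      by (rule mult_left_le_imp_le) (use N in simp)
  qed
  have Z: "z \<in> A" "x \<noteq> y" "z \<noteq> x" "z \<noteq> y" if "z \<in> Z" for z
  proof -
    have "0 < N\<^sup>2 / K'"
      using N K' by simp
    then have "n x y z > 0"
      using that by (auto simp: Z_def intro: gr0I)
    then have "Wz z \<noteq> {}"
      by (auto simp: n_def Wz_def card_gt_0_iff)
    then show "z \<in> A" "x \<noteq> y" "z \<noteq> x" "z \<noteq> y"
      using that by (auto simp: Z_def Wz_def)
  qed
  define i where "i z = modular_inverse (int p) (z - y)" for z
  have i: "int p dvd (z - y) * i z - 1" if "z \<in> Z" for z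
    unfolding i_def using p Z[OF that] nd xy by (intro dvd_modular_inverse) auto
  define \<mu> where "\<mu> z = ((x - z) * i z) mod int p" for z
  have mu: "int p dvd (x - z) * i z - \<mu> z" for z
    by (simp add: \<mu>_def minus_mod_eq_mult_div)
  have inj: "inj_on \<mu> Z"
  proof (rule inj_onI)
    fix z z' assume z: "z \<in> Z" "z' \<in> Z" "\<mu> z = \<mu> z'"
    have "(x - y) * (z' - z) = (z - y) * (z' - y) * (((x - z) * i z - \<mu> z) - ((x - z') * i z' - \<mu> z'))
        - (x - z) * (z' - y) * ((z - y) * i z - 1) + (x - z') * (z - y) * ((z' - y) * i z' - 1)"
      using z(3) by (simp add: algebra_simps)
    also have "int p dvd \<dots>"
      by (rule dvd_add[OF dvd_diff[OF dvd_mult[OF dvd_diff[OF mu mu]] dvd_mult[OF i[OF z(1)]]] dvd_mult[OF i[OF z(2)]]])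
    finally have "int p dvd z' - z"
      using p0 nd[OF xy Z(2)[OF z(1)]] by (metis prime_dvd_mult_iff)
    then have "int p dvd z - z'"
      by (simp add: dvd_diff_commute)
    then show "z = z'"
      using residues_eqI[OF p0(1) A] Z z by blast
  qed
  have muM: "\<mu> ` Z \<subseteq> {0<..<int p}"
  proof
    fix m assume "m \<in> \<mu> ` Z"
    then obtain z where z: "z \<in> Z" "m = \<mu> z"
      by blast
    have "\<not> int p dvd (x - z) * i z"
    proof
      assume "int p dvd (x - z) * i z"
      moreover have "\<not> int p dvd x - z"
        using nd xy Z[OF z(1)] by metis
      ultimately have pi: "int p dvd i z"
        using p0 by (metis prime_dvd_mult_iff)
      have "int p dvd (z - y) * i z - ((z - y) * i z - 1)"
        by (rule dvd_diff[OF dvd_mult[OF pi] i[OF z(1)]])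
      then show False
        using p by simp
    qed
    then have "m \<noteq> 0"
      by (auto simp: z \<mu>_def mod_eq_0_iff_dvd)
    moreover have "0 \<le> m" "m < int p"
      using p0 by (auto simp: z \<mu>_def)
    ultimately show "m \<in> {0<..<int p}"
      by auto
  qed
  define E' where "E' m = E (inv_into Z \<mu> m)" for m
  have E'[simp]: "E' (\<mu> z) = E z" if "z \<in> Z" for z
    using inj that by (simp add: E'_def)
  have lines: "card ((\<lambda>(s, t). cls p (s + \<mu> z * t)) ` E z) \<le> card A" if z: "z \<in> Z" for z
  proof -
    have "(\<lambda>(s, t). cls p (s + \<mu> z * t)) ` E z \<subseteq> (\<lambda>t. cls p ((x - y) * i z * t)) ` reciprocals p A z"
    proof
      fix c assume "c \<in> (\<lambda>(s, t). cls p (s + \<mu> z * t)) ` E z"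
      then obtain w where w: "w \<in> Wz z" "c = cls p (r w x + \<mu> z * r w y)"
        by (auto simp: E_def)
      define a b d where "a = r w x" and "b = r w y" and "d = r w z"
      have w': "x \<in> first_coords p A w" "y \<in> first_coords p A w" "z \<in> first_coords p A w" "w \<in> psum p ` nondegenerate A"
        using w by (auto simp: Wz_def)
      have e: "int p dvd q w * a - 2 * (x - fst w)" "int p dvd q w * b - 2 * (y - fst w)"
        "int p dvd q w * d - 2 * (z - fst w)"
        using rq[OF w'(1)] rq[OF w'(2)] rq[OF w'(3)] by (simp_all add: a_def b_def d_def)
      have "q w * ((a + \<mu> z * b) - (x - y) * i z * d) =
          i z * ((z - y) * (q w * a - 2 * (x - fst w)) + (x - z) * (q w * b - 2 * (y - fst w))
            - (x - y) * (q w * d - 2 * (z - fst w)))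
          - q w * a * ((z - y) * i z - 1) - q w * b * ((x - z) * i z - \<mu> z)"
        by (simp add: algebra_simps)
      also have "int p dvd \<dots>"
        by (rule dvd_diff[OF dvd_diff[OF dvd_mult[OF dvd_diff[OF dvd_add[OF dvd_mult[OF e(1)] dvd_mult[OF e(2)]]
            dvd_mult[OF e(3)]]] dvd_mult[OF i[OF z]]] dvd_mult[OF mu]])
      finally have "int p dvd (a + \<mu> z * b) - (x - y) * i z * d"
        using p0 q[OF w'(4)] by (metis prime_dvd_mult_iff)
      then have "c = cls p ((x - y) * i z * d)"
        using p0 by (simp add: w a_def b_def cls_eq_iff)
      then show "c \<in> (\<lambda>t. cls p ((x - y) * i z * t)) ` reciprocals p A z"
        using r[OF w'(3)] by (auto simp: d_def)
    qed
    then have "card ((\<lambda>(s, t). cls p (s + \<mu> z * t)) ` E z) \<le> card ((\<lambda>t. cls p ((x - y) * i z * t)) ` reciprocals p A z)"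
      using fin by (intro card_mono) (auto simp: reciprocals_def)
    also have "\<dots> \<le> card (reciprocals p A z)"
      using fin by (intro card_image_le) (auto simp: reciprocals_def)
    also have "\<dots> \<le> card A"
      using reciprocals[OF p0(1) fin] by simp
    finally show ?thesis .
  qed
  have "N \<le> 2 ^ 27 * K' ^ 10 * L \<or> real p \<le> 2 * L * N"
    unfolding L_def K1_def
  proof (rule partial_sumsets_small[OF p(1) reciprocals(1)[OF p0(1) fin, of x] reciprocals(1)[OF p0(1) fin, of y] muM _ _ _ K'])
    show "0 < N"
      using N by simp
    show "real (card (reciprocals p A x)) \<le> N" "real (card (reciprocals p A y)) \<le> N"
      using reciprocals[OF p0(1) fin] by (simp_all add: N_def)
    show "N / K' \<le> real (card (\<mu> ` Z))"
      using cardZ inj by (simp add: card_image)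
    fix m assume "m \<in> \<mu> ` Z"
    then obtain z where z: "z \<in> Z" "m = \<mu> z"
      by blast
    then have [simp]: "E' m = E z"
      by simp
    show "E' m \<subseteq> reciprocals p A x \<times> reciprocals p A y"
      using E by simp
    show "N\<^sup>2 / K' \<le> real (card (E' m))"
      using z by (simp add: cardE Z_def)
    show "real (card ((\<lambda>(x, y). cls p (x + m * y)) ` E' m)) \<le> N"
      using lines[OF z(1)] by (simp add: z N_def)
  qed
  then show ?thesis
    by (simp add: N_def)
qed

text \<open>
  Every constant above is a monomial in \<open>K\<close>, and for \<open>(card A)\<^sup>2 \<le> p\<close> the alternative
  that involves \<open>p\<close> is absorbed by the other one.
\<close>

lemma parabola_energy_bound:
  obtains C :: real and e :: nat where "C \<ge> 1" "e \<ge> 1"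
    "\<And>p A K. prime p \<Longrightarrow> p > 2 \<Longrightarrow> A \<subseteq> {0..<int p} \<Longrightarrow> (card A)\<^sup>2 \<le> p \<Longrightarrow> K \<ge> 1 \<Longrightarrow>
      real (card A) ^ 4 / K \<le> real (card (collisions (psum p) (A \<times> A \<times> A))) \<Longrightarrow> real (card A) \<le> C * K ^ e"
proof -
  \<comment> \<open>\<open>472 = 10 + 14 * 33\<close> is the exponent of \<open>K' = 16 * K\<^sup>2\<close>, since \<open>L\<close> contributes \<open>14 * 33\<close>; in \<open>K\<close> it doubles to \<open>944\<close>\<close>
  define C1 :: real where "C1 = 2 ^ 27 * (7 * (8 * 4096 ^ 4 * 8192 ^ 3)\<^sup>2) ^ 7 * 16 ^ 472"
  have C1: "C1 \<ge> 24"
  proof -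
    have "(1::real) \<le> (7 * (8 * 4096 ^ 4 * 8192 ^ 3)\<^sup>2) ^ 7"
      by (intro one_le_power) simp
    moreover have "(1::real) \<le> 16 ^ 472"
      by (intro one_le_power) simp
    ultimately have "2 ^ 27 * 1 * 1 \<le> C1"
      unfolding C1_def by (intro mult_mono) auto
    then show ?thesis
      by simp
  qed
  have main: "real (card A) \<le> C1 * K ^ 944"
    if p: "prime p" "p > 2" and A: "A \<subseteq> {0..<int p}" and Ap: "(card A)\<^sup>2 \<le> p" and K: "K \<ge> 1"
      and J: "real (card A) ^ 4 / K \<le> real (card (collisions (psum p) (A \<times> A \<times> A)))" for p A and K :: real
  proof (cases "24 * K\<^sup>2 \<le> real (card A)")
    case False
    have "24 * K\<^sup>2 \<le> C1 * K ^ 944"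
      using C1 K by (intro mult_mono power_increasing) auto
    then show ?thesis
      using False by linarith
  next
    case True
    define K' where "K' = 16 * K\<^sup>2"
    define L where "L = (7 * (8 * K' * (4096 * K' ^ 5) ^ 4 * (8192 * K' ^ 4) ^ 3)\<^sup>2) ^ 7"
    define c :: real where "c = 7 * (8 * 4096 ^ 4 * 8192 ^ 3)\<^sup>2"
    have "8 * K' * (4096 * K' ^ 5) ^ 4 * (8192 * K' ^ 4) ^ 3 = 8 * 4096 ^ 4 * 8192 ^ 3 * K' ^ 33"
      unfolding power_mult_distrib power_mult[symmetric] by (simp add: power_add[symmetric] mult.commute[of K'] power_Suc2[symmetric] del: power_Suc power_Suc2)
    then have L: "L = c ^ 7 * K' ^ 462"
      by (simp add: L_def c_def power_mult_distrib flip: power_mult)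
    have K': "K' \<ge> 1"
      using one_le_power[OF K, of 2] unfolding K'_def by linarith
    have c: "c > 0"
      by (simp add: c_def)
    have L0: "L \<ge> 0"
      using c K' by (simp add: L)
    have "2 ^ 27 * K' ^ 10 * L = C1 * K ^ 944"
    proof -
      have "K' ^ 10 * K' ^ 462 = K' ^ 472"
        by (simp flip: power_add)
      also have "K' ^ 472 = 16 ^ 472 * K ^ 944"
        unfolding K'_def power_mult_distrib power_mult[symmetric] by simp
      finally show ?thesis
        unfolding L C1_def c_def[symmetric] by (simp add: mult.assoc mult.left_commute[of "K' ^ 10"])
    qed
    moreover have "real (card A) \<le> 2 ^ 27 * K' ^ 10 * L \<or> real p \<le> 2 * L * real (card A)"
      unfolding L_def K'_def by (rule parabola_energy_dichotomy[OF p A K J True])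
    moreover have "real (card A) \<le> 2 ^ 27 * K' ^ 10 * L" if "real p \<le> 2 * L * real (card A)"
    proof -
      have "real (card A) * real (card A) \<le> real p"
        using Ap by (simp add: power2_eq_square flip: of_nat_mult)
      also note that
      finally have "real (card A) * real (card A) \<le> real (card A) * (2 * L)"
        by (simp add: mult.commute)
      moreover have "real (card A) > 0"
        using True K by (smt (verit) zero_less_power)
      ultimately have "real (card A) \<le> 2 * L"
        by simp
      also have "\<dots> \<le> 2 ^ 27 * K' ^ 10 * L"
      proof (rule mult_right_mono[OF _ L0])
        show "2 \<le> 2 ^ 27 * K' ^ 10"
          using mult_mono[of 2 "2 ^ 27" 1 "K' ^ 10"] one_le_power[OF K', of 10] by simp
      qed
      finally show ?thesis .
    qed
    ultimately show ?thesis
      by auto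
  qed
  show ?thesis
    by (rule that[of C1 944]) (use C1 main in auto)
qed

section \<open>Polynomials modulo a prime and the energy of their graphs\<close>

lemma diff_dvd_poly_diff:
  fixes q :: "'a::comm_ring_1 poly"
  shows "x - y dvd poly q x - poly q y"
proof (induction q)
  case (pCons a q)
  have "poly (pCons a q) x - poly (pCons a q) y = (x - y) * poly q x + y * (poly q x - poly q y)"
    by (simp add: algebra_simps)
  then show ?case
    using pCons.IH by simp
qed simp

lemma finite_residues_Collect: "finite {x\<in>{0..<int p}. P x}"
  by (rule finite_subset[of _ "{0..<int p}"]) auto

text \<open>
  Lagrange's bound, by splitting off a root with synthetic division; the remainder need only vanish
  modulo \<open>p\<close>.
\<close>

lemma card_roots_mod_prime:
  fixes q :: "int poly"
  assumes "prime p" "\<not> int p dvd lead_coeff q"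
  shows "card {x\<in>{0..<int p}. int p dvd poly q x} \<le> degree q"
  using assms(2)
proof (induction "degree q" arbitrary: q rule: less_induct)
  case less
  let ?Z = "\<lambda>q. {x\<in>{0..<int p}. int p dvd poly q x}"
  have p0: "p > 0" "prime (int p)"
    using assms by (auto simp: prime_gt_0_nat)
  show ?case
  proof (cases "?Z q = {}")
    case False
    then obtain a where a: "a \<in> {0..<int p}" "int p dvd poly q a"
      by blast
    define s where "s = synthetic_div q a"
    have q: "q = [:-a, 1:] * s + [:poly q a:]"
      unfolding s_def by (rule synthetic_div_correct'[symmetric])
    have deg: "degree q > 0"
    proof (rule ccontr)
      assume "\<not> degree q > 0"
      then obtain c where "q = [:c:]"
        by (auto elim: degree_eq_zeroE)
      then show False
        using a less.prems by simp
    qed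
    have degs: "degree s = degree q - 1"
      by (simp add: s_def degree_synthetic_div)
    have "lead_coeff q = poly.coeff ([:-a, 1:] * s + [:poly q a:]) (degree q)"
      using q by metis
    also have "\<dots> = poly.coeff ([:-a, 1:] * s) (degree q)"
      using deg by (cases "degree q") auto
    also have "\<dots> = lead_coeff s"
      using deg degs coeff_eq_0[of s "degree q"] by (cases "degree q") (auto simp: coeff_pCons)
    finally have "\<not> int p dvd lead_coeff s"
      using less.prems by simp
    then have IH: "card (?Z s) \<le> degree s"
      using less.hyps[of s] deg degs by simp
    have "?Z q \<subseteq> insert a (?Z s)"
    proof
      fix x assume x: "x \<in> ?Z q"
      have "poly q x = (x - a) * poly s x + poly q a"
        using arg_cong[OF q, of "\<lambda>r. poly r x"] by (simp add: algebra_simps)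
      then have "int p dvd (x - a) * poly s x"
        using x a by (metis (no_types, lifting) dvd_add_left_iff mem_Collect_eq)
      then have "int p dvd x - a \<or> int p dvd poly s x"
        using p0 by (metis prime_dvd_mult_iff)
      then show "x \<in> insert a (?Z s)"
        using x a residues_eqI[OF p0(1) order_refl, of x a] by blast
    qed
    then have "card (?Z q) \<le> card (insert a (?Z s))"
      by (intro card_mono finite.insertI finite_residues_Collect)
    also have "\<dots> \<le> Suc (card (?Z s))"
      by (rule card_insert_le_m1[of "Suc _", simplified]) simp
    also have "\<dots> \<le> degree q"
      using IH degs deg by simp
    finally show ?thesis .
  qed (simp only: card.empty)
qed

lemma difference_polynomial:
  fixes g :: "int poly" and t :: int
  assumes "degree g = Suc d"
  obtains D where "degree D \<le> d" "poly.coeff D d = int (Suc d) * t * lead_coeff g"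
    "\<And>y. poly D y = poly g (y + t) - poly g y"
proof
  let ?D = "\<Sum>i\<le>Suc d. Polynomial.smult (poly.coeff g i) ([:t, 1:] ^ i - Polynomial.monom 1 i)"
  have term0: "poly.coeff ([:t, 1:] ^ i - Polynomial.monom 1 i) k = 0" if "i \<le> k" for i k
  proof (cases "i = k")
    case True
    then show ?thesis
      by (simp add: coeff_linear_power)
  next
    case False
    moreover have "degree ([:t, 1:] ^ i) \<le> i"
      using degree_power_le[of "[:t, 1:]" i] by simp
    ultimately show ?thesis
      using that by (simp add: coeff_eq_0)
  qed
  show "degree ?D \<le> d"
  proof (rule degree_le, intro allI impI)
    fix k assume "d < k"
    then show "poly.coeff ?D k = 0"
      unfolding coeff_sum coeff_smult by (intro sum.neutral ballI) (use term0 in auto)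
  qed
  have "poly.coeff ?D d = (\<Sum>i\<le>Suc d. poly.coeff g i * poly.coeff ([:t, 1:] ^ i - Polynomial.monom 1 i) d)"
    by (simp add: coeff_sum)
  also have "\<dots> = poly.coeff g (Suc d) * poly.coeff ([:t, 1:] ^ Suc d - Polynomial.monom 1 (Suc d)) d"
    using term0 by (simp add: sum.neutral del: power_Suc)
  also have "poly.coeff ([:t, 1:] ^ Suc d - Polynomial.monom 1 (Suc d)) d = int (Suc d) * t"
    using coeff_linear_poly_power[of d "Suc d" t 1] by (simp del: power_Suc)
  finally show "poly.coeff ?D d = int (Suc d) * t * lead_coeff g"
    using assms by (simp add: algebra_simps)
  show "poly ?D y = poly g (y + t) - poly g y" for y
    unfolding poly_altdef[of g] assms
    by (simp add: poly_sum poly_monom right_diff_distrib sum_subtractf add.commute del: sum.atMost_Suc)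
qed

definition curve_quadruples ::
    "nat \<Rightarrow> (int \<Rightarrow> int) \<Rightarrow> (int \<Rightarrow> int) \<Rightarrow> int set \<Rightarrow> ((int \<times> int) \<times> (int \<times> int)) set" where
  "curve_quadruples p \<phi> \<theta> B = {((y1, y2), (y3, y4)). y1 \<in> B \<and> y2 \<in> B \<and> y3 \<in> B \<and> y4 \<in> B \<and>
      int p dvd \<phi> y1 + \<phi> y2 - (\<phi> y3 + \<phi> y4) \<and> int p dvd \<theta> y1 + \<theta> y2 - (\<theta> y3 + \<theta> y4)}"

text \<open>
  With \<open>t = y4 - y2\<close> a quadruple satisfies \<open>g (y3 + t) - g y3 = g y4 - g y2\<close>. For \<open>t \<noteq> 0\<close> the left
  hand side is a polynomial in \<open>y3\<close> of degree \<open>degree g - 1 \<ge> 1\<close>, so \<open>(y2, y4)\<close> leaves at most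
  \<open>degree g - 1\<close> choices of \<open>y3\<close>, and \<open>y1\<close> is then determined.
\<close>

lemma curve_energy:
  fixes g :: "int poly" and \<alpha> \<beta> :: int
  assumes p: "prime p" and B: "B \<subseteq> {0..<int p}" and ab: "\<not> int p dvd \<alpha>" "\<not> int p dvd \<beta>"
    and g: "degree g \<ge> 2" "\<not> int p dvd int (degree g) * lead_coeff g"
  shows "card (curve_quadruples p (\<lambda>y. \<alpha> * y) (\<lambda>y. \<beta> * poly g y) B) \<le> degree g * (card B)\<^sup>2"
    (is "card ?E \<le> _")
proof -
  have p0: "p > 0" "prime (int p)"
    using p by (auto simp: prime_gt_0_nat)
  have fin: "finite B"
    using B finite_subset by auto
  obtain d where d: "degree g = Suc d" "d \<ge> 1"
    using g by (cases "degree g") auto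
  define Q where "Q y2 y4 = {(y1, y3). ((y1, y2), (y3, y4)) \<in> ?E}" for y2 y4
  have E: "y1 \<in> B" "y2 \<in> B" "y3 \<in> B" "y4 \<in> B" "int p dvd (y1 + y2) - (y3 + y4)"
      "int p dvd (poly g y1 + poly g y2) - (poly g y3 + poly g y4)" if "((y1, y2), (y3, y4)) \<in> ?E" for y1 y2 y3 y4
  proof -
    show "y1 \<in> B" "y2 \<in> B" "y3 \<in> B" "y4 \<in> B"
      using that by (auto simp: curve_quadruples_def)
    have "int p dvd \<alpha> * ((y1 + y2) - (y3 + y4))"
      "int p dvd \<beta> * ((poly g y1 + poly g y2) - (poly g y3 + poly g y4))"
      using that unfolding right_diff_distrib distrib_left by (simp_all add: curve_quadruples_def)
    then show "int p dvd (y1 + y2) - (y3 + y4)" "int p dvd (poly g y1 + poly g y2) - (poly g y3 + poly g y4)"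
      using ab prime_dvd_mult_iff[OF p0(2)] by simp_all
  qed
  have QB: "Q y2 y4 \<subseteq> B \<times> B" for y2 y4
    by (auto simp: Q_def curve_quadruples_def)
  then have finQ: "finite (Q y2 y4)" for y2 y4
    using finite_subset[OF QB finite_cartesian_product[OF fin fin]] by blast
  have inj: "inj_on snd (Q y2 y4)" for y2 y4
  proof (rule inj_onI)
    fix s s' assume s: "s \<in> Q y2 y4" "s' \<in> Q y2 y4" "snd s = snd s'"
    obtain y1 y3 y1' where *: "s = (y1, y3)" "s' = (y1', y3)"
      using s(3) by (metis prod.collapse)
    have h: "((y1, y2), (y3, y4)) \<in> ?E" "((y1', y2), (y3, y4)) \<in> ?E"
      using s by (auto simp: Q_def *)
    have "int p dvd ((y1 + y2) - (y3 + y4)) - ((y1' + y2) - (y3 + y4))"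
      using E(5)[OF h(1)] E(5)[OF h(2)] by (rule dvd_diff)
    then have "int p dvd y1 - y1'"
      by simp
    then have "y1 = y1'"
      using residues_eqI[OF p0(1) B E(1)[OF h(1)] E(1)[OF h(2)]] by simp
    then show "s = s'"
      by (simp add: *)
  qed
  have offdiag: "card (Q y2 y4) \<le> d" if y: "y2 \<in> B" "y4 \<in> B" "y2 \<noteq> y4" for y2 y4
  proof -
    define t where "t = y4 - y2"
    have t: "\<not> int p dvd t"
      unfolding t_def using residues_eqI[OF p0(1) B] y by metis
    obtain D where D: "degree D \<le> d" "poly.coeff D d = int (Suc d) * t * lead_coeff g"
        "\<And>y. poly D y = poly g (y + t) - poly g y"
      using difference_polynomial[OF d(1)] by blast
    define D' where "D' = D - [:poly g y4 - poly g y2:]"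
    have cD: "poly.coeff D' d = int (Suc d) * t * lead_coeff g"
      using d D by (simp add: D'_def coeff_pCons split: nat.split)
    have lc: "\<not> int p dvd poly.coeff D' d"
      using t g p0 unfolding cD d(1) by (metis prime_dvd_mult_iff)
    have "degree D' \<le> d"
      using D by (simp add: D'_def degree_diff_le)
    moreover have "poly.coeff D' d \<noteq> 0"
      using lc by auto
    ultimately have degD: "degree D' = d"
      by (meson le_antisym le_degree)
    have "snd ` Q y2 y4 \<subseteq> {x\<in>{0..<int p}. int p dvd poly D' x}"
    proof
      fix y3 assume "y3 \<in> snd ` Q y2 y4"
      then obtain y1 where h: "((y1, y2), (y3, y4)) \<in> ?E"
        by (auto simp: Q_def)
      have "y3 + t - y1 = - ((y1 + y2) - (y3 + y4))"
        by (simp add: t_def)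
      then have "int p dvd y3 + t - y1"
        using E(5)[OF h] by (metis dvd_minus_iff)
      moreover have "y3 + t - y1 dvd poly g (y3 + t) - poly g y1"
        by (rule diff_dvd_poly_diff)
      ultimately have "int p dvd poly g (y3 + t) - poly g y1"
        by (rule dvd_trans)
      then have "int p dvd (poly g (y3 + t) - poly g y1) + ((poly g y1 + poly g y2) - (poly g y3 + poly g y4))"
        using E(6)[OF h] by (rule dvd_add)
      then have "int p dvd poly D' y3"
        by (simp add: D'_def D algebra_simps)
      then show "y3 \<in> {x\<in>{0..<int p}. int p dvd poly D' x}"
        using E(3)[OF h] B by auto
    qed
    then have "card (snd ` Q y2 y4) \<le> card {x\<in>{0..<int p}. int p dvd poly D' x}"
      by (intro card_mono finite_residues_Collect)
    also have "\<dots> \<le> d"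
      using card_roots_mod_prime[OF p, of D'] lc degD by simp
    finally show ?thesis
      using inj by (simp add: card_image)
  qed
  have diag: "card (Q y y) \<le> card B" for y
  proof -
    have "card (snd ` Q y y) \<le> card B"
      using QB[of y y] fin by (intro card_mono) auto
    then show ?thesis
      using inj by (simp add: card_image)
  qed
  have "?E \<subseteq> (\<Union>(y2, y4)\<in>B \<times> B. (\<lambda>(y1, y3). ((y1, y2), (y3, y4))) ` Q y2 y4)"
    by (auto simp: Q_def curve_quadruples_def image_iff)
  then have "card ?E \<le> card (\<Union>(y2, y4)\<in>B \<times> B. (\<lambda>(y1, y3). ((y1, y2), (y3, y4))) ` Q y2 y4)"
    using fin finQ by (intro card_mono) auto
  also have "\<dots> \<le> (\<Sum>(y2, y4)\<in>B \<times> B. card ((\<lambda>(y1, y3). ((y1, y2), (y3, y4))) ` Q y2 y4))"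
    using fin by (intro order_trans[OF card_UN_le]) (auto simp: case_prod_beta)
  also have "\<dots> \<le> (\<Sum>(y2, y4)\<in>B \<times> B. (if y2 = y4 then card B else d))"
    using offdiag diag finQ by (intro sum_mono) (auto intro!: order_trans[OF card_image_le])
  also have "\<dots> = (\<Sum>y2\<in>B. \<Sum>y4\<in>B. (if y2 = y4 then card B else d))"
    by (rule sum.cartesian_product[symmetric])
  also have "\<dots> \<le> (\<Sum>y2\<in>B. card B + card B * d)"
  proof (rule sum_mono)
    fix y2 assume y2: "y2 \<in> B"
    have "(\<Sum>y4\<in>B. (if y2 = y4 then card B else d)) \<le> (\<Sum>y4\<in>B. (if y2 = y4 then card B else 0) + d)"
      by (intro sum_mono) auto
    also have "\<dots> = card B + card B * d"
      using fin y2 by (simp add: sum.distrib)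
    finally show "(\<Sum>y4\<in>B. (if y2 = y4 then card B else d)) \<le> card B + card B * d" .
  qed
  also have "\<dots> = degree g * (card B)\<^sup>2"
    using d by (simp add: power2_eq_square algebra_simps)
  finally show ?thesis .
qed

section \<open>Exponential sums over the parabola\<close>

definition echar :: "nat \<Rightarrow> int \<Rightarrow> complex" where
  "echar p n = cis (2 * pi * real_of_int n / real p)"

lemma echar_add: "echar p (a + b) = echar p a * echar p b"
  by (simp add: echar_def cis_mult add_divide_distrib distrib_left)

lemma echar_0 [simp]: "echar p 0 = 1"
  by (simp add: echar_def)

lemma norm_echar [simp]: "norm (echar p n) = 1"
  by (simp add: echar_def)

lemma cnj_echar: "cnj (echar p n) = echar p (- n)"
  by (simp add: echar_def cis_cnj)

lemma echar_diff: "echar p (a - b) = echar p a * cnj (echar p b)"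
  using echar_add[of p a "- b"] by (simp add: cnj_echar)

lemma echar_power: "echar p n ^ k = echar p (int k * n)"
  by (induction k) (simp_all add: algebra_simps flip: echar_add)

lemma echar_eq_1_iff:
  assumes "p > 0"
  shows "echar p n = 1 \<longleftrightarrow> int p dvd n"
proof
  assume "echar p n = 1"
  then have "cos (2 * pi * real_of_int n / real p) = 1"
    by (simp add: echar_def complex_eq_iff)
  then obtain k :: int where "2 * pi * real_of_int n / real p = real_of_int k * 2 * pi"
    by (auto simp: cos_one_2pi_int)
  then have "real_of_int n = real_of_int (int p * k)"
    using assms by (simp add: field_simps)
  then have "n = int p * k"
    by (simp only: of_int_eq_iff)
  then show "int p dvd n"
    by simp
next
  assume "int p dvd n"
  then obtain k where "n = int p * k"
    by (auto elim: dvdE)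
  then have "2 * pi * real_of_int n / real p = 2 * pi * real_of_int k"
    using assms by simp
  then show "echar p n = 1"
    by (simp add: echar_def cis_multiple_2pi)
qed

lemma echar_cong:
  assumes "p > 0" "int p dvd a - b"
  shows "echar p a = echar p b"
proof -
  have "echar p a = echar p (a - b) * echar p b"
    using echar_add[of p "a - b" b] by simp
  then show ?thesis
    using assms by (simp add: echar_eq_1_iff)
qed

lemma sum_residues_eq: "(\<Sum>r\<in>{0..<int p}. f r) = (\<Sum>k<p. f (int k))"
  by (rule sum.reindex_bij_witness[of _ int nat]) auto

lemma echar_orthogonality:
  assumes "p > 0"
  shows "(\<Sum>r\<in>{0..<int p}. echar p (r * n)) = (if int p dvd n then of_nat p else 0)"
proof -
  have "(\<Sum>r\<in>{0..<int p}. echar p (r * n)) = (\<Sum>k<p. echar p n ^ k)"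
    by (simp add: sum_residues_eq echar_power)
  also have "\<dots> = (if int p dvd n then of_nat p else 0)"
  proof (cases "int p dvd n")
    case True
    then have "echar p n = 1"
      using assms by (simp add: echar_eq_1_iff)
    then show ?thesis
      using True by simp
  next
    case False
    then have "echar p n \<noteq> 1"
      using assms by (simp add: echar_eq_1_iff)
    moreover have "echar p n ^ p = 1"
      using assms by (simp add: echar_power echar_eq_1_iff)
    ultimately show ?thesis
      using False by (simp add: geometric_sum)
  qed
  finally show ?thesis .
qed

text \<open>
  Expanding the square and summing over the frequencies leaves the pairs that agree in both
  coordinates.
\<close>

lemma parseval_two_dim:
  fixes \<psi>1 \<psi>2 :: "'a \<Rightarrow> int"
  assumes p: "p > 0" and S: "finite S"
  shows "(\<Sum>(u, v)\<in>{0..<int p} \<times> {0..<int p}. (norm (\<Sum>s\<in>S. echar p (u * \<psi>1 s + v * \<psi>2 s)))\<^sup>2)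
    = (real p)\<^sup>2 * card {(s, t). s \<in> S \<and> t \<in> S \<and> int p dvd \<psi>1 s - \<psi>1 t \<and> int p dvd \<psi>2 s - \<psi>2 t}"
proof -
  let ?R = "{0..<int p}"
  have sq: "of_real ((norm (\<Sum>s\<in>S. echar p (u * \<psi>1 s + v * \<psi>2 s)))\<^sup>2) =
      (\<Sum>(s, t)\<in>S \<times> S. echar p (u * (\<psi>1 s - \<psi>1 t)) * echar p (v * (\<psi>2 s - \<psi>2 t)))" for u v
  proof -
    have "(\<Sum>s\<in>S. echar p (u * \<psi>1 s + v * \<psi>2 s)) * cnj (\<Sum>s\<in>S. echar p (u * \<psi>1 s + v * \<psi>2 s))
        = (\<Sum>(s, t)\<in>S \<times> S. echar p (u * \<psi>1 s + v * \<psi>2 s) * cnj (echar p (u * \<psi>1 t + v * \<psi>2 t)))"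
      by (simp add: sum_product sum.cartesian_product)
    also have "\<dots> = (\<Sum>(s, t)\<in>S \<times> S. echar p (u * (\<psi>1 s - \<psi>1 t)) * echar p (v * (\<psi>2 s - \<psi>2 t)))"
      unfolding echar_diff[symmetric] echar_add[symmetric]
      by (intro sum.cong refl) (auto simp: algebra_simps)
    finally show ?thesis
      by (simp only: complex_norm_square)
  qed
  have "of_real (\<Sum>(u, v)\<in>?R \<times> ?R. (norm (\<Sum>s\<in>S. echar p (u * \<psi>1 s + v * \<psi>2 s)))\<^sup>2) =
      (\<Sum>(u, v)\<in>?R \<times> ?R. \<Sum>(s, t)\<in>S \<times> S. echar p (u * (\<psi>1 s - \<psi>1 t)) * echar p (v * (\<psi>2 s - \<psi>2 t)))"
    unfolding of_real_sum by (intro sum.cong refl) (simp only: case_prod_beta sq)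
  also have "\<dots> = (\<Sum>(s, t)\<in>S \<times> S. \<Sum>(u, v)\<in>?R \<times> ?R. echar p (u * (\<psi>1 s - \<psi>1 t)) * echar p (v * (\<psi>2 s - \<psi>2 t)))"
    unfolding case_prod_beta by (rule sum.swap)
  also have "\<dots> = (\<Sum>(s, t)\<in>S \<times> S. (\<Sum>u\<in>?R. echar p (u * (\<psi>1 s - \<psi>1 t))) * (\<Sum>v\<in>?R. echar p (v * (\<psi>2 s - \<psi>2 t))))"
    by (intro sum.cong refl) (simp add: case_prod_beta sum_product sum.cartesian_product)
  also have "\<dots> = (\<Sum>(s, t)\<in>S \<times> S. if int p dvd \<psi>1 s - \<psi>1 t \<and> int p dvd \<psi>2 s - \<psi>2 t then (of_nat p)\<^sup>2 else 0)"
    using p by (intro sum.cong refl) (auto simp: echar_orthogonality power2_eq_square)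
  also have "\<dots> = (\<Sum>(s, t)\<in>{(s, t). s \<in> S \<and> t \<in> S \<and> int p dvd \<psi>1 s - \<psi>1 t \<and> int p dvd \<psi>2 s - \<psi>2 t}. (of_nat p)\<^sup>2)"
    using S by (intro sum.mono_neutral_cong_right) (auto split: if_splits)
  also have "\<dots> = of_real ((real p)\<^sup>2 * card {(s, t). s \<in> S \<and> t \<in> S \<and> int p dvd \<psi>1 s - \<psi>1 t \<and> int p dvd \<psi>2 s - \<psi>2 t})"
    by (simp add: case_prod_beta)
  finally show ?thesis
    by (simp only: of_real_eq_iff)
qed

text \<open>
  Cauchy--Schwarz for the fibre sizes \<open>n\<close>, in the form \<open>2 n (h v) n v \<le> (n (h v))\<^sup>2 + (n v)\<^sup>2\<close>.
\<close>

lemma shifted_collisions_le: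
  fixes f :: "'a \<Rightarrow> 'b" and h :: "'b \<Rightarrow> 'b"
  assumes S: "finite S" and h: "inj_on h (f ` S)"
  shows "card {(s, t). s \<in> S \<and> t \<in> S \<and> f s = h (f t)} \<le> card (collisions f S)"
proof -
  define n where "n v = card {s\<in>S. f s = v}" for v
  have n0: "n v = 0" if "v \<notin> f ` S" for v
  proof -
    have "{s\<in>S. f s = v} = {}"
      using that by auto
    then show ?thesis
      by (simp only: n_def card.empty)
  qed
  let ?V = "f ` S"
  have "{(s, t). s \<in> S \<and> t \<in> S \<and> f s = h (f t)} = (\<Union>v\<in>?V. {s\<in>S. f s = h v} \<times> {s\<in>S. f s = v})"
    by auto
  also have "card \<dots> = (\<Sum>v\<in>?V. card ({s\<in>S. f s = h v} \<times> {s\<in>S. f s = v}))"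
    using S by (intro card_UN_disjoint) auto
  also have "\<dots> = (\<Sum>v\<in>?V. n (h v) * n v)"
    by (simp add: card_cartesian_product n_def)
  finally have "2 * card {(s, t). s \<in> S \<and> t \<in> S \<and> f s = h (f t)} = (\<Sum>v\<in>?V. 2 * (n (h v) * n v))"
    by (simp add: sum_distrib_left)
  also have "\<dots> \<le> (\<Sum>v\<in>?V. (n (h v))\<^sup>2 + (n v)\<^sup>2)"
  proof (rule sum_mono)
    fix v
    have "int (2 * (n (h v) * n v)) \<le> int ((n (h v))\<^sup>2 + (n v)\<^sup>2)"
      using zero_le_power2[of "int (n (h v)) - int (n v)"] by (simp add: power2_diff)
    then show "2 * (n (h v) * n v) \<le> (n (h v))\<^sup>2 + (n v)\<^sup>2"
      by (simp only: of_nat_le_iff)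
  qed
  also have "\<dots> = (\<Sum>v\<in>h ` ?V. (n v)\<^sup>2) + (\<Sum>v\<in>?V. (n v)\<^sup>2)"
    using h by (simp add: sum.distrib sum.reindex)
  also have "(\<Sum>v\<in>h ` ?V. (n v)\<^sup>2) = (\<Sum>v\<in>h ` ?V \<inter> ?V. (n v)\<^sup>2)"
    using S n0 by (intro sum.mono_neutral_right) auto
  also have "\<dots> \<le> (\<Sum>v\<in>?V. (n v)\<^sup>2)"
    using S by (intro sum_mono2) auto
  also have "(\<Sum>v\<in>?V. (n v)\<^sup>2) = card (collisions f S)"
    by (simp add: card_collisions[OF S] n_def)
  finally show ?thesis
    by simp
qed

definition psum4 :: "nat \<Rightarrow> (int \<times> int \<times> int) \<times> int \<Rightarrow> int \<times> int" where
  "psum4 p = (\<lambda>((x, y, z), t). ((x + y - z - t) mod int p, (x\<^sup>2 + y\<^sup>2 - z\<^sup>2 - t\<^sup>2) mod int p))"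

text \<open>
  For fixed fourth points the two triples collide up to a fixed translation of the plane.
\<close>

lemma collisions_psum4:
  assumes p: "p > 0" and A: "finite A"
  shows "card (collisions (psum4 p) ((A \<times> A \<times> A) \<times> A)) \<le> (card A)\<^sup>2 * card (collisions (psum p) (A \<times> A \<times> A))"
proof -
  let ?S = "A \<times> A \<times> A"
  define h where "h x y = (\<lambda>(u, v). ((u + x - y) mod int p, (v + x\<^sup>2 - y\<^sup>2) mod int p))" for x y :: int
  have inj: "inj_on (h x y) (psum p ` ?S)" for x y
  proof (rule inj_onI)
    fix w w' assume w: "w \<in> psum p ` ?S" "w' \<in> psum p ` ?S" "h x y w = h x y w'"
    obtain u v u' v' where uv: "w = (u, v)" "w' = (u', v')"
      by (metis prod.exhaust)
    have r: "u \<in> {0..<int p}" "v \<in> {0..<int p}" "u' \<in> {0..<int p}" "v' \<in> {0..<int p}"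
      using w p by (auto simp: uv psum_def)
    have "int p dvd u - u'" "int p dvd v - v'"
      using w(3) by (auto simp: h_def uv mod_eq_dvd_iff)
    then show "w = w'"
      using residues_eqI[OF p order_refl] r by (simp add: uv)
  qed
  define G where "G x y = {(s, t). s \<in> ?S \<and> t \<in> ?S \<and> psum p s = h x y (psum p t)}" for x y
  define T where "T = (\<lambda>(x, y). (\<lambda>(s, t). ((s, x), (t, y))) ` G x y)"
  have "collisions (psum4 p) (?S \<times> A) \<subseteq>
      (\<Union>z\<in>A \<times> A. T z)"
  proof
    fix c assume "c \<in> collisions (psum4 p) (?S \<times> A)"
    then obtain s x t y where c: "c = ((s, x), (t, y))" "s \<in> ?S" "t \<in> ?S" "x \<in> A" "y \<in> A"
      "psum4 p (s, x) = psum4 p (t, y)"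
      by (auto simp: collisions_def)
    obtain s1 s2 s3 t1 t2 t3 where st: "s = (s1, s2, s3)" "t = (t1, t2, t3)"
      by (metis prod.exhaust)
    have d: "int p dvd (s1 + s2 - s3 - x) - (t1 + t2 - t3 - y)"
      "int p dvd (s1\<^sup>2 + s2\<^sup>2 - s3\<^sup>2 - x\<^sup>2) - (t1\<^sup>2 + t2\<^sup>2 - t3\<^sup>2 - y\<^sup>2)"
      using c(6) by (auto simp: psum4_def st mod_eq_dvd_iff)
    have "(s1 + s2 - s3) mod int p = ((t1 + t2 - t3) + x - y) mod int p"
      "(s1\<^sup>2 + s2\<^sup>2 - s3\<^sup>2) mod int p = ((t1\<^sup>2 + t2\<^sup>2 - t3\<^sup>2) + x\<^sup>2 - y\<^sup>2) mod int p"
      using d by (simp_all add: mod_eq_dvd_iff algebra_simps)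
    moreover have "(n mod int p + a - b) mod int p = (n + a - b) mod int p" for n a b
      using mod_add_left_eq[of n "int p" "a - b"] by (simp add: add_diff_eq)
    ultimately have "psum p s = h x y (psum p t)"
      by (simp add: psum_def h_def st)
    then have "(s, t) \<in> G x y"
      using c by (simp add: G_def)
    then have "c \<in> (\<lambda>(s, t). ((s, x), (t, y))) ` G x y"
      unfolding c(1) by (intro image_eqI[of _ _ "(s, t)"]) auto
    then have "c \<in> T (x, y)"
      by (simp add: T_def)
    then show "c \<in> (\<Union>z\<in>A \<times> A. T z)"
      using c(4,5) by blast
  qed
  moreover have fin: "finite (G x y)" for x y
    unfolding G_def by (rule finite_subset[of _ "?S \<times> ?S"]) (use A in auto)
  then have finT: "finite (T z)" for z
    by (simp add: T_def case_prod_beta)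
  ultimately have "card (collisions (psum4 p) (?S \<times> A)) \<le> card (\<Union>z\<in>A \<times> A. T z)"
    using A by (intro card_mono finite_UN_I finite_cartesian_product)
  also have "\<dots> \<le> (\<Sum>z\<in>A \<times> A. card (T z))"
    using A by (intro card_UN_le finite_cartesian_product)
  also have "\<dots> \<le> (\<Sum>z\<in>A \<times> A. card (collisions (psum p) ?S))"
  proof (rule sum_mono)
    fix z :: "int \<times> int"
    obtain x y where z: "z = (x, y)"
      by (metis prod.exhaust)
    have "card (T z) \<le> card (G x y)"
      unfolding z T_def prod.case using fin by (rule card_image_le)
    also have "\<dots> \<le> card (collisions (psum p) ?S)"
      unfolding G_def using A inj by (intro shifted_collisions_le) auto
    finally show "card (T z) \<le> card (collisions (psum p) ?S)" .
  qed
  also have "\<dots> = (card A)\<^sup>2 * card (collisions (psum p) ?S)"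
    by (simp add: card_cartesian_product power2_eq_square)
  finally show ?thesis .
qed

lemma norm_power4_eq:
  fixes a :: "int \<Rightarrow> complex"
  assumes "finite A"
  shows "of_real ((norm (\<Sum>x\<in>A. a x)) ^ 4) =
    (\<Sum>((x, y, z), t)\<in>(A \<times> A \<times> A) \<times> A. a x * (a y * cnj (a z)) * cnj (a t))"
proof -
  let ?f = "\<Sum>x\<in>A. a x"
  have "of_real ((norm ?f) ^ 4) = of_real ((norm ?f)\<^sup>2) * of_real ((norm ?f)\<^sup>2)"
    by (simp add: power_add[symmetric] flip: of_real_mult)
  also have "\<dots> = ?f * (?f * cnj ?f) * cnj ?f"
    by (simp only: complex_norm_square ac_simps)
  also have "?f * cnj ?f = (\<Sum>(y, z)\<in>A \<times> A. a y * cnj (a z))"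
    by (simp add: sum_product sum.cartesian_product)
  also have "?f * \<dots> = (\<Sum>(x, y, z)\<in>A \<times> A \<times> A. a x * (a y * cnj (a z)))"
    by (simp add: sum_product sum.cartesian_product case_prod_beta)
  also have "\<dots> * cnj ?f = (\<Sum>((x, y, z), t)\<in>(A \<times> A \<times> A) \<times> A. a x * (a y * cnj (a z)) * cnj (a t))"
    by (simp add: sum_product sum.cartesian_product case_prod_beta)
  finally show ?thesis .
qed

lemma curve_fourth_moment:
  fixes \<phi> \<theta> :: "int \<Rightarrow> int"
  assumes p: "p > 0" and B: "finite B"
  shows "(\<Sum>(u, v)\<in>{0..<int p} \<times> {0..<int p}. (norm (\<Sum>y\<in>B. echar p (u * \<phi> y + v * \<theta> y))) ^ 4) =
    (real p)\<^sup>2 * card (curve_quadruples p \<phi> \<theta> B)"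
proof -
  have "(norm (\<Sum>y\<in>B. echar p (u * \<phi> y + v * \<theta> y))) ^ 4 =
      (norm (\<Sum>s\<in>B \<times> B. echar p (u * (\<phi> (fst s) + \<phi> (snd s)) + v * (\<theta> (fst s) + \<theta> (snd s)))))\<^sup>2" for u v
  proof -
    have "(\<Sum>y\<in>B. echar p (u * \<phi> y + v * \<theta> y)) * (\<Sum>y\<in>B. echar p (u * \<phi> y + v * \<theta> y)) =
        (\<Sum>s\<in>B \<times> B. echar p (u * \<phi> (fst s) + v * \<theta> (fst s)) * echar p (u * \<phi> (snd s) + v * \<theta> (snd s)))"
      by (simp add: sum_product sum.cartesian_product case_prod_beta)
    also have "\<dots> = (\<Sum>s\<in>B \<times> B. echar p (u * (\<phi> (fst s) + \<phi> (snd s)) + v * (\<theta> (fst s) + \<theta> (snd s))))"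
      unfolding echar_add[symmetric] by (intro sum.cong refl arg_cong[where f = "echar p"]) (simp add: algebra_simps)
    finally have "(norm (\<Sum>y\<in>B. echar p (u * \<phi> y + v * \<theta> y)))\<^sup>2 =
        norm (\<Sum>s\<in>B \<times> B. echar p (u * (\<phi> (fst s) + \<phi> (snd s)) + v * (\<theta> (fst s) + \<theta> (snd s))))"
      by (simp only: power2_eq_square norm_mult[symmetric])
    then have "((norm (\<Sum>y\<in>B. echar p (u * \<phi> y + v * \<theta> y)))\<^sup>2)\<^sup>2 =
        (norm (\<Sum>s\<in>B \<times> B. echar p (u * (\<phi> (fst s) + \<phi> (snd s)) + v * (\<theta> (fst s) + \<theta> (snd s)))))\<^sup>2"
      by (rule arg_cong)
    then show ?thesis
      by (simp only: power_mult[symmetric]) simp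
  qed
  then have "(\<Sum>(u, v)\<in>{0..<int p} \<times> {0..<int p}. (norm (\<Sum>y\<in>B. echar p (u * \<phi> y + v * \<theta> y))) ^ 4) =
    (\<Sum>(u, v)\<in>{0..<int p} \<times> {0..<int p}.
      (norm (\<Sum>s\<in>B \<times> B. echar p (u * (\<phi> (fst s) + \<phi> (snd s)) + v * (\<theta> (fst s) + \<theta> (snd s)))))\<^sup>2)"
    by simp
  also have "\<dots> = (real p)\<^sup>2 * card {(s, t). s \<in> B \<times> B \<and> t \<in> B \<times> B \<and>
      int p dvd (\<phi> (fst s) + \<phi> (snd s)) - (\<phi> (fst t) + \<phi> (snd t)) \<and>
      int p dvd (\<theta> (fst s) + \<theta> (snd s)) - (\<theta> (fst t) + \<theta> (snd t))}"
    using p B by (intro parseval_two_dim finite_cartesian_product)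
  also have "{(s, t). s \<in> B \<times> B \<and> t \<in> B \<times> B \<and>
      int p dvd (\<phi> (fst s) + \<phi> (snd s)) - (\<phi> (fst t) + \<phi> (snd t)) \<and>
      int p dvd (\<theta> (fst s) + \<theta> (snd s)) - (\<theta> (fst t) + \<theta> (snd t))} = curve_quadruples p \<phi> \<theta> B"
    by (auto simp: curve_quadruples_def)
  finally show ?thesis .
qed

text \<open>
  Hoelder's inequality for the bilinear form \<open>x \<phi> y + x\<^sup>2 \<theta> y\<close>. The fourth power of the inner sum replaces \<open>x\<close> by
  the combinations \<open>d s\<close> of four points of the parabola, which removes the absolute value and lets the
  sum over \<open>y\<close> be taken first, giving \<open>F (d s)\<close>. Two more applications of Cauchy--Schwarz separate the multiplicities of
  the \<open>d s\<close> from the fourth moment of \<open>F\<close> over the whole plane, and Parseval evaluates the latter.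
\<close>

lemma bilinear_sum_power16:
  fixes \<phi> \<theta> :: "int \<Rightarrow> int"
  assumes p: "p > 0" and A: "finite A" and B: "finite B"
  defines "T \<equiv> (\<Sum>y\<in>B. norm (\<Sum>x\<in>A. echar p (\<phi> y * x + \<theta> y * x\<^sup>2)))"
  defines "E \<equiv> card (curve_quadruples p \<phi> \<theta> B)"
  shows "T ^ 16 \<le> real (card B) ^ 12 * real (card A) ^ 8 *
    (real (card (collisions (psum4 p) ((A \<times> A \<times> A) \<times> A))) * ((real p)\<^sup>2 * real E))"
proof -
  let ?S = "(A \<times> A \<times> A) \<times> A"
  let ?R = "{0..<int p}"
  have finS: "finite ?S"
    using A by simp
  define f where "f y = (\<Sum>x\<in>A. echar p (\<phi> y * x + \<theta> y * x\<^sup>2))" for y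
  define F where "F w = (\<Sum>y\<in>B. echar p (fst w * \<phi> y + snd w * \<theta> y))" for w :: "int \<times> int"
  define d where "d = (\<lambda>((x, y, z), t). (x + y - z - t, x\<^sup>2 + y\<^sup>2 - z\<^sup>2 - t\<^sup>2 :: int))"
  have T: "T = (\<Sum>y\<in>B. norm (f y))"
    by (simp add: T_def f_def)
  define Q X P where "Q = (\<Sum>y\<in>B. (norm (f y)) ^ 4)" and "X = (\<Sum>s\<in>?S. norm (F (d s)))"
    and "P = (\<Sum>s\<in>?S. (norm (F (d s)))\<^sup>2)"
  have T0: "T \<ge> 0" and Q0: "Q \<ge> 0" and X0: "X \<ge> 0" and P0: "P \<ge> 0"
    unfolding T Q_def X_def P_def by (auto intro!: sum_nonneg)
  have TQ: "T ^ 4 \<le> real (card B) ^ 3 * Q"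
  proof -
    define M where "M = (\<Sum>y\<in>B. (norm (f y))\<^sup>2)"
    have "T\<^sup>2 \<le> card B * M"
      unfolding T M_def using B by (rule sum_power2_le)
    then have "(T\<^sup>2)\<^sup>2 \<le> (card B * M)\<^sup>2"
      by (rule power_mono) simp
    also have "\<dots> = (real (card B))\<^sup>2 * M\<^sup>2"
      by (simp add: power_mult_distrib)
    also have "M\<^sup>2 \<le> card B * Q"
      unfolding M_def Q_def using sum_power2_le[OF B, of "\<lambda>y. (norm (f y))\<^sup>2"] by (simp flip: power_mult)
    finally show ?thesis
      by (simp add: mult_left_mono eval_nat_numeral mult.assoc)
  qed
  have QX: "Q \<le> X"
  proof -
    have "of_real ((norm (f y)) ^ 4) = (\<Sum>s\<in>?S. echar p (fst (d s) * \<phi> y + snd (d s) * \<theta> y))" for y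
    proof -
      have "of_real ((norm (f y)) ^ 4) = (\<Sum>((x1, x2, x3), x4)\<in>?S.
          echar p (\<phi> y * x1 + \<theta> y * x1\<^sup>2) * (echar p (\<phi> y * x2 + \<theta> y * x2\<^sup>2) *
            cnj (echar p (\<phi> y * x3 + \<theta> y * x3\<^sup>2))) * cnj (echar p (\<phi> y * x4 + \<theta> y * x4\<^sup>2)))"
        unfolding f_def by (rule norm_power4_eq[OF A])
      also have "\<dots> = (\<Sum>s\<in>?S. echar p (fst (d s) * \<phi> y + snd (d s) * \<theta> y))"
        unfolding cnj_echar echar_add[symmetric]
        by (intro sum.cong refl) (auto simp: d_def algebra_simps)
      finally show ?thesis .
    qed
    then have "of_real Q = (\<Sum>y\<in>B. \<Sum>s\<in>?S. echar p (fst (d s) * \<phi> y + snd (d s) * \<theta> y))"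
      by (simp add: Q_def)
    also have "\<dots> = (\<Sum>s\<in>?S. F (d s))"
      unfolding F_def by (rule sum.swap)
    finally have "norm (complex_of_real Q) = norm (\<Sum>s\<in>?S. F (d s))"
      by simp
    also have "\<dots> \<le> X"
      unfolding X_def by (rule norm_sum)
    finally show ?thesis
      using Q0 by simp
  qed
  have XP: "X\<^sup>2 \<le> real (card A) ^ 4 * P"
    unfolding X_def P_def using sum_power2_le[OF finS, of "\<lambda>s. norm (F (d s))"]
    by (simp add: card_cartesian_product eval_nat_numeral mult.assoc)
  have PE: "P\<^sup>2 \<le> real (card (collisions (psum4 p) ?S)) * ((real p)\<^sup>2 * real E)"
  proof -
    let ?W = "psum4 p ` ?S"
    have Fcong: "F (d s) = F (psum4 p s)" for s
    proof -
      obtain x y z t where s: "s = ((x, y, z), t)"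
        by (metis prod.exhaust)
      show ?thesis
        unfolding F_def
      proof (intro sum.cong refl echar_cong[OF p])
        fix b
        have "(fst (d s) * \<phi> b + snd (d s) * \<theta> b) - (fst (psum4 p s) * \<phi> b + snd (psum4 p s) * \<theta> b) =
            (fst (d s) - fst (d s) mod int p) * \<phi> b + (snd (d s) - snd (d s) mod int p) * \<theta> b"
          by (simp add: psum4_def d_def s algebra_simps)
        also have "int p dvd \<dots>"
          by (simp add: minus_mod_eq_mult_div)
        finally show "int p dvd (fst (d s) * \<phi> b + snd (d s) * \<theta> b) - (fst (psum4 p s) * \<phi> b + snd (psum4 p s) * \<theta> b)" .
      qed
    qed
    have "P = (\<Sum>w\<in>?W. \<Sum>s\<in>{s\<in>?S. psum4 p s = w}. (norm (F (psum4 p s)))\<^sup>2)"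
      unfolding P_def Fcong by (rule sum.image_gen[OF finS])
    also have "\<dots> = (\<Sum>w\<in>?W. real (card {s\<in>?S. psum4 p s = w}) * (norm (F w))\<^sup>2)"
      by (intro sum.cong refl) simp
    finally have "P\<^sup>2 \<le> (\<Sum>w\<in>?W. (real (card {s\<in>?S. psum4 p s = w}))\<^sup>2) * (\<Sum>w\<in>?W. ((norm (F w))\<^sup>2)\<^sup>2)"
      using Cauchy_Schwarz_ineq_sum[of "\<lambda>w. real (card {s\<in>?S. psum4 p s = w})" "\<lambda>w. (norm (F w))\<^sup>2" ?W] by simp
    also have "\<dots> \<le> (\<Sum>w\<in>?W. (real (card {s\<in>?S. psum4 p s = w}))\<^sup>2) * (\<Sum>w\<in>?R \<times> ?R. ((norm (F w))\<^sup>2)\<^sup>2)"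
    proof (intro mult_left_mono sum_mono2 sum_nonneg)
      show "?W \<subseteq> ?R \<times> ?R"
        using p by (auto simp: psum4_def)
    qed auto
    also have "(\<Sum>w\<in>?W. (real (card {s\<in>?S. psum4 p s = w}))\<^sup>2) = real (card (collisions (psum4 p) ?S))"
      by (simp add: card_collisions[OF finS])
    also have "(\<Sum>w\<in>?R \<times> ?R. ((norm (F w))\<^sup>2)\<^sup>2) = (real p)\<^sup>2 * real E"
      using curve_fourth_moment[OF p B, of \<phi> \<theta>] by (simp add: F_def E_def case_prod_beta flip: power_mult)
    finally show ?thesis .
  qed
  have "T ^ 16 = (T ^ 4) ^ 4"
    by (simp flip: power_mult)
  also have "\<dots> \<le> (real (card B) ^ 3 * X) ^ 4"
    using TQ QX T0 by (intro power_mono order_trans[OF TQ] mult_left_mono) auto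
  also have "\<dots> = real (card B) ^ 12 * (X\<^sup>2)\<^sup>2"
    by (simp add: power_mult_distrib flip: power_mult)
  also have "\<dots> \<le> real (card B) ^ 12 * (real (card A) ^ 4 * P)\<^sup>2"
    using XP by (intro mult_left_mono power_mono) auto
  also have "\<dots> = real (card B) ^ 12 * real (card A) ^ 8 * P\<^sup>2"
    by (simp add: power_mult_distrib flip: power_mult)
  also have "\<dots> \<le> real (card B) ^ 12 * real (card A) ^ 8 *
      (real (card (collisions (psum4 p) ?S)) * ((real p)\<^sup>2 * real E))"
    using PE by (intro mult_left_mono) auto
  finally show ?thesis .
qed

section \<open>Cancellation for two sources\<close>

text \<open>
  Taking \<open>K\<close> to be a small power of \<open>card A\<close> in \<open>parabola_energy_bound\<close>.
\<close>

lemma parabola_energy_power_saving: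
  obtains C c :: real where "C \<ge> 1" "c > 0" "c \<le> 1"
    "\<And>p A. prime p \<Longrightarrow> p > 2 \<Longrightarrow> A \<subseteq> {0..<int p} \<Longrightarrow> A \<noteq> {} \<Longrightarrow> (card A)\<^sup>2 \<le> p \<Longrightarrow>
      real (card (collisions (psum p) (A \<times> A \<times> A))) \<le> C * real (card A) powr (4 - c)"
proof -
  obtain C0 :: real and e :: nat where C0: "C0 \<ge> 1" "e \<ge> 1"
    and rich: "\<And>p A K. prime p \<Longrightarrow> p > 2 \<Longrightarrow> A \<subseteq> {0..<int p} \<Longrightarrow> (card A)\<^sup>2 \<le> p \<Longrightarrow> K \<ge> 1 \<Longrightarrow>
      real (card A) ^ 4 / K \<le> real (card (collisions (psum p) (A \<times> A \<times> A))) \<Longrightarrow> real (card A) \<le> C0 * K ^ e"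
    using parabola_energy_bound by blast
  define c where "c = 1 / real e"
  have c: "c > 0" "c \<le> 1"
    using C0 by (auto simp: c_def)
  have main: "real (card (collisions (psum p) (A \<times> A \<times> A))) \<le> (2 * C0) powr 3 * real (card A) powr (4 - c)"
    if p: "prime p" "p > 2" and A: "A \<subseteq> {0..<int p}" "A \<noteq> {}" and Ap: "(card A)\<^sup>2 \<le> p" for p A
  proof -
    define N J where "N = real (card A)" and "J = real (card (collisions (psum p) (A \<times> A \<times> A)))"
    have fin: "finite A"
      using A finite_subset by auto
    have N: "N \<ge> 1"
      using A fin by (simp add: N_def card_gt_0_iff Suc_leI)
    show ?thesis
    proof (cases "N < 2 * C0")
      case True
      have "collisions (psum p) (A \<times> A \<times> A) \<subseteq> (A \<times> A \<times> A) \<times> (A \<times> A \<times> A)"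
        by (auto simp: collisions_def)
      then have "card (collisions (psum p) (A \<times> A \<times> A)) \<le> card ((A \<times> A \<times> A) \<times> (A \<times> A \<times> A))"
        using fin by (intro card_mono) auto
      then have "J \<le> real (card ((A \<times> A \<times> A) \<times> (A \<times> A \<times> A)))"
        by (simp only: J_def of_nat_le_iff)
      also have "\<dots> = N powr 6"
        using N by (simp add: N_def card_cartesian_product eval_nat_numeral mult.assoc powr_numeral)
      also have "\<dots> = N powr (2 + c) * N powr (4 - c)"
        by (simp flip: powr_add)
      also have "\<dots> \<le> (2 * C0) powr 3 * N powr (4 - c)"
      proof (rule mult_right_mono)
        have "N powr (2 + c) \<le> N powr 3"
          using N c by (intro powr_mono) auto
        also have "\<dots> \<le> (2 * C0) powr 3"
          using N True by (intro powr_mono2) auto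
        finally show "N powr (2 + c) \<le> (2 * C0) powr 3" .
      qed simp
      finally show ?thesis
        by (simp add: J_def N_def)
    next
      case False
      define K where "K = (N / (2 * C0)) powr c"
      have q: "N / (2 * C0) \<ge> 1"
        using False C0 by simp
      then have K: "K \<ge> 1"
        unfolding K_def using c by (simp add: ge_one_powr_ge_zero)
      have "K ^ e = N / (2 * C0)"
        using q C0 by (simp add: K_def c_def powr_power)
      then have "C0 * K ^ e < N"
        using C0 N by simp
      then have "\<not> N ^ 4 / K \<le> J"
        using rich[OF p A(1) Ap K] by (auto simp: N_def J_def)
      then have "J \<le> N ^ 4 / K"
        by simp
      also have "N ^ 4 = N powr 4"
        using N by (simp add: powr_numeral)
      also have "N powr 4 / K = (2 * C0) powr c * N powr (4 - c)"
        using N C0 by (simp add: K_def powr_divide powr_diff)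
      also have "\<dots> \<le> (2 * C0) powr 3 * N powr (4 - c)"
        using C0 c by (intro mult_right_mono powr_mono) auto
      finally show ?thesis
        by (simp add: J_def N_def)
    qed
  qed
  have "(2 * C0) powr 3 \<ge> 1"
    using C0 by (intro ge_one_powr_ge_zero) auto
  then show ?thesis
    using that[of "(2 * C0) powr 3" c] c main by blast
qed

text \<open>
  Without the saving \<open>card A powr (- c)\<close> in the energy of the parabola, the sixteenth power of the relative size
  of the sum would be of order \<open>p\<^sup>2 / (card A * card B)\<^sup>2\<close>, which is \<open>p powr (4 * \<delta>)\<close> when both sets have
  \<open>p powr (1 / 2 - \<delta>)\<close> elements. The saving is at least \<open>p powr (c / 4)\<close> and wins for small \<open>\<delta>\<close>.
\<close>

lemma two_source_medium_sets:
  fixes g :: "int poly"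
  assumes g: "degree g \<ge> 2"
  obtains \<delta> \<gamma> C :: real and p0 :: nat where "0 < \<delta>" "\<delta> < 1 / 4" "0 < \<gamma>" "0 < C"
    "\<And>p A B \<alpha> \<beta>. prime p \<Longrightarrow> p0 \<le> p \<Longrightarrow> A \<subseteq> {0..<int p} \<Longrightarrow> B \<subseteq> {0..<int p} \<Longrightarrow>
      real p powr (1 / 2 - \<delta>) \<le> real (card A) \<Longrightarrow> (card A)\<^sup>2 \<le> p \<Longrightarrow>
      real p powr (1 / 2 - \<delta>) \<le> real (card B) \<Longrightarrow> (card B)\<^sup>2 \<le> p \<Longrightarrow>
      \<not> int p dvd \<alpha> \<Longrightarrow> \<not> int p dvd \<beta> \<Longrightarrow>
      (\<Sum>y\<in>B. norm (\<Sum>x\<in>A. echar p (\<alpha> * y * x + \<beta> * poly g y * x\<^sup>2))) \<le> C * real p powr (- \<gamma>) * real (card A) * real (card B)"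
proof -
  obtain C0 c :: real where C0: "C0 \<ge> 1" and c: "c > 0" "c \<le> 1"
    and energy: "\<And>p A. prime p \<Longrightarrow> p > 2 \<Longrightarrow> A \<subseteq> {0..<int p} \<Longrightarrow> A \<noteq> {} \<Longrightarrow> (card A)\<^sup>2 \<le> p \<Longrightarrow>
      real (card (collisions (psum p) (A \<times> A \<times> A))) \<le> C0 * real (card A) powr (4 - c)"
    using parabola_energy_power_saving by blast
  \<comment> \<open>the gain \<open>p powr (- c / 4)\<close> beats the loss \<open>p powr (4 * \<delta>)\<close> by \<open>p powr (c / 8)\<close>; its sixteenth root is \<open>p powr \<gamma>\<close>\<close>
  define \<delta> \<gamma> D where "\<delta> = c / 32" and "\<gamma> = c / 128" and "D = C0 * real (degree g)"
  \<comment> \<open>so that \<open>p\<close> is odd and divides neither the degree nor the leading coefficient of \<open>g\<close>\<close>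
  define p0 where "p0 = Suc (nat \<bar>int (degree g) * lead_coeff g\<bar>) + 3"
  have D: "D \<ge> 1"
    unfolding D_def using C0 g mult_mono[of 1 C0 1 "real (degree g)"] by simp
  have main: "(\<Sum>y\<in>B. norm (\<Sum>x\<in>A. echar p (\<alpha> * y * x + \<beta> * poly g y * x\<^sup>2))) \<le> D * real p powr (- \<gamma>) * real (card A) * real (card B)"
    if p: "prime p" "p0 \<le> p" and A: "A \<subseteq> {0..<int p}" and B: "B \<subseteq> {0..<int p}"
      and cA: "real p powr (1 / 2 - \<delta>) \<le> real (card A)" "(card A)\<^sup>2 \<le> p"
      and cB: "real p powr (1 / 2 - \<delta>) \<le> real (card B)" "(card B)\<^sup>2 \<le> p"
      and ab: "\<not> int p dvd \<alpha>" "\<not> int p dvd \<beta>" for p A B \<alpha> \<beta>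
  proof -
    have p3: "p > 2" "real p \<ge> 1"
      using p by (auto simp: p0_def)
    have lc: "\<not> int p dvd int (degree g) * lead_coeff g"
    proof
      assume "int p dvd int (degree g) * lead_coeff g"
      moreover have "int (degree g) * lead_coeff g \<noteq> 0"
        using g by auto
      ultimately have "\<bar>int p\<bar> \<le> \<bar>int (degree g) * lead_coeff g\<bar>"
        by (rule dvd_imp_le_int[rotated])
      then show False
        using p by (simp add: p0_def)
    qed
    have fin: "finite A" "finite B"
      using A B finite_subset by auto
    define a b where "a = real (card A)" and "b = real (card B)"
    have pos: "0 < real p powr (1 / 2 - \<delta>)"
      using p3 by simp
    have a: "a > 0" and b: "b > 0"
      unfolding a_def b_def by (rule less_le_trans[OF pos cA(1)], rule less_le_trans[OF pos cB(1)])
    define T where "T = (\<Sum>y\<in>B. norm (\<Sum>x\<in>A. echar p (\<alpha> * y * x + \<beta> * poly g y * x\<^sup>2)))"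
    define E where "E = card (curve_quadruples p (\<lambda>y. \<alpha> * y) (\<lambda>y. \<beta> * poly g y) B)"
    have "E \<le> degree g * (card B)\<^sup>2"
      unfolding E_def by (rule curve_energy[OF p(1) B ab g lc])
    then have "real E \<le> real (degree g * (card B)\<^sup>2)"
      by (simp only: of_nat_le_iff)
    then have E: "real E \<le> real (degree g) * b\<^sup>2"
      by (simp add: b_def)
    have "A \<noteq> {}"
      using a by (auto simp: a_def)
    have "real (card (collisions (psum4 p) ((A \<times> A \<times> A) \<times> A))) \<le> real ((card A)\<^sup>2 * card (collisions (psum p) (A \<times> A \<times> A)))"
      using p3 fin by (simp only: of_nat_le_iff) (intro collisions_psum4, auto)
    also have "\<dots> \<le> a\<^sup>2 * (C0 * a powr (4 - c))"
      using energy[OF p(1) p3(1) A \<open>A \<noteq> {}\<close> cA(2)] by (simp add: a_def mult_left_mono)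
    finally have J: "real (card (collisions (psum4 p) ((A \<times> A \<times> A) \<times> A))) \<le> a\<^sup>2 * (C0 * a powr (4 - c))" .
    have "T ^ 16 \<le> b ^ 12 * a ^ 8 * (real (card (collisions (psum4 p) ((A \<times> A \<times> A) \<times> A))) * ((real p)\<^sup>2 * real E))"
      unfolding T_def E_def a_def b_def
      using bilinear_sum_power16[OF _ fin, of p "\<lambda>y. \<alpha> * y" "\<lambda>y. \<beta> * poly g y"] p3 by simp
    also have "\<dots> \<le> b ^ 12 * a ^ 8 * ((a\<^sup>2 * (C0 * a powr (4 - c))) * ((real p)\<^sup>2 * (real (degree g) * b\<^sup>2)))"
      using J E a b C0 by (intro mult_left_mono mult_mono) auto
    also have "\<dots> = D * (a * b) ^ 14 * (a powr (- c) * (real p)\<^sup>2)"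
    proof -
      have "a powr (4 - c) = a ^ 4 * a powr (- c)"
        using a by (simp add: powr_diff powr_numeral powr_minus field_simps)
      then show ?thesis
        by (simp add: D_def power_mult_distrib power_add[symmetric] mult.assoc mult.left_commute)
    qed
    also have "\<dots> \<le> D * (a * b) ^ 14 * (real p powr (- (c / 4)) * ((a * b)\<^sup>2 * real p powr (4 * \<delta>)))"
    proof (intro mult_left_mono mult_mono)
      have "a powr (- c) \<le> (real p powr (1 / 2 - \<delta>)) powr (- c)"
        using cA c p3 by (intro powr_mono2') (auto simp: a_def)
      also have "\<dots> \<le> real p powr (- (c / 4))"
        unfolding powr_powr
      proof (rule powr_mono[OF _ p3(2)])
        have "c * (1 / 4) \<le> c * (1 / 2 - \<delta>)"
          using c by (intro mult_left_mono) (auto simp: \<delta>_def)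
        then show "(1 / 2 - \<delta>) * - c \<le> - (c / 4)"
          by (simp add: mult.commute)
      qed
      finally show "a powr (- c) \<le> real p powr (- (c / 4))" .
      have "real p powr (1 / 2 - \<delta>) * real p powr (1 / 2 - \<delta>) \<le> a * b"
        using cA cB a by (intro mult_mono) (auto simp: a_def b_def)
      then have "(real p powr (1 / 2 - \<delta>) * real p powr (1 / 2 - \<delta>))\<^sup>2 \<le> (a * b)\<^sup>2"
        by (intro power_mono) auto
      then have "(real p powr (1 / 2 - \<delta>) * real p powr (1 / 2 - \<delta>))\<^sup>2 * real p powr (4 * \<delta>) \<le> (a * b)\<^sup>2 * real p powr (4 * \<delta>)"
        by (intro mult_right_mono) auto
      also have "(real p powr (1 / 2 - \<delta>) * real p powr (1 / 2 - \<delta>))\<^sup>2 * real p powr (4 * \<delta>) = real p powr 2"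
        by (simp add: power2_eq_square flip: powr_add)
      finally show "(real p)\<^sup>2 \<le> (a * b)\<^sup>2 * real p powr (4 * \<delta>)"
        using p3 by (simp add: powr_numeral)
    qed (use D a b in auto)
    also have "\<dots> = D * ((a * b) ^ 14 * (a * b)\<^sup>2) * (real p powr (- (c / 4)) * real p powr (4 * \<delta>))"
      by (simp only: mult_ac)
    also have "\<dots> = D * (a * b) ^ 16 * (real p powr (- \<gamma>)) ^ 16"
      using p3 by (simp add: powr_power \<delta>_def \<gamma>_def flip: power_add powr_add)
    also have "\<dots> \<le> D ^ 16 * (a * b) ^ 16 * (real p powr (- \<gamma>)) ^ 16"
      using D self_le_power[of D 16] a b by (intro mult_right_mono) auto
    also have "\<dots> = (D * real p powr (- \<gamma>) * a * b) ^ 16"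
      by (simp add: power_mult_distrib mult_ac)
    finally have "T ^ 16 \<le> (D * real p powr (- \<gamma>) * a * b) ^ 16" .
    then have "T ^ Suc 15 \<le> (D * real p powr (- \<gamma>) * a * b) ^ Suc 15"
      by simp
    then have "T \<le> D * real p powr (- \<gamma>) * a * b"
      by (rule power_le_imp_le_base) (use D a b in auto)
    then show ?thesis
      by (simp add: T_def a_def b_def)
  qed
  show ?thesis
    by (rule that[of \<delta> \<gamma> D p0]) (use c D main in \<open>auto simp: \<delta>_def \<gamma>_def\<close>)
qed

text \<open>
  A bound that is linear in the size of the set extends from medium sets to large ones, because a
  large set is a disjoint union of medium ones.
\<close>

lemma norm_sum_le_by_splitting:
  fixes f :: "'a \<Rightarrow> complex" and \<epsilon> :: real
  assumes "finite A" "n \<ge> 1" "n \<le> card A"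
    and "\<And>A'. A' \<subseteq> A \<Longrightarrow> n \<le> card A' \<Longrightarrow> card A' < 2 * n \<Longrightarrow> norm (\<Sum>x\<in>A'. f x) \<le> \<epsilon> * card A'"
  shows "norm (\<Sum>x\<in>A. f x) \<le> \<epsilon> * card A"
  using assms
proof (induction "card A" arbitrary: A rule: less_induct)
  case less
  show ?case
  proof (cases "card A < 2 * n")
    case False
    obtain A1 where A1: "A1 \<subseteq> A" "card A1 = n"
      using obtain_subset_with_card_n[OF less.prems(3)] by metis
    have fin: "finite A1"
      using A1 less.prems finite_subset by blast
    have cD: "card (A - A1) = card A - n"
      using A1 fin by (simp add: card_Diff_subset)
    have "norm (\<Sum>x\<in>A1. f x) \<le> \<epsilon> * card A1"
      using A1 less.prems(2) by (intro less.prems(4)) auto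
    moreover have "norm (\<Sum>x\<in>A - A1. f x) \<le> \<epsilon> * card (A - A1)"
    proof (rule less.hyps)
      show "card (A - A1) < card A" "n \<le> card (A - A1)" "n \<ge> 1" "finite (A - A1)"
        using less.prems(1-3) False cD by auto
      fix A' assume A': "A' \<subseteq> A - A1" "n \<le> card A'" "card A' < 2 * n"
      then have "A' \<subseteq> A"
        by blast
      then show "norm (\<Sum>x\<in>A'. f x) \<le> \<epsilon> * card A'"
        using A'(2,3) by (rule less.prems(4))
    qed
    moreover have "(\<Sum>x\<in>A. f x) = (\<Sum>x\<in>A - A1. f x) + (\<Sum>x\<in>A1. f x)"
      by (rule sum.subset_diff[OF A1(1) less.prems(1)])
    moreover have "real (card A) = real (card (A - A1)) + real (card A1)"
      using cD A1 False by simp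
    ultimately show ?thesis
      using norm_triangle_ineq[of "\<Sum>x\<in>A - A1. f x" "\<Sum>x\<in>A1. f x"] by (simp add: distrib_left)
  qed (use less.prems in auto)
qed

lemma two_source_bound:
  fixes g :: "int poly"
  assumes g: "degree g \<ge> 2"
  obtains \<delta> \<gamma> C :: real and p0 :: nat where "0 < \<delta>" "\<delta> < 1 / 4" "0 < \<gamma>" "0 < C"
    "\<And>p A B \<alpha> \<beta> \<eta>. prime p \<Longrightarrow> p0 \<le> p \<Longrightarrow> A \<subseteq> {0..<int p} \<Longrightarrow> B \<subseteq> {0..<int p} \<Longrightarrow>
      real p powr (1 / 2 - \<delta>) \<le> real (card A) \<Longrightarrow> real p powr (1 / 2 - \<delta>) \<le> real (card B) \<Longrightarrow>
      \<not> int p dvd \<alpha> \<Longrightarrow> \<not> int p dvd \<beta> \<Longrightarrow>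
      norm (\<Sum>x\<in>A. \<Sum>y\<in>B. echar p (\<alpha> * y * x + \<beta> * poly g y * x\<^sup>2 + \<eta> y)) \<le>
        C * real p powr (- \<gamma>) * real (card A) * real (card B)"
proof -
  obtain \<delta> \<gamma> C :: real and p1 :: nat where *: "0 < \<delta>" "\<delta> < 1 / 4" "0 < \<gamma>" "0 < C"
    and medium: "\<And>p A B \<alpha> \<beta>. prime p \<Longrightarrow> p1 \<le> p \<Longrightarrow> A \<subseteq> {0..<int p} \<Longrightarrow> B \<subseteq> {0..<int p} \<Longrightarrow>
      real p powr (1 / 2 - \<delta>) \<le> real (card A) \<Longrightarrow> (card A)\<^sup>2 \<le> p \<Longrightarrow>
      real p powr (1 / 2 - \<delta>) \<le> real (card B) \<Longrightarrow> (card B)\<^sup>2 \<le> p \<Longrightarrow>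
      \<not> int p dvd \<alpha> \<Longrightarrow> \<not> int p dvd \<beta> \<Longrightarrow>
      (\<Sum>y\<in>B. norm (\<Sum>x\<in>A. echar p (\<alpha> * y * x + \<beta> * poly g y * x\<^sup>2))) \<le> C * real p powr (- \<gamma>) * real (card A) * real (card B)"
    using two_source_medium_sets[OF g] by blast
  have "filterlim (\<lambda>p. real p powr \<delta>) at_top sequentially"
    using * by real_asymp
  then have "eventually (\<lambda>p. 4 \<le> real p powr \<delta>) sequentially"
    by (simp add: filterlim_at_top)
  then obtain p2 where p2: "\<And>p. p2 \<le> p \<Longrightarrow> 4 \<le> real p powr \<delta>"
    by (auto simp: eventually_sequentially)
  have main: "norm (\<Sum>x\<in>A. \<Sum>y\<in>B. echar p (\<alpha> * y * x + \<beta> * poly g y * x\<^sup>2 + \<eta> y)) \<le>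
        C * real p powr (- \<gamma>) * real (card A) * real (card B)"
    if p: "prime p" "max p1 p2 \<le> p" and A: "A \<subseteq> {0..<int p}" and B: "B \<subseteq> {0..<int p}"
      and cA: "real p powr (1 / 2 - \<delta>) \<le> real (card A)" and cB: "real p powr (1 / 2 - \<delta>) \<le> real (card B)"
      and ab: "\<not> int p dvd \<alpha>" "\<not> int p dvd \<beta>" for p A B \<alpha> \<beta> \<eta>
  proof -
    have fin: "finite A" "finite B"
      using A B finite_subset by auto
    have p1: "real p \<ge> 1"
      using prime_ge_1_nat[OF p(1)] by simp
    define x0 where "x0 = real p powr (1 / 2 - \<delta>)"
    define n where "n = nat \<lceil>x0\<rceil>"
    have x0: "x0 \<ge> 1"
      unfolding x0_def using p1 * by (intro ge_one_powr_ge_zero) auto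
    have n: "x0 \<le> real n" "real n < x0 + 1" "n \<ge> 1"
      using x0 unfolding n_def by linarith+
    have nle: "n \<le> k" if "x0 \<le> real k" for k
      using that by (simp add: n_def ceiling_le_iff nat_le_iff)
    have sq: "k\<^sup>2 \<le> p" if k: "k < 2 * n" for k
    proof -
      have "real k \<le> 2 * real n"
        using k by linarith
      also have "\<dots> \<le> x0 * 4"
        using n x0 by linarith
      also have "\<dots> \<le> x0 * real p powr \<delta>"
        using p2[of p] p x0 by (intro mult_left_mono) auto
      also have "\<dots> = real p powr (1 / 2)"
        by (simp add: x0_def flip: powr_add)
      finally have "(real k)\<^sup>2 \<le> (real p powr (1 / 2))\<^sup>2"
        by (intro power_mono) auto
      also have "\<dots> = real p"
        using p1 by (simp add: powr_power)
      finally show ?thesis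
        by (simp flip: of_nat_power)
    qed
    define c where "c x y = echar p (\<alpha> * y * x + \<beta> * poly g y * x\<^sup>2 + \<eta> y)" for x y
    have mid: "norm (\<Sum>x\<in>A'. \<Sum>y\<in>B'. c x y) \<le> (C * real p powr (- \<gamma>) * real (card A')) * real (card B')"
      if A': "A' \<subseteq> A" "n \<le> card A'" "card A' < 2 * n" and B': "B' \<subseteq> B" "n \<le> card B'" "card B' < 2 * n" for A' B'
    proof -
      have "(\<Sum>x\<in>A'. \<Sum>y\<in>B'. c x y) = (\<Sum>y\<in>B'. \<Sum>x\<in>A'. c x y)"
        by (rule sum.swap)
      also have "norm \<dots> \<le> (\<Sum>y\<in>B'. norm (\<Sum>x\<in>A'. c x y))"
        by (rule norm_sum)
      also have "\<dots> = (\<Sum>y\<in>B'. norm (\<Sum>x\<in>A'. echar p (\<alpha> * y * x + \<beta> * poly g y * x\<^sup>2)))"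
        by (simp add: c_def echar_add[of _ _ "\<eta> _"] norm_mult flip: sum_distrib_right)
      also have "\<dots> \<le> C * real p powr (- \<gamma>) * real (card A') * real (card B')"
        using p A B A' B' ab n sq[OF A'(3)] sq[OF B'(3)] unfolding x0_def
        by (intro medium) (auto intro: order_trans)
      finally show ?thesis .
    qed
    have 1: "norm (\<Sum>x\<in>A'. \<Sum>y\<in>B. c x y) \<le> (C * real p powr (- \<gamma>) * real (card B)) * real (card A')"
      if A': "A' \<subseteq> A" "n \<le> card A'" "card A' < 2 * n" for A'
    proof -
      have "norm (\<Sum>y\<in>B. \<Sum>x\<in>A'. c x y) \<le> (C * real p powr (- \<gamma>) * real (card A')) * real (card B)"
      proof (rule norm_sum_le_by_splitting[OF fin(2) n(3)])
        show "n \<le> card B"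
          using cB by (intro nle) (simp add: x0_def)
        fix B' assume "B' \<subseteq> B" "n \<le> card B'" "card B' < 2 * n"
        then show "norm (\<Sum>y\<in>B'. \<Sum>x\<in>A'. c x y) \<le> C * real p powr (- \<gamma>) * real (card A') * real (card B')"
          using mid[OF A'] by (subst sum.swap)
      qed
      then show ?thesis
        by (subst sum.swap) (simp add: mult_ac)
    qed
    have "norm (\<Sum>x\<in>A. \<Sum>y\<in>B. c x y) \<le> (C * real p powr (- \<gamma>) * real (card B)) * real (card A)"
    proof (rule norm_sum_le_by_splitting[OF fin(1) n(3)])
      show "n \<le> card A"
        using cA by (intro nle) (simp add: x0_def)
    qed (rule 1)
    then show ?thesis
      by (simp add: c_def mult_ac)
  qed
  show ?thesis
    by (rule that[of \<delta> \<gamma> C "max p1 p2"]) (use * main in auto)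
qed

section \<open>Fourier coefficients of the sign of the sine\<close>

definition sgn_sine :: "real \<Rightarrow> nat \<Rightarrow> int \<Rightarrow> real" where
  "sgn_sine s p t = sgn_at0 s (sin (2 * pi * real_of_int t / real p))"

definition sgn_sine_hat :: "real \<Rightarrow> nat \<Rightarrow> int \<Rightarrow> complex" where
  "sgn_sine_hat s p r = (\<Sum>t\<in>{0..<int p}. of_real (sgn_sine s p t) * echar p (- (r * t)))"

lemma sgn_sine_inversion:
  assumes p: "p > 0" and t: "t \<in> {0..<int p}"
  shows "of_real (sgn_sine s p t) = (\<Sum>r\<in>{0..<int p}. sgn_sine_hat s p r * echar p (r * t)) / of_nat p"
proof -
  have "(\<Sum>r\<in>{0..<int p}. sgn_sine_hat s p r * echar p (r * t)) =
      (\<Sum>r\<in>{0..<int p}. \<Sum>u\<in>{0..<int p}. of_real (sgn_sine s p u) * echar p (r * (t - u)))"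
    unfolding sgn_sine_hat_def sum_distrib_right
    by (intro sum.cong refl) (simp add: mult.assoc right_diff_distrib flip: echar_add)
  also have "\<dots> = (\<Sum>u\<in>{0..<int p}. of_real (sgn_sine s p u) * (\<Sum>r\<in>{0..<int p}. echar p (r * (t - u))))"
    by (subst sum.swap) (simp add: sum_distrib_left)
  also have "\<dots> = (\<Sum>u\<in>{0..<int p}. if u = t then of_real (sgn_sine s p t) * of_nat p else 0)"
  proof (intro sum.cong refl)
    fix u assume u: "u \<in> {0..<int p}"
    have "int p dvd t - u \<longleftrightarrow> u = t"
      using residues_eqI[OF p order_refl t u] by auto
    then show "of_real (sgn_sine s p u) * (\<Sum>r\<in>{0..<int p}. echar p (r * (t - u))) =
        (if u = t then of_real (sgn_sine s p t) * of_nat p else 0)"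
      using p by (simp add: echar_orthogonality)
  qed
  also have "\<dots> = of_real (sgn_sine s p t) * of_nat p"
    using t by simp
  finally show ?thesis
    using p by simp
qed

lemma norm_geometric_le:
  fixes w :: complex
  assumes "norm w = 1" "w \<noteq> 1"
  shows "norm (\<Sum>k<m. w ^ (a + k)) \<le> 2 / norm (w - 1)"
proof -
  have "(\<Sum>k<m. w ^ (a + k)) = w ^ a * ((w ^ m - 1) / (w - 1))"
    using assms by (simp add: power_add geometric_sum flip: sum_distrib_left)
  then have "norm (\<Sum>k<m. w ^ (a + k)) = norm (w ^ m - 1) / norm (w - 1)"
    using assms by (simp add: norm_mult norm_divide norm_power)
  also have "\<dots> \<le> 2 / norm (w - 1)"
    using norm_triangle_ineq4[of "w ^ m" 1] assms by (intro divide_right_mono) (auto simp: norm_power)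
  finally show ?thesis .
qed

lemma sum_lessThan_odd:
  fixes f :: "nat \<Rightarrow> 'a::comm_monoid_add"
  shows "(\<Sum>k<2 * m + 1. f k) = f 0 + (\<Sum>k<m. f (1 + k)) + (\<Sum>k<m. f (m + 1 + k))"
proof -
  have split: "(\<Sum>k<a + b. g k) = (\<Sum>k<a. g k) + (\<Sum>k<b. g (a + k))" for a b and g :: "nat \<Rightarrow> 'a"
    by (induction b) (simp_all add: ac_simps)
  have "2 * m + 1 = 1 + (m + m)"
    by simp
  then show ?thesis
    by (simp only: split) (simp add: ac_simps)
qed

lemma sgn_sine_values:
  assumes p: "p = 2 * m + 1"
  shows "sgn_sine s p 0 = s" "k < m \<Longrightarrow> sgn_sine s p (int (1 + k)) = 1"
    "k < m \<Longrightarrow> sgn_sine s p (int (m + 1 + k)) = - 1"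
proof -
  show "sgn_sine s p 0 = s"
    by (simp add: sgn_sine_def sgn_at0_def)
  assume k: "k < m"
  have p0: "real p > 0"
    using p by simp
  have pi0: "0 < pi"
    by simp
  have "0 < sin (2 * pi * real (1 + k) / real p)"
  proof (rule sin_gt_zero)
    have "2 * real (1 + k) < real p"
      using k p by simp
    then have "pi * (2 * real (1 + k)) < pi * real p"
      using pi0 by (intro mult_strict_left_mono)
    then show "2 * pi * real (1 + k) / real p < pi"
      using p0 by (simp add: field_simps)
  qed (use p0 in simp)
  then show "sgn_sine s p (int (1 + k)) = 1"
    by (simp add: sgn_sine_def sgn_at0_def)
  have "0 < sin (2 * pi * real (m + 1 + k) / real p - pi)"
  proof (rule sin_gt_zero)
    have "real p < 2 * real (m + 1 + k)" "2 * real (m + 1 + k) < 2 * real p"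
      using k p by simp_all
    then have "pi * real p < pi * (2 * real (m + 1 + k))" "pi * (2 * real (m + 1 + k)) < pi * (2 * real p)"
      using pi0 by (auto intro: mult_strict_left_mono)
    then show "0 < 2 * pi * real (m + 1 + k) / real p - pi" "2 * pi * real (m + 1 + k) / real p - pi < pi"
      using p0 by (simp_all add: field_simps)
  qed
  then have "sin (2 * pi * real (m + 1 + k) / real p) < 0"
    by (simp add: sin_diff)
  then show "sgn_sine s p (int (m + 1 + k)) = - 1"
    by (simp add: sgn_sine_def sgn_at0_def)
qed

text \<open>
  A weak form of Jordan's inequality suffices, as the constant is immaterial below.
\<close>

lemma sin_ge_third:
  fixes x :: real
  assumes "0 \<le> x" "x \<le> pi / 2"
  shows "x / 3 \<le> sin x"
proof -
  have "x \<le> 2"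
    using assms pi_less_4 by linarith
  then have "x\<^sup>2 \<le> 4"
    using power_mono[of x 2 2] assms by simp
  then have "x * x\<^sup>2 \<le> x * 4"
    using assms by (intro mult_left_mono)
  moreover have "\<bar>sin x - (\<Sum>k<3. sin_coeff k * x ^ k)\<bar> \<le> inverse (fact 3) * \<bar>x\<bar> ^ 3"
    by (rule Maclaurin_sin_bound)
  then have "\<bar>sin x - x\<bar> \<le> x * x\<^sup>2 / 6"
    using assms by (simp add: sin_coeff_def eval_nat_numeral field_simps)
  ultimately show ?thesis
    by linarith
qed

lemma norm_echar_minus_1_ge:
  assumes p: "p > 0" and r: "0 < r" "r < int p"
  shows "real_of_int (min r (int p - r)) / real p \<le> norm (echar p r - 1)"
proof -
  define x where "x = pi * real_of_int r / real p"
  have x: "0 < x" "x < pi"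
  proof -
    show "0 < x"
      using p r by (simp add: x_def)
    have "pi * real_of_int r < pi * real p"
      using r by (intro mult_strict_left_mono) auto
    then show "x < pi"
      using p by (simp add: x_def field_simps)
  qed
  have "(norm (cis (2 * x) - 1))\<^sup>2 = (cos (2 * x) - 1)\<^sup>2 + (sin (2 * x))\<^sup>2"
    by (simp add: cmod_power2)
  also have "\<dots> = (2 * sin x)\<^sup>2 * ((sin x)\<^sup>2 + (cos x)\<^sup>2)"
    unfolding cos_double_sin sin_double by (simp add: power2_eq_square distrib_left)
  also have "\<dots> = (2 * sin x)\<^sup>2"
    by simp
  finally have "norm (cis (2 * x) - 1) = 2 * sin x"
    by (rule power2_eq_imp_eq) (use x in \<open>auto simp: sin_ge_zero\<close>)
  then have n: "norm (echar p r - 1) = 2 * sin x"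
    by (simp add: echar_def x_def mult.assoc)
  have sin3: "pi * t / 3 \<le> sin x" if "x = pi * t \<or> pi - x = pi * t" "t \<le> 1 / 2" "t \<ge> 0" for t
  proof -
    have "0 \<le> pi * t" "pi * t \<le> pi / 2"
      using that mult_left_mono[of t "1 / 2" pi] by auto
    then have "pi * t / 3 \<le> sin (pi * t)"
      by (rule sin_ge_third)
    moreover have "sin (pi * t) = sin x"
      using that(1) by (metis sin_pi_minus)
    ultimately show ?thesis
      by simp
  qed
  define q where "q = min r (int p - r)"
  define t where "t = real_of_int q / real p"
  have "2 * q \<le> int p" "0 \<le> q"
    using r by (auto simp: q_def min_def)
  then have "2 * real_of_int q \<le> real p" "0 \<le> real_of_int q"
    by linarith+
  then have t: "t \<le> 1 / 2" "0 \<le> t"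
    using p by (simp_all add: t_def field_simps)
  have "x = pi * t \<or> pi - x = pi * t"
  proof (cases "r \<le> int p - r")
    case True
    then have "q = r"
      by (simp add: q_def)
    then show ?thesis
      by (simp add: x_def t_def)
  next
    case False
    then have "real_of_int q = real p - real_of_int r"
      by (simp add: q_def)
    then have "pi - x = pi * t"
      unfolding x_def t_def using p by (simp add: diff_divide_distrib right_diff_distrib)
    then show ?thesis ..
  qed
  from sin3[OF this t] have "pi * t \<le> 3 * sin x"
    by simp
  moreover have "2 * t \<le> pi * t"
    using t pi_ge_two by (intro mult_right_mono)
  moreover have "0 \<le> sin x"
    using x by (simp add: sin_ge_zero)
  ultimately have "t \<le> 2 * sin x"
    by linarith
  then show ?thesis
    unfolding n t_def q_def .
qed

lemma sgn_sine_hat_0: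
  assumes "p = 2 * m + 1"
  shows "sgn_sine_hat s p 0 = of_real s"
proof -
  have "sgn_sine_hat s p 0 = (\<Sum>k<2 * m + 1. of_real (sgn_sine s p (int k)))"
    using sum_residues_eq[of "\<lambda>t. complex_of_real (sgn_sine s p t)" p] assms by (simp add: sgn_sine_hat_def)
  also have "\<dots> = of_real s"
    unfolding sum_lessThan_odd using sgn_sine_values[OF assms, where s = s] by simp
  finally show ?thesis .
qed

text \<open>
  The sign of the sine is constant on the two halves of the nonzero residues, so the coefficient is a
  difference of two geometric sums, up to the term of the residue \<open>0\<close>.
\<close>

lemma norm_sgn_sine_hat_le:
  assumes p: "p = 2 * m + 1" and s: "s \<in> {-1, 1}" and r: "0 < r" "r < int p"
  shows "norm (sgn_sine_hat s p r) \<le> 5 * real p * (1 / real_of_int r + 1 / real_of_int (int p - r))"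
proof -
  have p0: "p > 0"
    using p by simp
  define w where "w = echar p (- r)"
  have w: "norm w = 1" "norm (w - 1) = norm (echar p r - 1)"
  proof -
    show "norm w = 1"
      by (simp add: w_def)
    have "w - 1 = cnj (echar p r - 1)"
      by (simp add: w_def cnj_echar)
    then show "norm (w - 1) = norm (echar p r - 1)"
      by (simp only: complex_mod_cnj)
  qed
  have "\<not> int p dvd r"
    using r zdvd_not_zless by blast
  then have w1: "w \<noteq> 1"
    using p0 by (simp add: w_def echar_eq_1_iff)
  define \<mu> where "\<mu> = real_of_int (min r (int p - r))"
  have mu: "\<mu> \<ge> 1" "\<mu> \<le> real p" "\<mu> / real p \<le> norm (w - 1)"
    using r norm_echar_minus_1_ge[OF p0 r] by (auto simp: \<mu>_def w)
  have "sgn_sine_hat s p r = (\<Sum>k<2 * m + 1. of_real (sgn_sine s p (int k)) * w ^ k)"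
    using sum_residues_eq[of "\<lambda>t. complex_of_real (sgn_sine s p t) * echar p (- (r * t))" p] p
    by (simp add: sgn_sine_hat_def w_def echar_power mult.commute)
  also have "\<dots> = of_real s + (\<Sum>k<m. w ^ (1 + k)) - (\<Sum>k<m. w ^ (m + 1 + k))"
    unfolding sum_lessThan_odd using sgn_sine_values[OF p, where s = s] by (simp add: sum_negf)
  finally have "norm (sgn_sine_hat s p r) \<le> norm (complex_of_real s) + norm (\<Sum>k<m. w ^ (1 + k)) + norm (\<Sum>k<m. w ^ (m + 1 + k))"
    using norm_triangle_ineq4[of "of_real s + (\<Sum>k<m. w ^ (1 + k))" "\<Sum>k<m. w ^ (m + 1 + k)"]
      norm_triangle_ineq[of "of_real s" "\<Sum>k<m. w ^ (1 + k)"] by simp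
  also have "\<dots> \<le> 1 + 2 / norm (w - 1) + 2 / norm (w - 1)"
    using s by (intro add_mono norm_geometric_le w w1) auto
  also have "\<dots> \<le> 1 + 4 * (real p / \<mu>)"
  proof -
    have "1 / norm (w - 1) \<le> 1 / (\<mu> / real p)"
    proof (intro divide_left_mono mult_pos_pos mu)
      show "0 < \<mu> / real p"
        using mu p0 by (intro divide_pos_pos) auto
      show "0 < norm (w - 1)"
        using w1 by simp
    qed simp
    then show ?thesis
      by simp
  qed
  also have "\<dots> \<le> 5 * (real p / \<mu>)"
  proof -
    have "1 \<le> real p / \<mu>"
      using mu by simp
    then show ?thesis
      by linarith
  qed
  also have "\<dots> \<le> 5 * real p * (1 / real_of_int r + 1 / real_of_int (int p - r))"
  proof -
    have "1 / \<mu> \<le> 1 / real_of_int r + 1 / real_of_int (int p - r)"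
      using r by (auto simp: \<mu>_def min_def)
    then have "5 * real p * (1 / \<mu>) \<le> 5 * real p * (1 / real_of_int r + 1 / real_of_int (int p - r))"
      by (intro mult_left_mono) auto
    then show ?thesis
      by simp
  qed
  finally show ?thesis .
qed

lemma sum_inverse_le_ln:
  assumes "n \<ge> 1"
  shows "(\<Sum>k=1..n. 1 / real k) \<le> 1 + ln (real n)"
  using assms
proof (induction n rule: dec_induct)
  case (step n)
  have "ln (real n / real (Suc n)) \<le> real n / real (Suc n) - 1"
    using step.hyps by (intro ln_le_minus_one) simp
  also have "\<dots> = - (1 / real (Suc n))"
    by (simp add: field_simps)
  finally have "1 / real (Suc n) \<le> ln (real (Suc n)) - ln (real n)"
    using step.hyps by (simp add: ln_div)
  then show ?case
    using step.IH by simp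
qed simp

lemma sum_norm_sgn_sine_hat_le:
  assumes p: "prime p" "p > 2" and s: "s \<in> {-1, 1}"
  shows "(\<Sum>r\<in>{0<..<int p}. norm (sgn_sine_hat s p r)) \<le> 10 * real p * (1 + ln (real p))"
proof -
  have "odd p"
    using p by (simp add: prime_odd_nat)
  then obtain m where m: "p = 2 * m + 1"
    by (elim oddE)
  define H where "H = (\<Sum>r\<in>{0<..<int p}. 1 / real_of_int r)"
  have "H = (\<Sum>k=1..p - 1. 1 / real k)"
    unfolding H_def by (rule sum.reindex_bij_witness[of _ int nat]) auto
  also have "\<dots> \<le> 1 + ln (real (p - 1))"
    using p by (intro sum_inverse_le_ln) simp
  also have "\<dots> \<le> 1 + ln (real p)"
    using p by simp
  finally have H: "H \<le> 1 + ln (real p)" .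
  have "(\<Sum>r\<in>{0<..<int p}. norm (sgn_sine_hat s p r)) \<le>
      (\<Sum>r\<in>{0<..<int p}. 5 * real p * (1 / real_of_int r + 1 / real_of_int (int p - r)))"
    by (intro sum_mono norm_sgn_sine_hat_le[OF m s]) auto
  also have "\<dots> = 5 * real p * (H + (\<Sum>r\<in>{0<..<int p}. 1 / real_of_int (int p - r)))"
    unfolding H_def sum.distrib[symmetric] by (rule sum_distrib_left[symmetric])
  also have "(\<Sum>r\<in>{0<..<int p}. 1 / real_of_int (int p - r)) = H"
    unfolding H_def by (rule sum.reindex_bij_witness[of _ "\<lambda>r. int p - r" "\<lambda>r. int p - r"]) auto
  also have "5 * real p * (H + H) = 10 * real p * H"
    by simp
  also have "\<dots> \<le> 10 * real p * (1 + ln (real p))"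
    using H by (intro mult_left_mono) auto
  finally show ?thesis .
qed

section \<open>The three-source extractor\<close>

lemma few_roots_eventually:
  fixes a :: "int poly"
  assumes "a \<noteq> 0"
  obtains p0 :: nat where "\<And>p. prime p \<Longrightarrow> p0 \<le> p \<Longrightarrow> card {z\<in>{0..<int p}. int p dvd poly a z} \<le> degree a"
proof (rule that[of "Suc (nat \<bar>lead_coeff a\<bar>)"])
  fix p assume p: "prime p" "Suc (nat \<bar>lead_coeff a\<bar>) \<le> p"
  have "\<not> int p dvd lead_coeff a"
  proof
    assume "int p dvd lead_coeff a"
    then have "\<bar>int p\<bar> \<le> \<bar>lead_coeff a\<bar>"
      using assms by (intro dvd_imp_le_int) auto
    then show False
      using p by simp
  qed
  then show "card {z\<in>{0..<int p}. int p dvd poly a z} \<le> degree a"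
    by (rule card_roots_mod_prime[OF p(1)])
qed

text \<open>
  For fixed \<open>z\<close> the term \<open>h\<close> of the polynomial is a phase that depends on \<open>y\<close> alone, and the two-source bound applies unless
  \<open>a\<close> or \<open>b\<close> vanishes at \<open>z\<close> modulo \<open>p\<close>. There are boundedly many such \<open>z\<close>, and \<open>card C\<close> is a power of \<open>p\<close>.
\<close>

lemma exponential_sum_bound:
  fixes a b g :: "int poly" and h :: "int poly poly"
  assumes a: "a \<noteq> 0" and b: "b \<noteq> 0" and g: "degree g \<ge> 2"
  obtains \<delta> \<gamma> K :: real and p0 :: nat where "0 < \<delta>" "\<delta> < 1 / 4" "0 < \<gamma>" "\<gamma> \<le> 1 / 4" "0 < K"
    "\<And>p A B C r. prime p \<Longrightarrow> p0 \<le> p \<Longrightarrow> A \<subseteq> {0..<int p} \<Longrightarrow> B \<subseteq> {0..<int p} \<Longrightarrow> C \<subseteq> {0..<int p} \<Longrightarrow>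
      real p powr (1 / 2 - \<delta>) \<le> real (card A) \<Longrightarrow> real p powr (1 / 2 - \<delta>) \<le> real (card B) \<Longrightarrow>
      real p powr (1 / 2 - \<delta>) \<le> real (card C) \<Longrightarrow> \<not> int p dvd r \<Longrightarrow>
      norm (\<Sum>(x, y, z)\<in>A \<times> B \<times> C. echar p (r * F_eval a b g h x y z)) \<le>
        K * real p powr (- \<gamma>) * (real (card A) * real (card B) * real (card C))"
proof -
  obtain \<delta> \<gamma>0 K0 :: real and p1 :: nat where *: "0 < \<delta>" "\<delta> < 1 / 4" "0 < \<gamma>0" "0 < K0"
    and two: "\<And>p A B \<alpha> \<beta> \<eta>. prime p \<Longrightarrow> p1 \<le> p \<Longrightarrow> A \<subseteq> {0..<int p} \<Longrightarrow> B \<subseteq> {0..<int p} \<Longrightarrow>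
      real p powr (1 / 2 - \<delta>) \<le> real (card A) \<Longrightarrow> real p powr (1 / 2 - \<delta>) \<le> real (card B) \<Longrightarrow>
      \<not> int p dvd \<alpha> \<Longrightarrow> \<not> int p dvd \<beta> \<Longrightarrow>
      norm (\<Sum>x\<in>A. \<Sum>y\<in>B. echar p (\<alpha> * y * x + \<beta> * poly g y * x\<^sup>2 + \<eta> y)) \<le>
        K0 * real p powr (- \<gamma>0) * real (card A) * real (card B)"
    using two_source_bound[OF g] by blast
  obtain p2 where pa: "\<And>p. prime p \<Longrightarrow> p2 \<le> p \<Longrightarrow> card {z\<in>{0..<int p}. int p dvd poly a z} \<le> degree a"
    using few_roots_eventually[OF a] by blast
  obtain p3 where pb: "\<And>p. prime p \<Longrightarrow> p3 \<le> p \<Longrightarrow> card {z\<in>{0..<int p}. int p dvd poly b z} \<le> degree b"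
    using few_roots_eventually[OF b] by blast
  define \<gamma> where "\<gamma> = min \<gamma>0 (1 / 4)"
  define m where "m = degree a + degree b"
  define K where "K = K0 + real m"
  have main: "norm (\<Sum>(x, y, z)\<in>A \<times> B \<times> C. echar p (r * F_eval a b g h x y z)) \<le>
        K * real p powr (- \<gamma>) * (real (card A) * real (card B) * real (card C))"
    if p: "prime p" "max p1 (max p2 p3) \<le> p" and sets: "A \<subseteq> {0..<int p}" "B \<subseteq> {0..<int p}" "C \<subseteq> {0..<int p}"
      and cA: "real p powr (1 / 2 - \<delta>) \<le> real (card A)" and cB: "real p powr (1 / 2 - \<delta>) \<le> real (card B)"
      and cC: "real p powr (1 / 2 - \<delta>) \<le> real (card C)" and r: "\<not> int p dvd r" for p A B C r
  proof -
    have p0: "prime (int p)" "real p \<ge> 1"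
      using p prime_ge_1_nat[OF p(1)] by auto
    have fin: "finite A" "finite B" "finite C"
      using finite_subset[OF sets(1)] finite_subset[OF sets(2)] finite_subset[OF sets(3)] by simp_all
    define AB where "AB = real (card A) * real (card B)"
    have AB: "AB \<ge> 0"
      by (simp add: AB_def)
    define S where "S z = (\<Sum>x\<in>A. \<Sum>y\<in>B. echar p (r * F_eval a b g h x y z))" for z
    define Z where "Z = {z\<in>C. int p dvd poly a z \<or> int p dvd poly b z}"
    have good: "norm (S z) \<le> K0 * real p powr (- \<gamma>0) * AB" if z: "z \<in> C - Z" for z
    proof -
      have ab: "\<not> int p dvd r * poly a z" "\<not> int p dvd r * poly b z"
        using z r p0 by (auto simp: Z_def prime_dvd_mult_iff)
      have "S z = (\<Sum>x\<in>A. \<Sum>y\<in>B. echar p ((r * poly a z) * y * x + (r * poly b z) * poly g y * x\<^sup>2 + r * poly_yz h y z))"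
        unfolding S_def F_eval_def by (intro sum.cong refl arg_cong[where f = "echar p"]) (simp add: algebra_simps)
      then show ?thesis
        using two[OF p(1) _ sets(1,2) cA cB ab, of "\<lambda>y. r * poly_yz h y z"] p(2) by (simp add: AB_def mult.assoc)
    qed
    have trivial: "norm (S z) \<le> AB" for z
    proof -
      have "norm (S z) \<le> (\<Sum>x\<in>A. \<Sum>y\<in>B. norm (echar p (r * F_eval a b g h x y z)))"
        unfolding S_def by (intro order_trans[OF norm_sum] sum_mono norm_sum)
      then show ?thesis
        by (simp add: AB_def)
    qed
    have "Z \<subseteq> {z\<in>{0..<int p}. int p dvd poly a z} \<union> {z\<in>{0..<int p}. int p dvd poly b z}"
      using sets by (auto simp: Z_def)
    then have "card Z \<le> card ({z\<in>{0..<int p}. int p dvd poly a z} \<union> {z\<in>{0..<int p}. int p dvd poly b z})"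
      by (intro card_mono finite_UnI finite_residues_Collect)
    also have "\<dots> \<le> card {z\<in>{0..<int p}. int p dvd poly a z} + card {z\<in>{0..<int p}. int p dvd poly b z}"
      by (rule card_Un_le)
    also have "\<dots> \<le> m"
      unfolding m_def using pa pb p by (intro add_mono) auto
    finally have Z: "card Z \<le> m" .
    have one: "1 \<le> real p powr (- \<gamma>) * real (card C)"
    proof -
      have "1 = real p powr (- \<gamma>) * real p powr \<gamma>"
        using p0 by (simp flip: powr_add)
      also have "\<dots> \<le> real p powr (- \<gamma>) * real p powr (1 / 2 - \<delta>)"
        using p0 * by (intro mult_left_mono powr_mono) (auto simp: \<gamma>_def)
      also have "\<dots> \<le> real p powr (- \<gamma>) * real (card C)"
        using cC by (intro mult_left_mono) auto
      finally show ?thesis .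
    qed
    have "(\<Sum>(x, y, z)\<in>A \<times> B \<times> C. echar p (r * F_eval a b g h x y z)) =
        (\<Sum>x\<in>A. \<Sum>y\<in>B. \<Sum>z\<in>C. echar p (r * F_eval a b g h x y z))"
      by (simp add: sum.cartesian_product)
    also have "\<dots> = (\<Sum>x\<in>A. \<Sum>z\<in>C. \<Sum>y\<in>B. echar p (r * F_eval a b g h x y z))"
      by (intro sum.cong refl sum.swap)
    also have "\<dots> = (\<Sum>z\<in>C. S z)"
      unfolding S_def by (rule sum.swap)
    finally have "norm (\<Sum>(x, y, z)\<in>A \<times> B \<times> C. echar p (r * F_eval a b g h x y z)) = norm (\<Sum>z\<in>C. S z)"
      by simp
    also have "\<dots> \<le> (\<Sum>z\<in>C. norm (S z))"
      by (rule norm_sum)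
    also have "\<dots> = (\<Sum>z\<in>C - Z. norm (S z)) + (\<Sum>z\<in>Z. norm (S z))"
      using fin by (intro sum.subset_diff) (auto simp: Z_def)
    also have "\<dots> \<le> (\<Sum>z\<in>C - Z. K0 * real p powr (- \<gamma>0) * AB) + (\<Sum>z\<in>Z. AB)"
      using good trivial by (intro add_mono sum_mono)
    also have "\<dots> \<le> card C * (K0 * real p powr (- \<gamma>) * AB) + real m * AB"
    proof -
      have "(\<Sum>z\<in>C - Z. K0 * real p powr (- \<gamma>0) * AB) = card (C - Z) * (K0 * real p powr (- \<gamma>0) * AB)"
        by simp
      also have "\<dots> \<le> card C * (K0 * real p powr (- \<gamma>) * AB)"
        using fin AB * p0 by (intro mult_mono mult_right_mono mult_left_mono powr_mono) (auto simp: \<gamma>_def intro!: card_mono)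
      finally have "(\<Sum>z\<in>C - Z. K0 * real p powr (- \<gamma>0) * AB) \<le> card C * (K0 * real p powr (- \<gamma>) * AB)" .
      moreover have "(\<Sum>z\<in>Z. AB) \<le> real m * AB"
        using Z AB by (simp add: mult_right_mono)
      ultimately show ?thesis
        by (rule add_mono)
    qed
    also have "real m * AB \<le> (real m * AB) * (real p powr (- \<gamma>) * real (card C))"
      using one AB mult_left_mono[OF one, of "real m * AB"] by simp
    also have "card C * (K0 * real p powr (- \<gamma>) * AB) + (real m * AB) * (real p powr (- \<gamma>) * real (card C)) =
        K * real p powr (- \<gamma>) * (real (card A) * real (card B) * real (card C))"
      by (simp add: K_def AB_def algebra_simps)
    finally show ?thesis
      by simp
  qed
  show ?thesis
    by (rule that[of \<delta> \<gamma> K "max p1 (max p2 p3)"]) (use * main in \<open>auto simp: \<gamma>_def K_def\<close>)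
qed

text \<open>
  The constant Fourier coefficient contributes \<open>1 / p\<close>, since positive and negative signs balance up
  to the residue \<open>0\<close>. The others have an absolute sum of order \<open>ln p\<close>, which costs half of the
  exponent \<open>\<gamma>\<close>.
\<close>

lemma sine_source_bound:
  fixes a b g :: "int poly" and h :: "int poly poly" and s :: real
  assumes a: "a \<noteq> 0" and b: "b \<noteq> 0" and g: "degree g \<ge> 2" and s: "s \<in> {-1, 1}"
  obtains \<delta> \<gamma> K :: real and p0 :: nat where "0 < \<delta>" "\<delta> < 1 / 4" "0 < \<gamma>" "0 < K"
    "\<And>p A B C. prime p \<Longrightarrow> p0 \<le> p \<Longrightarrow> A \<subseteq> {0..<int p} \<Longrightarrow> B \<subseteq> {0..<int p} \<Longrightarrow> C \<subseteq> {0..<int p} \<Longrightarrow>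
      real p powr (1 / 2 - \<delta>) \<le> real (card A) \<Longrightarrow> real p powr (1 / 2 - \<delta>) \<le> real (card B) \<Longrightarrow>
      real p powr (1 / 2 - \<delta>) \<le> real (card C) \<Longrightarrow>
      \<bar>\<Sum>(x, y, z)\<in>A \<times> B \<times> C. sine_source s (F_eval a b g h) p [x, y, z]\<bar> \<le>
        K * real p powr (- \<gamma>) * real (card A) * real (card B) * real (card C)"
proof -
  obtain \<delta> \<gamma> K :: real and p1 :: nat where *: "0 < \<delta>" "\<delta> < 1 / 4" "0 < \<gamma>" "\<gamma> \<le> 1 / 4" "0 < K"
    and expsum: "\<And>p A B C r. prime p \<Longrightarrow> p1 \<le> p \<Longrightarrow> A \<subseteq> {0..<int p} \<Longrightarrow> B \<subseteq> {0..<int p} \<Longrightarrow> C \<subseteq> {0..<int p} \<Longrightarrow>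
      real p powr (1 / 2 - \<delta>) \<le> real (card A) \<Longrightarrow> real p powr (1 / 2 - \<delta>) \<le> real (card B) \<Longrightarrow>
      real p powr (1 / 2 - \<delta>) \<le> real (card C) \<Longrightarrow> \<not> int p dvd r \<Longrightarrow>
      norm (\<Sum>(x, y, z)\<in>A \<times> B \<times> C. echar p (r * F_eval a b g h x y z)) \<le>
        K * real p powr (- \<gamma>) * (real (card A) * real (card B) * real (card C))"
    using exponential_sum_bound[OF a b g] by blast
  have "eventually (\<lambda>p. 1 + ln (real p) \<le> real p powr (\<gamma> / 2)) sequentially"
    using *(3) by real_asymp
  then obtain p2 where p2: "\<And>p. p2 \<le> p \<Longrightarrow> 1 + ln (real p) \<le> real p powr (\<gamma> / 2)"
    by (auto simp: eventually_sequentially)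
  have main: "\<bar>\<Sum>(x, y, z)\<in>A \<times> B \<times> C. sine_source s (F_eval a b g h) p [x, y, z]\<bar> \<le>
        (1 + 10 * K) * real p powr (- (\<gamma> / 2)) * real (card A) * real (card B) * real (card C)"
    if p: "prime p" "max 3 (max p1 p2) \<le> p" and sets: "A \<subseteq> {0..<int p}" "B \<subseteq> {0..<int p}" "C \<subseteq> {0..<int p}"
      and cA: "real p powr (1 / 2 - \<delta>) \<le> real (card A)" and cB: "real p powr (1 / 2 - \<delta>) \<le> real (card B)"
      and cC: "real p powr (1 / 2 - \<delta>) \<le> real (card C)" for p A B C
  proof -
    have p0: "p > 0" "p > 2" "real p \<ge> 1"
      using p by auto
    let ?R = "{0..<int p}"
    let ?P = "A \<times> B \<times> C"
    define F where "F = (\<lambda>(x, y, z). F_eval a b g h x y z)"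
    define N where "N = real (card A) * real (card B) * real (card C)"
    have N: "N \<ge> 0"
      by (simp add: N_def)
    define E where "E r = (\<Sum>v\<in>?P. echar p (r * F v))" for r
    have "complex_of_real (\<Sum>(x, y, z)\<in>?P. sine_source s (F_eval a b g h) p [x, y, z]) =
        (\<Sum>v\<in>?P. complex_of_real (sgn_sine s p (F v mod int p)))"
      by (simp add: sine_source_def sgn_sine_def F_def case_prod_beta)
    also have "\<dots> = (\<Sum>v\<in>?P. (\<Sum>r\<in>?R. sgn_sine_hat s p r * echar p (r * F v)) / of_nat p)"
    proof (intro sum.cong refl)
      fix v
      have "complex_of_real (sgn_sine s p (F v mod int p)) =
          (\<Sum>r\<in>?R. sgn_sine_hat s p r * echar p (r * (F v mod int p))) / of_nat p"
        using p0 by (intro sgn_sine_inversion) auto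
      also have "(\<Sum>r\<in>?R. sgn_sine_hat s p r * echar p (r * (F v mod int p))) =
          (\<Sum>r\<in>?R. sgn_sine_hat s p r * echar p (r * F v))"
      proof (intro sum.cong refl arg_cong2[where f = "(*)"] echar_cong[OF p0(1)])
        fix r
        show "int p dvd r * (F v mod int p) - r * F v"
          by (simp add: mod_eq_dvd_iff[symmetric] mod_mult_right_eq)
      qed
      finally show "complex_of_real (sgn_sine s p (F v mod int p)) =
          (\<Sum>r\<in>?R. sgn_sine_hat s p r * echar p (r * F v)) / of_nat p" .
    qed
    also have "\<dots> = (\<Sum>r\<in>?R. sgn_sine_hat s p r * E r) / of_nat p"
    proof -
      have "(\<Sum>v\<in>?P. \<Sum>r\<in>?R. sgn_sine_hat s p r * echar p (r * F v)) = (\<Sum>r\<in>?R. sgn_sine_hat s p r * E r)"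
        unfolding E_def by (subst sum.swap) (simp add: sum_distrib_left)
      then show ?thesis
        by (simp flip: sum_divide_distrib)
    qed
    finally have eq: "complex_of_real (\<Sum>(x, y, z)\<in>?P. sine_source s (F_eval a b g h) p [x, y, z]) =
        (\<Sum>r\<in>?R. sgn_sine_hat s p r * E r) / of_nat p" .
    have R: "?R = insert 0 {0<..<int p}"
      using p0 by auto
    have E0: "E 0 = of_real N"
      by (simp add: E_def N_def card_cartesian_product)
    have Er: "norm (E r) \<le> K * real p powr (- \<gamma>) * N" if r: "r \<in> {0<..<int p}" for r
    proof -
      have "\<not> int p dvd r"
        using r zdvd_not_zless[of r "int p"] by auto
      then show ?thesis
        using expsum[OF p(1) _ sets cA cB cC, of r] p(2) by (simp add: E_def F_def N_def case_prod_beta)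
    qed
    have "odd p"
      using p p0 by (simp add: prime_odd_nat)
    then obtain m where m: "p = 2 * m + 1"
      by (elim oddE)
    have s1: "norm (complex_of_real s) = 1"
      using s by auto
    have "norm (\<Sum>r\<in>?R. sgn_sine_hat s p r * E r) \<le> (\<Sum>r\<in>?R. norm (sgn_sine_hat s p r) * norm (E r))"
      by (intro order_trans[OF norm_sum]) (simp add: norm_mult)
    also have "\<dots> = norm (sgn_sine_hat s p 0) * norm (E 0) + (\<Sum>r\<in>{0<..<int p}. norm (sgn_sine_hat s p r) * norm (E r))"
      unfolding R by (subst sum.insert) auto
    also have "norm (sgn_sine_hat s p 0) * norm (E 0) = N"
      unfolding sgn_sine_hat_0[OF m] E0 s1 using N by simp
    also have "(\<Sum>r\<in>{0<..<int p}. norm (sgn_sine_hat s p r) * norm (E r)) \<le>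
        (\<Sum>r\<in>{0<..<int p}. norm (sgn_sine_hat s p r) * (K * real p powr (- \<gamma>) * N))"
      using Er by (intro sum_mono mult_left_mono) auto
    also have "\<dots> = (\<Sum>r\<in>{0<..<int p}. norm (sgn_sine_hat s p r)) * (K * real p powr (- \<gamma>) * N)"
      by (rule sum_distrib_right[symmetric])
    also have "\<dots> \<le> (10 * real p * (1 + ln (real p))) * (K * real p powr (- \<gamma>) * N)"
      using sum_norm_sgn_sine_hat_le[OF p(1) p0(2) s] * N by (intro mult_right_mono) auto
    also have "\<dots> \<le> (10 * real p * real p powr (\<gamma> / 2)) * (K * real p powr (- \<gamma>) * N)"
      using p2[of p] p * N by (intro mult_right_mono mult_left_mono) auto
    also have "\<dots> = real p * (10 * K * real p powr (- (\<gamma> / 2)) * N)"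
    proof -
      have "real p powr (\<gamma> / 2) * real p powr (- \<gamma>) = real p powr (- (\<gamma> / 2))"
        by (simp flip: powr_add)
      then show ?thesis
        by (simp add: mult_ac)
    qed
    also have "N + real p * (10 * K * real p powr (- (\<gamma> / 2)) * N) \<le>
        real p * real p powr (- (\<gamma> / 2)) * N + real p * (10 * K * real p powr (- (\<gamma> / 2)) * N)"
    proof -
      have "1 \<le> real p powr (1 - \<gamma> / 2)"
        using p0 * by (intro ge_one_powr_ge_zero) auto
      also have "\<dots> = real p * real p powr (- (\<gamma> / 2))"
        using p0 powr_add[of "real p" 1 "- (\<gamma> / 2)"] by simp
      finally show ?thesis
        using N mult_right_mono[of 1 "real p * real p powr (- (\<gamma> / 2))" N] by simp
    qed
    finally have "norm (\<Sum>r\<in>?R. sgn_sine_hat s p r * E r) \<le> real p * ((1 + 10 * K) * real p powr (- (\<gamma> / 2)) * N)"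
      by (simp add: algebra_simps)
    then have "norm ((\<Sum>r\<in>?R. sgn_sine_hat s p r * E r) / of_nat p) \<le> (1 + 10 * K) * real p powr (- (\<gamma> / 2)) * N"
      using p0 by (simp add: norm_divide divide_le_eq mult.commute)
    then show ?thesis
      unfolding eq[symmetric] norm_of_real by (simp add: N_def mult.assoc)
  qed
  show ?thesis
    by (rule that[of \<delta> "\<gamma> / 2" "1 + 10 * K" "max 3 (max p1 p2)"]) (use * main in auto)
qed

lemma sum_listset_3: "(\<Sum>v\<in>listset [A, B, C]. f v) = (\<Sum>(x, y, z)\<in>A \<times> B \<times> C. f [x, y, z])"
  by (rule sum.reindex_bij_witness[of _ "\<lambda>(x, y, z). [x, y, z]" "\<lambda>v. (v ! 0, v ! 1, v ! 2)"])
    (auto simp: set_Cons_def)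

lemma eventually_primes_at_top:
  "eventually P primes_at_top \<longleftrightarrow> (\<exists>p0. \<forall>p\<ge>p0. prime p \<longrightarrow> P p)"
  by (simp add: primes_at_top_def eventually_inf_principal eventually_at_top_linorder)

theorem corollary11:
  fixes a b g :: "int poly" and h :: "int poly poly" and s :: real
    and f :: "nat \<Rightarrow> int list \<Rightarrow> real"
  assumes "a \<noteq> 0" and "b \<noteq> 0" and "degree g \<ge> 2"
    and "s \<in> {-1, 1}"
  defines "f \<equiv> sine_source s (F_eval a b g h)"
  shows "\<exists>\<delta>>0. entropy 3 f \<le> 1 / 2 - \<delta> \<and>
    (\<forall>\<alpha>\<in>{1 / 2 - \<delta><..<1}. \<exists>\<gamma>>0. \<forall>L1 L2. 0 < L1 \<and> L1 \<le> L2 \<longrightarrow>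
      (\<exists>K. \<forall>\<^sub>F p in primes_at_top. \<forall>A B C.
        (\<forall>S\<in>{A, B, C}. S \<subseteq> prime_field p \<and>
           L1 * real p powr \<alpha> \<le> real (card S) \<and> real (card S) \<le> L2 * real p powr \<alpha>) \<longrightarrow>
        \<bar>\<Sum>(x, y, z)\<in>A \<times> B \<times> C. f p [x, y, z]\<bar>
          \<le> K * real p powr (- \<gamma>) * real (card A) * real (card B) * real (card C)))"
proof -
  obtain \<delta> \<gamma> K :: real and p0 :: nat where *: "0 < \<delta>" "\<delta> < 1 / 4" "0 < \<gamma>" "0 < K"
    and main: "\<And>p A B C. prime p \<Longrightarrow> p0 \<le> p \<Longrightarrow> A \<subseteq> {0..<int p} \<Longrightarrow> B \<subseteq> {0..<int p} \<Longrightarrow> C \<subseteq> {0..<int p} \<Longrightarrow>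
      real p powr (1 / 2 - \<delta>) \<le> real (card A) \<Longrightarrow> real p powr (1 / 2 - \<delta>) \<le> real (card B) \<Longrightarrow>
      real p powr (1 / 2 - \<delta>) \<le> real (card C) \<Longrightarrow>
      \<bar>\<Sum>(x, y, z)\<in>A \<times> B \<times> C. f p [x, y, z]\<bar> \<le>
        K * real p powr (- \<gamma>) * real (card A) * real (card B) * real (card C)"
    unfolding f_def using sine_source_bound[OF assms(1-4)] by metis
  have carrier: "prime_field p = {0..<int p}" for p
    by (auto simp: residue_ring_def)
  have cancel: "cancels_at 3 f (1 / 2 - \<delta>)"
    unfolding cancels_at_def
  proof (intro allI impI)
    fix \<epsilon> :: real assume eps: "\<epsilon> > 0"
    have "eventually (\<lambda>p. K * real p powr (- \<gamma>) \<le> \<epsilon>) sequentially"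
      using * eps by real_asymp
    then obtain p1 where p1: "\<And>p. p1 \<le> p \<Longrightarrow> K * real p powr (- \<gamma>) \<le> \<epsilon>"
      by (auto simp: eventually_sequentially)
    show "\<forall>\<^sub>F p in primes_at_top. \<forall>As. length As = 3 \<and>
        (\<forall>A\<in>set As. A \<subseteq> prime_field p \<and> real p powr (1 / 2 - \<delta>) \<le> real (card A)) \<longrightarrow>
        \<bar>\<Sum>v\<in>listset As. f p v\<bar> \<le> \<epsilon> * (\<Prod>A\<leftarrow>As. real (card A))"
      unfolding eventually_primes_at_top
    proof (intro exI[of _ "max p0 p1"] allI impI, elim conjE)
      fix p and As :: "int set list"
      assume p: "max p0 p1 \<le> p" "prime p" and len: "length As = 3"
        and As: "\<forall>A\<in>set As. A \<subseteq> prime_field p \<and> real p powr (1 / 2 - \<delta>) \<le> real (card A)"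
      obtain A B C where ABC: "As = [A, B, C]"
        using len by (auto simp: length_Suc_conv eval_nat_numeral)
      have "\<bar>\<Sum>v\<in>listset As. f p v\<bar> \<le> K * real p powr (- \<gamma>) * real (card A) * real (card B) * real (card C)"
        unfolding ABC sum_listset_3 using As p by (intro main) (auto simp: ABC carrier)
      also have "\<dots> \<le> \<epsilon> * real (card A) * real (card B) * real (card C)"
        using p1[of p] p by (intro mult_right_mono) auto
      finally show "\<bar>\<Sum>v\<in>listset As. f p v\<bar> \<le> \<epsilon> * (\<Prod>A\<leftarrow>As. real (card A))"
        by (simp add: ABC mult.assoc)
    qed
  qed
  have "entropy 3 f \<le> 1 / 2 - \<delta>"
    unfolding entropy_def using cancel *
    by (intro cInf_lower bdd_belowI[of _ 0]) auto
  moreover have "\<exists>\<gamma>>0. \<forall>L1 L2. 0 < L1 \<and> L1 \<le> L2 \<longrightarrow>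
      (\<exists>K. \<forall>\<^sub>F p in primes_at_top. \<forall>A B C.
        (\<forall>S\<in>{A, B, C}. S \<subseteq> prime_field p \<and>
           L1 * real p powr \<alpha> \<le> real (card S) \<and> real (card S) \<le> L2 * real p powr \<alpha>) \<longrightarrow>
        \<bar>\<Sum>(x, y, z)\<in>A \<times> B \<times> C. f p [x, y, z]\<bar>
          \<le> K * real p powr (- \<gamma>) * real (card A) * real (card B) * real (card C))"
    if \<alpha>: "\<alpha> \<in> {1 / 2 - \<delta><..<1}" for \<alpha>
  proof (rule exI[of _ \<gamma>], intro conjI allI impI)
    show "\<gamma> > 0"
      by (rule *(3))
    fix L1 L2 :: real assume "0 < L1 \<and> L1 \<le> L2"
    then have L1: "0 < L1" ..
    have "eventually (\<lambda>p. real p powr (1 / 2 - \<delta>) \<le> L1 * real p powr \<alpha>) sequentially"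
      using \<alpha> L1 by real_asymp
    then obtain p1 where p1: "\<And>p. p1 \<le> p \<Longrightarrow> real p powr (1 / 2 - \<delta>) \<le> L1 * real p powr \<alpha>"
      by (auto simp: eventually_sequentially)
    show "\<exists>K. \<forall>\<^sub>F p in primes_at_top. \<forall>A B C.
        (\<forall>S\<in>{A, B, C}. S \<subseteq> prime_field p \<and>
           L1 * real p powr \<alpha> \<le> real (card S) \<and> real (card S) \<le> L2 * real p powr \<alpha>) \<longrightarrow>
        \<bar>\<Sum>(x, y, z)\<in>A \<times> B \<times> C. f p [x, y, z]\<bar>
          \<le> K * real p powr (- \<gamma>) * real (card A) * real (card B) * real (card C)"
      unfolding eventually_primes_at_top
    proof (rule exI[of _ K], rule exI[of _ "max p0 p1"], intro allI impI)
      fix p A B C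
      assume p: "max p0 p1 \<le> p" "prime p" and S: "\<forall>S\<in>{A, B, C}. S \<subseteq> prime_field p \<and>
           L1 * real p powr \<alpha> \<le> real (card S) \<and> real (card S) \<le> L2 * real p powr \<alpha>"
      have "real p powr (1 / 2 - \<delta>) \<le> L1 * real p powr \<alpha>"
        using p1 p by simp
      then show "\<bar>\<Sum>(x, y, z)\<in>A \<times> B \<times> C. f p [x, y, z]\<bar>
          \<le> K * real p powr (- \<gamma>) * real (card A) * real (card B) * real (card C)"
        using S p by (intro main) (auto simp: carrier)
    qed
  qed
  ultimately show ?thesis
    using * by blast
qed

end
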